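(* Let $T$ be a finite modification of a quasi-lift $T_o$ of an expanding circle map, and suppose $T$ verifies (A1)-(A7) (see context). Let $\mu_o$ be the measure preserved by $T_o$. If $T$ is Markov-indecomposable and preserves a Lebesgue-equivalent measure $\mu$ such that $\overline\mu=\overline\mu_o$, then $T$ is: (a) mixing of type (GLM1) for any $\mathcal G\subset L^\infty$ and $\mathcal L=L^1$; i.e. for all $F\in L^\infty(\mathbb R,\mu)$ and $g\in L^1(\mathbb R,\mu)$ with $\int g\,d\mu=0$, $\lim_{n\to\infty}\int_{\mathbb R}(F\circ T^n)g\,d\mu=0$; (b) mixing of type (GGM1) w.r.t. $\mathcal G_2$; i.e. for all $F,G\in\mathcal G_2$, $\overline\mu((F\circ T^n)G)$ exists for all sufficiently large $n$, and $\lim_{n\to\infty}\overline\mu((F\circ T^n)G)=\overline\mu(F)\,\overline\mu(G)$.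
   Context: Conventions: $m$ is Lebesgue measure; set relations are modulo $m$-null sets; $\mathbb N=\{0,1,\dots\}$, $\mathbb Z^+=\{1,2,\dots\}$; measures are $\sigma$-finite Borel measures; functions are complex-valued. "Lebesgue-equivalent" means mutually absolutely continuous with $m$. Quasi-lift: fix $a>0$, $a_j:=aj$, $I_j:=[aj,a(j+1)]$. Let $\tau_0:I_0\to J_0$ be bijective, twice differentiable with bounded second derivative, expanding ($|\tau_0'|\ge\lambda>1$), with $J_0=[ak_{1,0},a(k_{2,0}+1)]$, integers $k_{1,0}\le0\le k_{2,0}$. The quasi-lift is $T_o(x):=\tau_0(x-aj)+aj$ for $x$ in the interior of $I_j$. With $\sigma(x):=x+a$, $T_o\circ\sigma=\sigma\circ T_o$. The circle map $T_o\bmod a$ on $[0,a)$ has a finite invariant measure equivalent to Lebesgue; $\mu_o$ is its $\sigma$-invariant extension to $\mathbb R$, which is $T_o$-invariant. Finite modification: $T:\mathbb R\to\mathbb R$ such that for some $k_o\in\mathbb Z^+$, $T(x)=T_o(x)$ for all $x\notin\bigsqcup_{j=-k_o}^{k_o}I_j$. Assumptions on $T$ (surjective, relative to the partition $\{I_j\}$): (A1) $\exists\theta>0$: $0<a_{j+1}-a_j\le\theta$ for all $j$; (A2) $T|_{(a_j,a_{j+1})}$ has a unique extension $\tau_j:I_j\to J_j$, twice differentiable and bijective onto a finite union $J_j$ of consecutive Markov intervals $I_k$; (A3) $\exists\lambda>1$: $|\tau_j'|\ge\lambda$ for all $j$; (A4) $\exists\eta>0$: $|\tau_j''/(\tau_j')^2|\le\eta$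 for all $j$; (A5) $\exists\rho>0$: $|T(x)-x|\le\rho$ for $x\in\mathcal I_{\mathcal D}$; (A6) $\exists\theta_o\in(0,\theta)$: $a_{j+1}-a_j\ge\theta_o$ whenever $m(I_j\cap\mathcal I_{\mathcal D})>0$; (A7) $TI_j\supset I_j$ whenever $m(I_j\cap\mathcal I_{\mathcal D})>0$. Here $\mathcal D$ is the dissipative part of $T$ (measurable union of all wandering sets, i.e. sets $W$ with $T^{-n}W$, $n\in\mathbb N$, pairwise disjoint), $\mathcal C:=\mathbb R\setminus\mathcal D$, $\mathcal I(A):=\bigcup_{k\in\mathbb Z^+}\bigcup_{n\in\mathbb N}T^{-k}T^nA$, and $\mathcal I_{\mathcal D}:=\mathcal I(\mathcal D)\setminus\mathcal I(\mathcal C)$. Markov-indecomposable: the undirected graph on $\mathbb Z$ with an edge between $j$ and $k$ iff $TI_j\supseteq I_k$ or $TI_k\supseteq I_j$ is connected. Infinite-volume average: for a measure $\nu$ on $\mathbb R$ with $\nu(\mathbb R)=\infty$ and bounded $F$, $\overline\nu(F):=\lim_{r\to\infty}\frac1{\nu([x_0-r,x_0+r])}\int_{x_0-r}^{x_0+r}F\,d\nu$, provided the limit exists uniformly in $x_0\in\mathbb R$ and is independent of $x_0$; then $F$ is a global observable. For two $\sigma$-finite infinite measures, $\overline\mu=\overline\mu_o$ means: for all bounded $F:\mathbb R\to\mathbb C$, $\overline\mu(F)$ exists iff $\overline\mu_o(F)$ does, and they are equal. $\mathcal G_2:=\overline{\mathrm{span}_{\mathbb C}\{F\in L^\infty:\exists\beta\in\mathbb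 R,\ F\circ\sigma=e^{ia\beta}F\}}$, closure in the $L^\infty$-norm. *)

theory Defs
  imports "HOL-Analysis.Analysis" "HOL-Library.Real_Mod"
begin

text \<open>
  Lebesgue measure is \<^const>\<open>lborel\<close>. Relations between sets are understood modulo Lebesgue-null
  sets throughout, and essentially bounded or integrable functions are represented by Borel
  functions. Maps of the line are total functions, but their values at the (countably many)
  endpoints of the partition intervals are left arbitrary.
\<close>

definition twice_differentiable_with ::
    "(real \<Rightarrow> real) \<Rightarrow> (real \<Rightarrow> real) \<Rightarrow> (real \<Rightarrow> real) \<Rightarrow> real set \<Rightarrow> bool" where
  "twice_differentiable_with f f' f'' S \<longleftrightarrow>
     (\<forall>x\<in>S. (f has_real_derivative f' x) (at x within S) \<and>
            (f' has_real_derivative f'' x) (at x within S))"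

definition partition_interval :: "(int \<Rightarrow> real) \<Rightarrow> int \<Rightarrow> real set" where
  "partition_interval c j = {c j .. c (j + 1)}"

definition null_subset :: "real set \<Rightarrow> real set \<Rightarrow> bool" where
  "null_subset A B \<longleftrightarrow> A - B \<in> null_sets lborel"

definition preserves_measure :: "('a \<Rightarrow> 'a) \<Rightarrow> 'a measure \<Rightarrow> bool" where
  "preserves_measure T M \<longleftrightarrow> T \<in> measurable M M \<and> distr M M T = M"

definition lebesgue_equivalent :: "real measure \<Rightarrow> bool" where
  "lebesgue_equivalent M \<longleftrightarrow>
     sets M = sets borel \<and> absolutely_continuous M lborel \<and> absolutely_continuous lborel M"


section \<open>Quasi-lifts and finite modifications\<close>

definition uniform_partition :: "real \<Rightarrow> int \<Rightarrow> real" where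
  "uniform_partition a j = a * of_int j"

definition quasi_lift_branch :: "real \<Rightarrow> (real \<Rightarrow> real) \<Rightarrow> bool" where
  "quasi_lift_branch a \<tau> \<longleftrightarrow>
     (\<exists>k\<^sub>1 k\<^sub>2 :: int. k\<^sub>1 \<le> 0 \<and> 0 \<le> k\<^sub>2 \<and> bij_betw \<tau> {0..a} {a * of_int k\<^sub>1 .. a * (of_int k\<^sub>2 + 1)}) \<and>
     (\<exists>\<tau>' \<tau>''. twice_differentiable_with \<tau> \<tau>' \<tau>'' {0..a} \<and>
        (\<exists>B. \<forall>x\<in>{0..a}. \<bar>\<tau>'' x\<bar> \<le> B) \<and>
        (\<exists>l>1. \<forall>x\<in>{0..a}. \<bar>\<tau>' x\<bar> \<ge> l))"

definition quasi_lift :: "real \<Rightarrow> (real \<Rightarrow> real) \<Rightarrow> bool" where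
  "quasi_lift a T\<^sub>o \<longleftrightarrow> a > 0 \<and>
     (\<exists>\<tau>. quasi_lift_branch a \<tau> \<and>
        (\<forall>j::int. \<forall>x\<in>{a * of_int j <..< a * (of_int j + 1)}.
            T\<^sub>o x = \<tau> (x - a * of_int j) + a * of_int j))"

text \<open>
  The measure preserved by a quasi-lift: a translation-invariant measure on the line whose
  restriction to the fundamental domain is a finite measure, equivalent to Lebesgue measure and
  invariant for the circle map. It is determined up to a positive factor, which does not affect
  averages.
\<close>

definition quasi_lift_measure :: "real \<Rightarrow> (real \<Rightarrow> real) \<Rightarrow> real measure \<Rightarrow> bool" where
  "quasi_lift_measure a T\<^sub>o M \<longleftrightarrow>
     sets M = sets borel \<and>
     preserves_measure (\<lambda>x. x + a) M \<and>
     emeasure M {0..<a} < \<infinity> \<and>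
     null_sets (restrict_space M {0..<a}) = null_sets (restrict_space lborel {0..<a}) \<and>
     preserves_measure (\<lambda>x. T\<^sub>o x rmod a) (restrict_space M {0..<a})"

definition finite_modification :: "real \<Rightarrow> (real \<Rightarrow> real) \<Rightarrow> (real \<Rightarrow> real) \<Rightarrow> bool" where
  "finite_modification a T\<^sub>o T \<longleftrightarrow>
     (\<exists>k::int. k \<ge> 1 \<and>
        (\<forall>x. x \<notin> (\<Union>j\<in>{-k..k}. partition_interval (uniform_partition a) j) \<longrightarrow> T x = T\<^sub>o x))"


section \<open>Dissipative part and Markov maps\<close>

definition wandering :: "(real \<Rightarrow> real) \<Rightarrow> real set \<Rightarrow> bool" where
  "wandering T W \<longleftrightarrow> W \<in> sets lborel \<and>
     (\<forall>i j::nat. i \<noteq> j \<longrightarrow> (T ^^ i) -` W \<inter> (T ^^ j) -` W \<in> null_sets lborel)"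

text \<open>
  The measurable union of a family is its least upper bound among measurable sets modulo null
  sets. It exists for every family of measurable sets and is unique modulo null sets.
\<close>

definition is_measurable_union :: "real set set \<Rightarrow> real set \<Rightarrow> bool" where
  "is_measurable_union \<W> D \<longleftrightarrow> D \<in> sets lborel \<and>
     (\<forall>W\<in>\<W>. null_subset W D) \<and>
     (\<forall>E\<in>sets lborel. (\<forall>W\<in>\<W>. null_subset W E) \<longrightarrow> null_subset D E)"

definition is_dissipative_part :: "(real \<Rightarrow> real) \<Rightarrow> real set \<Rightarrow> bool" where
  "is_dissipative_part T D \<longleftrightarrow> is_measurable_union {W. wandering T W} D"

definition orbit_saturation :: "(real \<Rightarrow> real) \<Rightarrow> real set \<Rightarrow> real set" where
  "orbit_saturation T A = (\<Union>k\<in>{1::nat..}. \<Union>n::nat. (T ^^ k) -` ((T ^^ n) ` A))"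

definition dissipative_core :: "(real \<Rightarrow> real) \<Rightarrow> real set \<Rightarrow> real set" where
  "dissipative_core T D = orbit_saturation T D - orbit_saturation T (- D)"

text \<open>
  The \<open>\<tau> j\<close> extends the \<open>j\<close>-th branch to the closed interval; it is unique there by continuity,
  and so are its derivatives. The set \<open>D\<close> is unique modulo null sets, and every condition
  involving it is insensitive to null sets.
\<close>

definition expanding_markov_map :: "(int \<Rightarrow> real) \<Rightarrow> (real \<Rightarrow> real) \<Rightarrow> bool" where
  "expanding_markov_map c T \<longleftrightarrow>
     null_subset UNIV (range T) \<and>
     (\<exists>\<tau> \<tau>' \<tau>'' D \<theta> l \<eta> \<rho> \<theta>\<^sub>o.
        is_dissipative_part T D \<and>
        \<theta> > 0 \<and> (\<forall>j. 0 < c (j + 1) - c j \<and> c (j + 1) - c j \<le> \<theta>) \<and>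
        (\<forall>j. (\<forall>x\<in>{c j <..< c (j + 1)}. \<tau> j x = T x) \<and>
             twice_differentiable_with (\<tau> j) (\<tau>' j) (\<tau>'' j) (partition_interval c j) \<and>
             (\<exists>p q. bij_betw (\<tau> j) (partition_interval c j)
                       (\<Union>k\<in>{p..q}. partition_interval c k))) \<and>
        l > 1 \<and> (\<forall>j. \<forall>x\<in>partition_interval c j. \<bar>\<tau>' j x\<bar> \<ge> l) \<and>
        \<eta> > 0 \<and> (\<forall>j. \<forall>x\<in>partition_interval c j. \<bar>\<tau>'' j x / (\<tau>' j x)\<^sup>2\<bar> \<le> \<eta>) \<and>
        \<rho> > 0 \<and> (AE x in lborel. x \<in> dissipative_core T D \<longrightarrow> \<bar>T x - x\<bar> \<le> \<rho>) \<and>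
        0 < \<theta>\<^sub>o \<and> \<theta>\<^sub>o < \<theta> \<and>
        (\<forall>j. emeasure lborel (partition_interval c j \<inter> dissipative_core T D) > 0 \<longrightarrow>
               c (j + 1) - c j \<ge> \<theta>\<^sub>o \<and>
               null_subset (partition_interval c j) (T ` partition_interval c j)))"

definition markov_edges :: "(int \<Rightarrow> real) \<Rightarrow> (real \<Rightarrow> real) \<Rightarrow> (int \<times> int) set" where
  "markov_edges c T =
     {(j, k). null_subset (partition_interval c k) (T ` partition_interval c j) \<or>
              null_subset (partition_interval c j) (T ` partition_interval c k)}"

definition markov_indecomposable :: "(int \<Rightarrow> real) \<Rightarrow> (real \<Rightarrow> real) \<Rightarrow> bool" where
  "markov_indecomposable c T \<longleftrightarrow> (\<forall>j k. (j, k) \<in> (markov_edges c T)\<^sup>*)"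


section \<open>Infinite-volume averages\<close>

text \<open>
  The finiteness conjunct makes the averages well-defined quotients; without it, an interval of
  infinite measure would silently contribute the value 0.
\<close>

definition has_infinite_volume_average :: "real measure \<Rightarrow> (real \<Rightarrow> complex) \<Rightarrow> complex \<Rightarrow> bool" where
  "has_infinite_volume_average M F L \<longleftrightarrow>
     (\<forall>x\<^sub>0 r. emeasure M {x\<^sub>0 - r .. x\<^sub>0 + r} < \<infinity>) \<and>
     uniform_limit UNIV
       (\<lambda>r x\<^sub>0. (LINT x:{x\<^sub>0 - r .. x\<^sub>0 + r}|M. F x) / of_real (measure M {x\<^sub>0 - r .. x\<^sub>0 + r}))
       (\<lambda>_. L) at_top"

definition average_exists :: "real measure \<Rightarrow> (real \<Rightarrow> complex) \<Rightarrow> bool" where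
  "average_exists M F \<longleftrightarrow> (\<exists>L. has_infinite_volume_average M F L)"

definition average :: "real measure \<Rightarrow> (real \<Rightarrow> complex) \<Rightarrow> complex" where
  "average M F = (THE L. has_infinite_volume_average M F L)"

definition same_averages :: "real measure \<Rightarrow> real measure \<Rightarrow> bool" where
  "same_averages M N \<longleftrightarrow>
     emeasure M UNIV = \<infinity> \<and> emeasure N UNIV = \<infinity> \<and>
     (\<forall>F \<in> borel_measurable borel. bounded (range F) \<longrightarrow>
        (average_exists M F \<longleftrightarrow> average_exists N F) \<and>
        (average_exists M F \<longrightarrow> average M F = average N F))"


section \<open>Observables and mixing\<close>

definition L_infinity :: "real measure \<Rightarrow> (real \<Rightarrow> complex) set" where
  "L_infinity M = {F \<in> borel_measurable M. \<exists>B. AE x in M. norm (F x) \<le> B}"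

definition L_one :: "real measure \<Rightarrow> (real \<Rightarrow> complex) set" where
  "L_one M = {g. integrable M g}"

definition complex_span :: "(real \<Rightarrow> complex) set \<Rightarrow> (real \<Rightarrow> complex) set" where
  "complex_span S = {(\<lambda>x. \<Sum>i<n. z i * f i x) | (n::nat) z f. \<forall>i<n. f i \<in> S}"

definition L_infinity_closure :: "(real \<Rightarrow> complex) set \<Rightarrow> (real \<Rightarrow> complex) set" where
  "L_infinity_closure S =
     {F \<in> L_infinity lborel. \<forall>\<epsilon>>0. \<exists>H\<in>S. AE x in lborel. norm (F x - H x) \<le> \<epsilon>}"

definition translation_eigenfunctions :: "real \<Rightarrow> (real \<Rightarrow> complex) set" where
  "translation_eigenfunctions a =
     {F \<in> L_infinity lborel. \<exists>\<beta>::real. AE x in lborel. F (x + a) = exp (\<i> * of_real (a * \<beta>)) * F x}"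

definition G2 :: "real \<Rightarrow> (real \<Rightarrow> complex) set" where
  "G2 a = L_infinity_closure (complex_span (translation_eigenfunctions a))"

definition GLM1 ::
    "(real \<Rightarrow> real) \<Rightarrow> real measure \<Rightarrow> (real \<Rightarrow> complex) set \<Rightarrow> (real \<Rightarrow> complex) set \<Rightarrow> bool" where
  "GLM1 T M \<G> \<L> \<longleftrightarrow>
     (\<forall>F\<in>\<G>. \<forall>g\<in>\<L>. (LINT x|M. g x) = 0 \<longrightarrow>
        (\<lambda>n. LINT x|M. F ((T ^^ n) x) * g x) \<longlonglongrightarrow> 0)"

definition GGM1 :: "(real \<Rightarrow> real) \<Rightarrow> real measure \<Rightarrow> (real \<Rightarrow> complex) set \<Rightarrow> bool" where
  "GGM1 T M \<G> \<longleftrightarrow>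
     (\<forall>F\<in>\<G>. average_exists M F) \<and>
     (\<forall>F\<in>\<G>. \<forall>G\<in>\<G>.
        (\<forall>\<^sub>F n in sequentially. average_exists M (\<lambda>x. F ((T ^^ n) x) * G x)) \<and>
        (\<lambda>n. average M (\<lambda>x. F ((T ^^ n) x) * G x)) \<longlonglongrightarrow> average M F * average M G)"

end

theory Submission
  imports Defs "HOL-Probability.Conditional_Expectation"
begin

text \<open>
  Part (a) is exactness. Along the cylinders of an expanding Markov map with bounded distortion, the
  images of a set of positive measure eventually fill whole cells. Applied to \<open>A - T\<^sup>-\<^sup>1 A\<close> for a tail
  set \<open>A\<close>, this makes \<open>A\<close> invariant, because far out every cell is mapped over itself. For an invariant
  set and its complement it leaves three possibilities. If typical orbits of both reach the same end of
  the line, both sets would fill a common cell. If an orbit keeps returning to a cell, that cell and all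
  its successors are filled; by indecomposability such a family of cells is entered from outside, and
  since the preserved measure is finite on bounded sets, Borel--Cantelli sends almost all entering
  orbits to infinity. Finally, orbits of positive measure cannot escape to both ends, as the
  translation-equivariant map admits only one of the two directions. Hence the tail is trivial, and
  reverse \<open>L\<^sup>2\<close>-martingale convergence gives mixing.

  For part (b), exactness is applied to the quasi-lift itself. Averages of eigenfunctions of the
  translation are integrals over one period, and correlations of eigenfunctions are local
  correlations, which converge by exactness; a nontrivial eigenvalue is dealt with by testing against
  \<open>u - u \<circ> \<sigma>\<^sup>-\<^sup>1\<close>, which has mean zero. For fixed \<open>n\<close> the \<open>n\<close>-th iterates of the map and of the quasi-lift
  agree outside a bounded set, so that they have the same averages.
\<close>

section \<open>Density points along refining partitions\<close>

text \<open>The preserved measure is infinite and nothing is known about recurrence, so typical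
  orbits are examined one at a time, with Lebesgue measure: at time \<open>n\<close> the orbit of a
  density point sees the image set fill its current cell up to an error tending to 0. In a cell
  visited infinitely often the error is then 0. An orbit that runs off to infinity keeps no cell,
  and its small error has to be moved to a cell chosen in advance. Each move along an edge
  multiplies the error by at most the slope bound \<open>B\<close>, and the number of moves is
  bounded by the jump size, because beyond the modified region all cells have the same outgoing
  edges up to translation. Of the preserved measure the geometric part uses its null sets, its
  invariance and its finiteness on bounded sets; the last property is extracted from the equality of
  averages. The arbitrary values at endpoints are removed by passing to maps with the same orbits
  almost everywhere.\<close>

lemma AE_fibre_density:
  fixes \<pi> :: "nat \<Rightarrow> real \<Rightarrow> 'i::countable"
  assumes meas: "\<And>n c. {y. \<pi> n y = c} \<in> sets borel"
    and refine: "\<And>m n x y. m \<le> n \<Longrightarrow> \<pi> n x = \<pi> n y \<Longrightarrow> \<pi> m x = \<pi> m y"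
    and diam: "\<And>n x y. \<pi> n x = \<pi> n y \<Longrightarrow> \<bar>x - y\<bar> \<le> \<delta> n"
    and \<delta>: "\<delta> \<longlonglongrightarrow> 0"
    and A[measurable]: "A \<in> sets borel"
  shows "AE x in lborel. x \<in> A \<longrightarrow> (\<forall>\<epsilon>>0. \<forall>\<^sub>F n in sequentially.
    measure lborel ({y. \<pi> n y = \<pi> n x} - A) \<le> \<epsilon> * measure lborel {y. \<pi> n y = \<pi> n x})"
proof -
  define F where "F n x = {y. \<pi> n y = \<pi> n x}" for n x
  have F_meas[measurable]: "F n x \<in> sets borel" for n x
    unfolding F_def by (rule meas)
  have F_fin: "emeasure lborel (F n x) < \<infinity>" for n x
  proof -
    have "F n x \<subseteq> {x - \<delta> n .. x + \<delta> n}"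
      using diam by (force simp: F_def abs_le_iff)
    then have "emeasure lborel (F n x) \<le> emeasure lborel {x - \<delta> n .. x + \<delta> n}"
      by (intro emeasure_mono) auto
    also have "\<dots> < \<infinity>" by (simp add: emeasure_lborel_Icc_eq)
    finally show ?thesis .
  qed
  have \<pi>_meas[measurable]: "\<pi> n \<in> borel \<rightarrow>\<^sub>M count_space UNIV" for n
  proof (rule measurableI)
    fix X :: "'i set"
    have "\<pi> n -` X = (\<Union>c\<in>X. {y. \<pi> n y = c})" by auto
    also have "\<dots> \<in> sets borel" by (intro sets.countable_UN'' meas) (auto intro: countable_subset[OF _ countableI_type])
    finally show "\<pi> n -` X \<inter> space borel \<in> sets borel" by simp
  qed auto
  \<comment> \<open>A stopping-time form of the Vitali covering argument. Cut the bad set to a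
    bounded piece \<open>B'\<close> of measure \<open>m\<close>, surround it by an open
    \<open>U\<close> with excess less than \<open>\<epsilon> * m\<close>, and stop each point at its
    first bad fibre inside \<open>U\<close>. The stopped fibres are disjoint and cover
    \<open>B'\<close>, and \<open>A\<close> takes at most the share \<open>1 - \<epsilon>\<close> of
    each, so \<open>m \<le> (1 - \<epsilon>) * (1 + \<epsilon>) * m\<close>, which forces
    \<open>m = 0\<close>.\<close>
  have one: "AE x in lborel. x \<in> A \<longrightarrow>
      (\<forall>\<^sub>F n in sequentially. measure lborel (F n x - A) \<le> \<epsilon> * measure lborel (F n x))"
    if \<epsilon>: "0 < \<epsilon>" "\<epsilon> < 1" for \<epsilon> :: real
  proof -
    define bad where "bad n x \<longleftrightarrow> measure lborel (F n x - A) > \<epsilon> * measure lborel (F n x)" for n x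
    have bad_meas[measurable]: "Measurable.pred borel (bad n)" for n
    proof -
      have "bad n = (\<lambda>c. measure lborel ({y. \<pi> n y = c} - A) > \<epsilon> * measure lborel {y. \<pi> n y = c}) \<circ> \<pi> n"
        by (auto simp: bad_def F_def)
      also have "Measurable.pred borel \<dots>" by (rule measurable_comp[OF \<pi>_meas]) auto
      finally show ?thesis .
    qed
    define B where "B = {x\<in>A. \<exists>\<^sub>F n in sequentially. bad n x}"
    have [measurable]: "B \<in> sets borel" unfolding B_def frequently_sequentially by measurable
    have "emeasure lborel (B \<inter> {- real r .. real r}) = 0" for r
    proof (rule ccontr)
      define B' where "B' = B \<inter> {- real r .. real r}"
      define m where "m = measure lborel B'"
      assume nz: "emeasure lborel (B \<inter> {- real r .. real r}) \<noteq> 0"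
      have [measurable]: "B' \<in> sets borel" unfolding B'_def by simp
      have fin: "emeasure lborel B' < \<infinity>"
        using emeasure_mono[of B' "{- real r .. real r}" lborel]
        by (auto simp: B'_def emeasure_lborel_Icc_eq less_top[symmetric] top_unique)
      then have em: "emeasure lborel B' = ennreal m"
        unfolding m_def by (simp add: emeasure_eq_ennreal_measure less_top)
      have m: "m > 0" using nz em unfolding B'_def[symmetric]
        by (metis ennreal_neg less_eq_real_def linorder_not_le)
      obtain U where U: "open U" "B' \<subseteq> U" "emeasure lborel (U - B') < ennreal (\<epsilon> * m)"
        using outer_regular_lborel[of B' "\<epsilon> * m"] m \<epsilon> by auto
      have [measurable]: "U \<in> sets borel" using U(1) by simp
      have ex: "\<exists>n. F n x \<subseteq> U \<and> bad n x" if "x \<in> B'" for x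
      proof -
        from U that obtain e where e: "e > 0" "ball x e \<subseteq> U"
          using open_contains_ball by blast
        have "\<forall>\<^sub>F n in sequentially. \<delta> n < e" using \<delta> e by (simp add: order_tendsto_iff)
        moreover have "\<exists>\<^sub>F n in sequentially. bad n x" using that by (auto simp: B'_def B_def)
        ultimately have "\<exists>n. bad n x \<and> \<delta> n < e"
          by (intro frequently_ex[OF frequently_eventually_frequently])
        then obtain n where n: "bad n x" "\<delta> n < e" by blast
        have "F n x \<subseteq> ball x e"
          using n diam by (force simp: F_def dist_real_def)
        with e n show ?thesis by blast
      qed
      define N where "N x = (LEAST n. F n x \<subseteq> U \<and> bad n x)" for x
      have N: "F (N x) x \<subseteq> U" "bad (N x) x" if "x \<in> B'" for x
        using LeastI_ex[OF ex[OF that]] by (auto simp: N_def)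
      define \<F> where "\<F> = (\<lambda>x. F (N x) x) ` B'"
      have cnt: "countable \<F>"
        by (rule countable_subset[of _ "(\<lambda>(n, c). {y. \<pi> n y = c}) ` UNIV"])
          (auto simp: \<F>_def F_def image_iff)
      \<comment> \<open>Badness and inclusion in \<open>U\<close> depend only on the fibre. If the
        earlier of two stopped fibres meets the later one, it contains the base point of the later
        one, which therefore stops no later: minimality makes meeting fibres equal.\<close>
      have same: "F (N x) x = F (N y) y"
        if xy: "x \<in> B'" "y \<in> B'" "N x \<le> N y" "F (N x) x \<inter> F (N y) y \<noteq> {}" for x y
      proof -
        from xy obtain z where z: "\<pi> (N x) z = \<pi> (N x) x" "\<pi> (N y) z = \<pi> (N y) y"
          by (auto simp: F_def)
        have "\<pi> (N x) y = \<pi> (N x) x" using refine[OF xy(3) z(2)] z(1) by simp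
        then have e: "F (N x) y = F (N x) x" by (auto simp: F_def)
        then have "bad (N x) y" using N(2)[OF xy(1)] by (simp add: bad_def)
        then have "N y \<le> N x" unfolding N_def[of y] using N(1)[OF xy(1)] e
          by (intro Least_le) auto
        with xy(3) e show ?thesis by simp
      qed
      have disj: "disjoint_family_on (\<lambda>X. X) \<F>"
        unfolding disjoint_family_on_def
      proof (intro ballI impI)
        fix X Y assume "X \<in> \<F>" "Y \<in> \<F>" "X \<noteq> Y"
        then obtain x y where xy: "x \<in> B'" "y \<in> B'" "X = F (N x) x" "Y = F (N y) y"
          unfolding \<F>_def by blast
        show "X \<inter> Y = {}"
        proof (rule ccontr)
          assume ne: "X \<inter> Y \<noteq> {}"
          have "X = Y"
          proof (cases "N x \<le> N y")
            case True
            then show ?thesis using same[of x y] xy ne by simp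
          next
            case False
            then show ?thesis using same[of y x] xy ne by (simp add: Int_commute)
          qed
          with \<open>X \<noteq> Y\<close> show False ..
        qed
      qed
      have \<F>_sets: "X \<in> sets borel" if "X \<in> \<F>" for X using that by (auto simp: \<F>_def)
      have step: "emeasure lborel (X \<inter> A) \<le> ennreal (1 - \<epsilon>) * emeasure lborel X" if X: "X \<in> \<F>" for X
      proof -
        obtain x where x: "x \<in> B'" "X = F (N x) x" using X by (auto simp: \<F>_def)
        have fX: "X \<in> fmeasurable lborel" using F_fin[of "N x" x] x by (auto intro!: fmeasurableI)
        have "measure lborel (X \<inter> A \<union> (X - A)) = measure lborel (X \<inter> A) + measure lborel (X - A)"
          using fX by (intro measure_Union) (auto dest: fmeasurableD2[OF fmeasurable_Int_fmeasurable[of _ _ A]] fmeasurableD2[OF fmeasurable_Diff[of _ _ A]])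
        moreover have "X \<inter> A \<union> (X - A) = X" by auto
        moreover have "measure lborel (X - A) > \<epsilon> * measure lborel X"
          using N(2)[OF x(1)] x(2) by (simp add: bad_def)
        ultimately have "measure lborel (X \<inter> A) \<le> (1 - \<epsilon>) * measure lborel X"
          by (simp add: algebra_simps)
        moreover have "X \<inter> A \<in> fmeasurable lborel" using fX by (intro fmeasurable_Int_fmeasurable) auto
        ultimately show ?thesis using fX \<epsilon>
          by (simp add: emeasure_eq_measure2 ennreal_mult[symmetric])
      qed
      have "emeasure lborel B' \<le> emeasure lborel (\<Union>X\<in>\<F>. X \<inter> A)"
        using \<F>_sets cnt
        by (intro emeasure_mono sets.countable_UN'') (auto simp: \<F>_def F_def B'_def B_def)
      also have "\<dots> = (\<integral>\<^sup>+X. emeasure lborel (X \<inter> A) \<partial>count_space \<F>)"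
        using cnt \<F>_sets disj
        by (intro emeasure_UN_countable) (auto simp: disjoint_family_on_def)
      also have "\<dots> \<le> (\<integral>\<^sup>+X. ennreal (1 - \<epsilon>) * emeasure lborel X \<partial>count_space \<F>)"
        by (intro nn_integral_mono) (use step in auto)
      also have "\<dots> = ennreal (1 - \<epsilon>) * (\<integral>\<^sup>+X. emeasure lborel X \<partial>count_space \<F>)"
        by (intro nn_integral_cmult) auto
      also have "(\<integral>\<^sup>+X. emeasure lborel X \<partial>count_space \<F>) = emeasure lborel (\<Union>X\<in>\<F>. X)"
        using cnt \<F>_sets disj by (intro emeasure_UN_countable[symmetric]) auto
      also have "\<dots> \<le> emeasure lborel U"
        using N by (intro emeasure_mono) (auto simp: \<F>_def)
      also have "emeasure lborel U = emeasure lborel B' + emeasure lborel (U - B')"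
        using U by (subst plus_emeasure) (auto simp: Un_absorb1)
      also have "\<dots> \<le> ennreal m + ennreal (\<epsilon> * m)"
        using U em by (intro add_mono) auto
      finally have "ennreal m \<le> ennreal (1 - \<epsilon>) * ennreal (m + \<epsilon> * m)"
        using em m \<epsilon> by (auto simp: mult_left_mono)
      then have "m \<le> (1 - \<epsilon>) * (m + \<epsilon> * m)"
        using m \<epsilon> by (simp add: ennreal_mult[symmetric] del: ennreal_plus)
      also have "\<dots> = m - \<epsilon> * \<epsilon> * m" by (simp add: algebra_simps)
      finally show False using m \<epsilon> mult_pos_pos[OF mult_pos_pos[OF \<epsilon>(1) \<epsilon>(1)] m] by linarith
    qed
    then have "(\<Union>r. B \<inter> {- real r .. real r}) \<in> null_sets lborel"
      by (intro null_sets_UN) (auto simp: null_sets_def)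
    also have "(\<Union>r. B \<inter> {- real r .. real r}) = B"
    proof safe
      fix x assume "x \<in> B"
      moreover obtain r where "\<bar>x\<bar> \<le> real r" using real_arch_simple by blast
      ultimately show "x \<in> (\<Union>r. B \<inter> {- real r .. real r})" by (auto simp: abs_le_iff intro!: exI[of _ r])
    qed
    finally have "B \<in> null_sets lborel" .
    then have "AE x in lborel. x \<notin> B" by (rule AE_not_in)
    then show ?thesis
      by eventually_elim (auto simp: B_def bad_def frequently_def not_less)
  qed
  \<comment> \<open>Countably many tolerances suffice; \<open>k + 2\<close> keeps each of them
    strictly below 1, as the covering argument requires.\<close>
  have "AE x in lborel. \<forall>k::nat. x \<in> A \<longrightarrow> (\<forall>\<^sub>F n in sequentially.
      measure lborel (F n x - A) \<le> (1 / real (k + 2)) * measure lborel (F n x))"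
    by (subst AE_all_countable, intro allI one) auto
  then show ?thesis
  proof eventually_elim
    case (elim x)
    show ?case
    proof (intro impI allI)
      fix \<epsilon> :: real assume x: "x \<in> A" and "\<epsilon> > 0"
      then obtain k where "inverse (real (Suc k)) < \<epsilon>" using reals_Archimedean by blast
      then have k: "1 / real (k + 2) \<le> \<epsilon>"
        by (smt (verit) add_2_eq_Suc' frac_le inverse_eq_divide of_nat_Suc of_nat_0_le_iff)
      have "\<forall>\<^sub>F n in sequentially.
          measure lborel (F n x - A) \<le> (1 / real (k + 2)) * measure lborel (F n x)"
        using elim x by blast
      then have "\<forall>\<^sub>F n in sequentially. measure lborel (F n x - A) \<le> \<epsilon> * measure lborel (F n x)"
        by (rule eventually_mono) (meson k measure_nonneg mult_right_mono order_trans)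
      then show "\<forall>\<^sub>F n in sequentially. measure lborel ({y. \<pi> n y = \<pi> n x} - A)
          \<le> \<epsilon> * measure lborel {y. \<pi> n y = \<pi> n x}" by (simp add: F_def)
    qed
  qed
qed

section \<open>Mixing from a trivial tail\<close>

text \<open>This takes the place of the Cauchy-Schwarz inequality: with \<open>\<delta>\<close>
  fixed first, a small second moment makes the first moment small. Pointwise it is
  \<open>\<bar>t\<bar> \<le> \<delta> + t\<^sup>2 / \<delta>\<close>.\<close>

lemma (in finite_measure) integral_abs_le_square:
  fixes f :: "'a \<Rightarrow> real"
  assumes f: "integrable M f" and f2: "integrable M (\<lambda>x. (f x)\<^sup>2)" and \<delta>: "\<delta> > 0"
  shows "(\<integral>x. \<bar>f x\<bar> \<partial>M) \<le> \<delta> * measure M (space M) + (\<integral>x. (f x)\<^sup>2 \<partial>M) / \<delta>"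
proof -
  have "\<bar>t\<bar> \<le> \<delta> + t\<^sup>2 / \<delta>" for t :: real
  proof -
    have "\<bar>t\<bar> * \<delta> \<le> \<delta>\<^sup>2 + t\<^sup>2"
      using sum_squares_bound[of "\<bar>t\<bar>" \<delta>] mult_nonneg_nonneg[OF abs_ge_zero[of t], of \<delta>] \<delta>
      unfolding power2_abs by linarith
    then show ?thesis using \<delta> by (simp add: field_simps power2_eq_square)
  qed
  then have "(\<integral>x. \<bar>f x\<bar> \<partial>M) \<le> (\<integral>x. \<delta> + (f x)\<^sup>2 / \<delta> \<partial>M)"
    using f f2 by (intro integral_mono) auto
  also have "\<dots> = \<delta> * measure M (space M) + (\<integral>x. (f x)\<^sup>2 \<partial>M) / \<delta>"
    using f2 by simp
  finally show ?thesis .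
qed

text \<open>Replacing \<open>u\<close> by its conditional expectation \<open>e n\<close> on the
  pullback algebra \<open>S n\<close> leaves the integral against \<open>F\<close> after
  \<open>n\<close> steps unchanged, so it suffices that \<open>e n\<close> tends to 0 in mean. The
  algebras decrease, hence the second moments \<open>a n\<close> decrease and the \<open>e n\<close>
  form a Cauchy sequence. The limit \<open>v\<close> along a subsequence is tail measurable and has
  mean 0; triviality of the set where \<open>v > 0\<close> makes it vanish.\<close>

lemma (in finite_measure) tail_trivial_mixing_bounded:
  fixes u F :: "'a \<Rightarrow> real"
  assumes T[measurable]: "T \<in> measurable M M"
    and tail: "\<And>A. A \<in> sets M \<Longrightarrow> (\<And>n. \<exists>B\<in>sets M. A = (T ^^ n) -` B \<inter> space M) \<Longrightarrow>
      A \<in> null_sets M \<or> space M - A \<in> null_sets M"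
    and u[measurable]: "u \<in> borel_measurable M" and uC: "\<And>x. \<bar>u x\<bar> \<le> C" and u0: "(\<integral>x. u x \<partial>M) = 0"
    and F[measurable]: "F \<in> borel_measurable M" and FK: "\<And>x. \<bar>F x\<bar> \<le> K"
  shows "(\<lambda>n. \<integral>x. F ((T ^^ n) x) * u x \<partial>M) \<longlonglongrightarrow> 0"
proof -
  define S where "S n = vimage_algebra (space M) (T ^^ n) M" for n
  have Tn[measurable]: "T ^^ n \<in> measurable M M" for n by simp
  have S_sets: "sets (S n) = {(T ^^ n) -` B \<inter> space M | B. B \<in> sets M}" for n
    unfolding S_def using measurable_space[OF Tn[of n]] by (intro sets_vimage_algebra2) auto
  have sub: "subalgebra M (S n)" for n
    unfolding subalgebra_def S_sets using measurable_sets[OF Tn[of n]] by (auto simp: S_def)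
  have nest: "subalgebra (S n) (S m)" if "n \<le> m" for n m
  proof -
    have "(T ^^ m) -` B \<inter> space M \<in> sets (S n)" if B: "B \<in> sets M" for B
    proof -
      have "(T ^^ m) -` B \<inter> space M = (T ^^ n) -` ((T ^^ (m - n)) -` B \<inter> space M) \<inter> space M"
        using \<open>n \<le> m\<close> measurable_space[OF Tn[of n]]
        by (auto simp: funpow_add[symmetric, THEN fun_cong, unfolded o_apply])
      moreover have "(T ^^ (m - n)) -` B \<inter> space M \<in> sets M" using B Tn by (rule measurable_sets[rotated])
      ultimately show ?thesis unfolding S_sets by blast
    qed
    then show ?thesis unfolding subalgebra_def S_sets[of m] by (auto simp: S_def)
  qed
  have mS: "f \<in> borel_measurable (S n)" if "f \<in> borel_measurable (S m)" "n \<le> m" for f :: "'a \<Rightarrow> real" and n m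
    using measurable_from_subalg[OF nest[OF that(2)]] that(1) by blast
  have fs: "finite_measure_subalgebra M (S n)" for n
    using sub[of n] by unfold_locales
  have sf: "sigma_finite_subalgebra M (S n)" for n
  proof -
    interpret finite_measure_subalgebra M "S n" by (rule fs)
    show ?thesis by unfold_locales
  qed
  define e where "e n = real_cond_exp M (S n) u" for n
  have bdd_int: "integrable M f" if "f \<in> borel_measurable M" "AE x in M. \<bar>f x\<bar> \<le> B" for f :: "'a \<Rightarrow> real" and B
    using that by (intro integrable_const_bound[of _ B]) auto
  have ui: "integrable M u" using uC by (intro bdd_int[of _ C]) auto
  have eS[measurable]: "e n \<in> borel_measurable (S n)" for n unfolding e_def by simp
  have eM[measurable]: "e n \<in> borel_measurable M" for n unfolding e_def by simp
  have eC: "AE x in M. \<bar>e n x\<bar> \<le> C" for n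
  proof -
    interpret sigma_finite_subalgebra M "S n" by (rule sf)
    have "AE x in M. e n x \<le> C" unfolding e_def
      using uC abs_le_D1 by (intro real_cond_exp_le_c ui) auto
    moreover have "AE x in M. - C \<le> e n x" unfolding e_def
      using uC by (intro real_cond_exp_ge_c ui AE_I2) (simp add: abs_le_iff minus_le_iff)
    ultimately show ?thesis by eventually_elim auto
  qed
  have prod_int: "integrable M (\<lambda>x. f x * g x)"
    if [measurable]: "f \<in> borel_measurable M" "g \<in> borel_measurable M"
      and b: "AE x in M. \<bar>f x\<bar> \<le> B" "AE x in M. \<bar>g x\<bar> \<le> B'" for f g :: "'a \<Rightarrow> real" and B B'
  proof (rule bdd_int[of _ "B * B'"])
    show "AE x in M. \<bar>f x * g x\<bar> \<le> B * B'"
      using b by eventually_elim (auto simp: abs_mult intro!: mult_mono order_trans[OF abs_ge_zero])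
  qed simp
  have proj: "(\<integral>x. f x * e n x \<partial>M) = (\<integral>x. f x * u x \<partial>M)"
    if "f \<in> borel_measurable (S n)" "AE x in M. \<bar>f x\<bar> \<le> B" for f n B
  proof -
    interpret sigma_finite_subalgebra M "S n" by (rule sf)
    have "f \<in> borel_measurable M" using that(1) measurable_from_subalg[OF sub] by blast
    then show ?thesis unfolding e_def
      using that uC by (intro real_cond_exp_intg prod_int[of _ _ B C]) auto
  qed
  define a where "a n = (\<integral>x. (e n x)\<^sup>2 \<partial>M)" for n
  have sq_int: "integrable M (\<lambda>x. (e n x)\<^sup>2)" for n
    unfolding power2_eq_square by (intro prod_int[of _ _ C C] eC) auto
  have e_int: "integrable M (e n)" for n by (rule bdd_int[OF eM eC])
  \<comment> \<open>Both are projections of \<open>u\<close>, and \<open>e m\<close> is measurable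
    also for the larger algebra \<open>S n\<close>; the mixed term therefore equals
    \<open>a m\<close>.\<close>
  have pyth: "(\<integral>x. (e n x - e m x)\<^sup>2 \<partial>M) = a n - a m" if "n \<le> m" for n m
  proof -
    have 1: "(\<integral>x. e m x * e n x \<partial>M) = (\<integral>x. e m x * u x \<partial>M)"
      by (rule proj[OF mS[OF eS that] eC])
    have 2: "(\<integral>x. e m x * e m x \<partial>M) = (\<integral>x. e m x * u x \<partial>M)" by (rule proj[OF eS eC])
    have "(\<integral>x. (e n x - e m x)\<^sup>2 \<partial>M) = (\<integral>x. (e n x)\<^sup>2 + (e m x)\<^sup>2 - 2 * (e m x * e n x) \<partial>M)"
      by (simp add: power2_diff algebra_simps)
    also have "\<dots> = a n + a m - 2 * (\<integral>x. e m x * e n x \<partial>M)"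
      using sq_int prod_int[OF eM eM eC eC] by (simp add: a_def)
    also have "(\<integral>x. e m x * e n x \<partial>M) = a m" using 1 2 by (simp add: a_def power2_eq_square)
    finally show ?thesis by simp
  qed
  have a_nonneg: "0 \<le> a n" for n unfolding a_def by simp
  have a_dec: "a m \<le> a n" if "n \<le> m" for n m
    
  proof -
    have "0 \<le> (\<integral>x. (e n x - e m x)\<^sup>2 \<partial>M)" by simp
    then show ?thesis using pyth[OF that] by simp
  qed
  have "convergent a"
    using decseq_convergent[of a 0] a_dec a_nonneg unfolding decseq_def convergent_def by metis
  then have Cau: "Cauchy a" by (rule convergent_Cauchy)
  define V where "V = measure M (space M)"
  have V: "V \<ge> 0" by (simp add: V_def)
  have L1: "\<exists>N. \<forall>i\<ge>N. \<forall>j\<ge>N. (\<integral>x. norm (e i x - e j x) \<partial>M) < \<epsilon>" if "\<epsilon> > 0" for \<epsilon>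
  proof -
    define \<delta> where "\<delta> = \<epsilon> / (2 * (V + 1))"
    have \<delta>: "\<delta> > 0" using V that by (simp add: \<delta>_def)
    have "V * \<epsilon> < (V + 1) * \<epsilon>" using that by simp
    then have \<delta>V: "\<delta> * V < \<epsilon> / 2" using V by (simp add: \<delta>_def divide_simps algebra_simps)
    have "\<exists>N. \<forall>i\<ge>N. \<forall>j\<ge>N. dist (a i) (a j) < \<delta> * (\<epsilon> / 2)"
      using \<delta> that by (intro metric_CauchyD[OF Cau]) auto
    then obtain N where N: "\<And>i j. i \<ge> N \<Longrightarrow> j \<ge> N \<Longrightarrow> \<bar>a i - a j\<bar> < \<delta> * (\<epsilon> / 2)"
      unfolding dist_real_def by blast
    have "(\<integral>x. norm (e i x - e j x) \<partial>M) < \<epsilon>" if ij: "i \<ge> N" "j \<ge> N" for i j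
    proof -
      have "(\<integral>x. (e i x - e j x)\<^sup>2 \<partial>M) = \<bar>a i - a j\<bar>"
      proof (cases "i \<le> j")
        case True
        then show ?thesis using pyth a_dec by fastforce
      next
        case False
        then have "(\<integral>x. (e i x - e j x)\<^sup>2 \<partial>M) = a j - a i"
          using pyth[of j i] by (simp add: power2_commute)
        then show ?thesis using a_dec[of j i] False by simp
      qed
      also have "\<dots> < \<delta> * (\<epsilon> / 2)" using N ij by blast
      finally have "(\<integral>x. (e i x - e j x)\<^sup>2 \<partial>M) / \<delta> < \<epsilon> / 2" using \<delta> by (simp add: field_simps)
      moreover have "(\<integral>x. \<bar>e i x - e j x\<bar> \<partial>M) \<le> \<delta> * V + (\<integral>x. (e i x - e j x)\<^sup>2 \<partial>M) / \<delta>"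
        unfolding V_def
      proof (rule integral_abs_le_square[OF _ _ \<delta>])
        show "integrable M (\<lambda>x. (e i x - e j x)\<^sup>2)" unfolding power2_diff
          using sq_int prod_int[OF eM eM eC eC, of i j] by (simp add: mult.assoc)
      qed (use e_int in auto)
      ultimately show ?thesis using \<delta>V unfolding real_norm_def by linarith
    qed
    then show ?thesis by blast
  qed
  obtain r where r: "strict_mono r" "AE x in M. Cauchy (\<lambda>i. e (r i) x)"
    using cauchy_L1_AE_cauchy_subseq[of M e, OF e_int L1] by blast
  define v where "v x = lim (\<lambda>i. e (r i) x)" for x
  \<comment> \<open>Dropping the first \<open>k\<close> terms changes neither the limit nor, at
    points of divergence, the value of \<open>lim\<close>. As \<open>r\<close> is strictly
    increasing, the remaining indices are at least \<open>k\<close>, which makes \<open>v\<close>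
    measurable for every algebra \<open>S k\<close>.\<close>
  have v_shift: "v x = lim (\<lambda>i. e (r (i + k)) x)" for k x
  proof -
    have "(\<lambda>i. e (r i) x) \<longlonglongrightarrow> l \<longleftrightarrow> (\<lambda>i. e (r (i + k)) x) \<longlonglongrightarrow> l" for l
      using LIMSEQ_ignore_initial_segment[of "\<lambda>i. e (r i) x" l k]
        LIMSEQ_offset[of "\<lambda>i. e (r i) x" k l] by blast
    then show ?thesis by (simp add: v_def lim_def)
  qed
  have vS: "v \<in> borel_measurable (S n)" for n
    unfolding v_shift[of _ n]
  proof (rule borel_measurable_lim_metric)
    fix i show "e (r (i + n)) \<in> borel_measurable (S n)"
      by (rule mS[OF eS]) (use seq_suble[OF r(1), of "i + n"] in simp)
  qed
  have vM[measurable]: "v \<in> borel_measurable M" using vS[of 0] measurable_from_subalg[OF sub] by blast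
  have lim_v: "AE x in M. (\<lambda>i. e (r i) x) \<longlonglongrightarrow> v x"
    using r(2) by eventually_elim (simp add: v_def Cauchy_convergent convergent_LIMSEQ_iff[symmetric])
  have eC': "AE x in M. \<forall>n. \<bar>e n x\<bar> \<le> C" using eC by (simp add: AE_all_countable)
  have "(\<lambda>i. \<integral>x. e (r i) x \<partial>M) \<longlonglongrightarrow> (\<integral>x. v x \<partial>M)"
    using eC lim_v by (intro integral_dominated_convergence[where w = "\<lambda>_. C"]) auto
  moreover have "(\<integral>x. e n x \<partial>M) = 0" for n
  proof -
    have "(\<integral>x. 1 * e n x \<partial>M) = (\<integral>x. 1 * u x \<partial>M)" by (rule proj[of _ n 1]) auto
    then show ?thesis using u0 by simp
  qed
  ultimately have v0: "(\<integral>x. v x \<partial>M) = 0" by (simp add: LIMSEQ_const_iff)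
  have vC: "AE x in M. \<bar>v x\<bar> \<le> C"
    using eC' lim_v
  proof eventually_elim
    case (elim x)
    then have "(\<lambda>i. \<bar>e (r i) x\<bar>) \<longlonglongrightarrow> \<bar>v x\<bar>" by (intro tendsto_rabs)
    then show ?case using elim(1) by (intro LIMSEQ_le_const2) auto
  qed
  have vi: "integrable M v" by (rule bdd_int[OF vM vC])
  define P where "P = {x \<in> space M. v x > 0}"
  have "P \<in> sets M" unfolding P_def by measurable
  moreover have "\<exists>B\<in>sets M. P = (T ^^ n) -` B \<inter> space M" for n
  proof -
    have "{x \<in> space (S n). v x > 0} \<in> sets (S n)" using vS by measurable
    also have "{x \<in> space (S n). v x > 0} = P" by (simp add: P_def S_def)
    finally show ?thesis unfolding S_sets by blast
  qed
  ultimately have "P \<in> null_sets M \<or> space M - P \<in> null_sets M" by (rule tail)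
  then have "AE x in M. v x = 0"
  proof
    assume "P \<in> null_sets M"
    then have "AE x in M. x \<notin> P" by (rule AE_not_in)
    then have "AE x in M. 0 \<le> - v x"
      using AE_space by eventually_elim (simp add: P_def)
    moreover have "(\<integral>x. - v x \<partial>M) = 0" using v0 by simp
    ultimately show ?thesis using integral_nonneg_eq_0_iff_AE[of M "\<lambda>x. - v x"] vi by auto
  next
    assume "space M - P \<in> null_sets M"
    then have "AE x in M. x \<notin> space M - P" by (rule AE_not_in)
    then have "AE x in M. 0 \<le> v x" by (auto simp: P_def elim!: AE_mp)
    then show ?thesis using integral_nonneg_eq_0_iff_AE[OF vi] v0 by auto
  qed
  then have "AE x in M. (\<lambda>i. (e (r i) x)\<^sup>2) \<longlonglongrightarrow> 0"
    using lim_v by eventually_elim (auto intro: tendsto_eq_intros)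
  moreover have "AE x in M. norm ((e n x)\<^sup>2) \<le> C\<^sup>2" for n
    using eC[of n] by eventually_elim (use power_mono[of "\<bar>_\<bar>" C 2] in force)
  ultimately have "(\<lambda>i. a (r i)) \<longlonglongrightarrow> (\<integral>x. 0 \<partial>M)"
    unfolding a_def by (intro integral_dominated_convergence[where w = "\<lambda>_. C\<^sup>2"]) auto
  then have ar0: "(\<lambda>i. a (r i)) \<longlonglongrightarrow> 0" by simp
  \<comment> \<open>The subsequence decides, because \<open>a\<close> is nonincreasing.\<close>
  have a0: "a \<longlonglongrightarrow> 0"
  proof (rule LIMSEQ_I)
    fix \<epsilon> :: real assume "\<epsilon> > 0"
    then obtain i where "norm (a (r i) - 0) < \<epsilon>"
      using LIMSEQ_D[OF ar0] by blast
    then have "a (r i) < \<epsilon>" by simp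
    then show "\<exists>no. \<forall>n\<ge>no. norm (a n - 0) < \<epsilon>"
      using a_dec a_nonneg by (intro exI[of _ "r i"]) (auto intro: le_less_trans)
  qed
  have K: "K \<ge> 0" using FK[of undefined] by linarith
  show ?thesis
  proof (rule LIMSEQ_I)
    fix \<epsilon> :: real assume \<epsilon>: "\<epsilon> > 0"
    define \<delta> where "\<delta> = \<epsilon> / (2 * (K * V + 1))"
    have KV: "K * V \<ge> 0" using K V by simp
    have \<delta>: "\<delta> > 0" using KV \<epsilon> by (simp add: \<delta>_def)
    have \<delta>V: "K * (\<delta> * V) < \<epsilon> / 2"
    proof -
      have "(K * V) * \<epsilon> < (K * V + 1) * \<epsilon>" using \<epsilon> by simp
      then show ?thesis using KV \<epsilon> by (simp add: \<delta>_def field_simps)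
    qed
    have "(\<lambda>n. K * (a n / \<delta>)) \<longlonglongrightarrow> K * (0 / \<delta>)"
      by (intro tendsto_intros a0) (use \<delta> in auto)
    then obtain N where N: "\<And>n. n \<ge> N \<Longrightarrow> \<bar>K * (a n / \<delta>)\<bar> < \<epsilon> / 2"
      using LIMSEQ_D[of "\<lambda>n. K * (a n / \<delta>)" 0 "\<epsilon> / 2"] \<epsilon> by auto
    have "norm ((\<integral>x. F ((T ^^ n) x) * u x \<partial>M) - 0) < \<epsilon>" if "n \<ge> N" for n
    proof -
      have "T ^^ n \<in> S n \<rightarrow>\<^sub>M M" unfolding S_def
        using measurable_space[OF Tn] by (intro measurable_vimage_algebra1) auto
      then have "(\<lambda>x. F ((T ^^ n) x)) \<in> borel_measurable (S n)" by measurable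
      then have "(\<integral>x. F ((T ^^ n) x) * e n x \<partial>M) = (\<integral>x. F ((T ^^ n) x) * u x \<partial>M)"
        by (rule proj[of _ _ K]) (use FK in auto)
      then have "\<bar>\<integral>x. F ((T ^^ n) x) * u x \<partial>M\<bar> \<le> (\<integral>x. \<bar>F ((T ^^ n) x) * e n x\<bar> \<partial>M)"
        by (metis integral_abs_bound)
      also have "\<dots> \<le> (\<integral>x. K * \<bar>e n x\<bar> \<partial>M)"
        using FK eC by (intro integral_mono integrable_abs integrable_mult_right e_int prod_int[of _ _ K C])
          (auto simp: abs_mult intro!: mult_right_mono)
      also have "\<dots> = K * (\<integral>x. \<bar>e n x\<bar> \<partial>M)" by simp
      also have "\<dots> \<le> K * (\<delta> * V + a n / \<delta>)"
        using integral_abs_le_square[OF e_int sq_int \<delta>, of n] K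
        by (intro mult_left_mono) (auto simp: V_def a_def)
      also have "\<dots> = K * (\<delta> * V) + K * (a n / \<delta>)" by (simp add: algebra_simps)
      also have "\<dots> < \<epsilon>" using \<delta>V N[OF that] by linarith
      finally show ?thesis by simp
    qed
    then show "\<exists>no. \<forall>n\<ge>no. norm ((\<integral>x. F ((T ^^ n) x) * u x \<partial>M) - 0) < \<epsilon>" by blast
  qed
qed


text \<open>Truncating \<open>u\<close> at height \<open>k\<close> spoils its mean. Recentring by
  the mean \<open>m\<close> of the truncation restores it, and since \<open>u\<close> has mean 0,
  \<open>m\<close> is bounded by the error \<open>d k\<close> of the truncation. Both errors are
  uniform in \<open>n\<close> because \<open>F\<close> is bounded.\<close>

lemma (in finite_measure) tail_trivial_mixing_finite:
  fixes u F :: "'a \<Rightarrow> real"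
  assumes T[measurable]: "T \<in> measurable M M"
    and tail: "\<And>A. A \<in> sets M \<Longrightarrow> (\<And>n. \<exists>B\<in>sets M. A = (T ^^ n) -` B \<inter> space M) \<Longrightarrow>
      A \<in> null_sets M \<or> space M - A \<in> null_sets M"
    and u: "integrable M u" and u0: "(\<integral>x. u x \<partial>M) = 0"
    and F[measurable]: "F \<in> borel_measurable M" and FK: "\<And>x. \<bar>F x\<bar> \<le> K"
  shows "(\<lambda>n. \<integral>x. F ((T ^^ n) x) * u x \<partial>M) \<longlonglongrightarrow> 0"
proof (rule LIMSEQ_I)
  fix \<epsilon> :: real assume \<epsilon>: "\<epsilon> > 0"
  have K: "K \<ge> 0" using FK[of undefined] by linarith
  have um[measurable]: "u \<in> borel_measurable M" using u by simp
  define V where "V = measure M (space M)"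
  have V: "V \<ge> 0" by (simp add: V_def)
  define w where "w k x = max (- real k) (min (real k) (u x))" for k x
  have wm[measurable]: "w k \<in> borel_measurable M" for k unfolding w_def by simp
  have wk: "\<bar>w k x\<bar> \<le> real k" for k x unfolding w_def by auto
  have wu: "\<bar>w k x\<bar> \<le> \<bar>u x\<bar>" for k x unfolding w_def by auto
  have wi: "integrable M (w k)" for k using wk by (intro integrable_const_bound[of _ "real k"]) auto
  have w_lim: "(\<lambda>k. w k x) \<longlonglongrightarrow> u x" for x
  proof -
    obtain k0 where "\<bar>u x\<bar> \<le> real k0" using real_arch_simple by blast
    then have "w k x = u x" if "k \<ge> k0" for k using that by (auto simp: w_def abs_le_iff)
    then have "\<forall>\<^sub>F k in sequentially. w k x = u x"
      unfolding eventually_sequentially by blast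
    then show ?thesis by (rule tendsto_eventually)
  qed
  have "(\<lambda>k. \<integral>x. \<bar>u x - w k x\<bar> \<partial>M) \<longlonglongrightarrow> (\<integral>x. \<bar>u x - u x\<bar> \<partial>M)"
  proof (rule integral_dominated_convergence[where w = "\<lambda>x. 2 * \<bar>u x\<bar>"])
    show "AE x in M. (\<lambda>k. \<bar>u x - w k x\<bar>) \<longlonglongrightarrow> \<bar>u x - u x\<bar>"
      by (intro AE_I2 tendsto_intros w_lim)
    show "AE x in M. norm \<bar>u x - w k x\<bar> \<le> 2 * \<bar>u x\<bar>" for k
      using wu[of k] by (intro AE_I2) (smt (verit) real_norm_def)
  qed (use u in auto)
  then have lim1: "(\<lambda>k. \<integral>x. \<bar>u x - w k x\<bar> \<partial>M) \<longlonglongrightarrow> 0" by simp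
  define d where "d k = (\<integral>x. \<bar>u x - w k x\<bar> \<partial>M)" for k
  obtain k where k: "\<bar>d k\<bar> < \<epsilon> / (4 * (K + 1))"
    using LIMSEQ_D[OF lim1, of "\<epsilon> / (4 * (K + 1))"] \<epsilon> K by (auto simp: d_def)
  have Kd: "K * d k < \<epsilon> / 4"
  proof -
    have dk: "d k < \<epsilon> / (4 * (K + 1))" "0 \<le> d k" using k by (auto simp: d_def)
    then have "K * d k \<le> (K + 1) * d k" by (simp add: mult_right_mono)
    also have "\<dots> < \<epsilon> / 4" using dk(1) K by (simp add: field_simps)
    finally show ?thesis .
  qed
  define m where "m = (\<integral>x. w k x \<partial>M)"
  have m: "\<bar>m\<bar> \<le> d k"
  proof -
    have "m = - (\<integral>x. u x - w k x \<partial>M)" using u u0 wi by (simp add: m_def)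
    then show ?thesis unfolding d_def using integral_abs_bound[of M "\<lambda>x. u x - w k x"] by simp
  qed
  \<comment> \<open>On a space of measure 0 the quotient is 0 by convention, and every integral
    vanishes anyway.\<close>
  define u' where "u' x = w k x - m / V" for x
  have "(\<lambda>n. \<integral>x. F ((T ^^ n) x) * u' x \<partial>M) \<longlonglongrightarrow> 0"
  proof (rule tail_trivial_mixing_bounded[OF T tail])
    show "u' \<in> borel_measurable M" unfolding u'_def by simp
    show "\<bar>u' x\<bar> \<le> real k + \<bar>m / V\<bar>" for x using wk[of k x] unfolding u'_def by linarith
    show "(\<integral>x. u' x \<partial>M) = 0"
    proof (cases "V = 0")
      case True
      then have "space M \<in> null_sets M"
        by (simp add: V_def null_sets_def emeasure_eq_measure)
      then have "AE x in M. x \<notin> space M" by (rule AE_not_in)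
      then have "AE x in M. u' x = 0" using AE_space by eventually_elim simp
      then show ?thesis by (rule integral_eq_zero_AE)
    next
      case False
      then show ?thesis unfolding u'_def using wi by (simp add: m_def V_def)
    qed
  qed (use FK in auto)
  then obtain N where N: "\<And>n. n \<ge> N \<Longrightarrow> \<bar>\<integral>x. F ((T ^^ n) x) * u' x \<partial>M\<bar> < \<epsilon> / 2"
    using LIMSEQ_D[of "\<lambda>n. \<integral>x. F ((T ^^ n) x) * u' x \<partial>M" 0 "\<epsilon> / 2"] \<epsilon> by auto
  have u'i: "integrable M u'" unfolding u'_def using wi by auto
  have Fint: "integrable M (\<lambda>x. F ((T ^^ n) x) * f x)" if "integrable M f" for f n
  proof (rule Bochner_Integration.integrable_bound[of _ "\<lambda>x. K * f x"])
    show "AE x in M. norm (F ((T ^^ n) x) * f x) \<le> norm (K * f x)"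
      using FK K by (auto simp: abs_mult intro!: mult_right_mono)
  qed (use that in auto)
  have "norm ((\<integral>x. F ((T ^^ n) x) * u x \<partial>M) - 0) < \<epsilon>" if "n \<ge> N" for n
  proof -
    have "\<bar>(\<integral>x. F ((T ^^ n) x) * u x \<partial>M) - (\<integral>x. F ((T ^^ n) x) * u' x \<partial>M)\<bar>
        = \<bar>\<integral>x. F ((T ^^ n) x) * (u x - u' x) \<partial>M\<bar>"
      using Fint[OF u, of n] Fint[OF u'i, of n] by (simp add: right_diff_distrib)
    also have "\<dots> \<le> (\<integral>x. \<bar>F ((T ^^ n) x) * (u x - u' x)\<bar> \<partial>M)" by (rule integral_abs_bound)
    also have "\<dots> \<le> (\<integral>x. K * (\<bar>u x - w k x\<bar> + \<bar>m\<bar> / V) \<partial>M)"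
    proof (rule integral_mono)
      show "integrable M (\<lambda>x. \<bar>F ((T ^^ n) x) * (u x - u' x)\<bar>)"
        using Fint[of "\<lambda>x. u x - u' x" n] u u'i by auto
      show "integrable M (\<lambda>x. K * (\<bar>u x - w k x\<bar> + \<bar>m\<bar> / V))" using u wi by auto
      fix x
      have "\<bar>u x - u' x\<bar> \<le> \<bar>u x - w k x\<bar> + \<bar>m\<bar> / V"
        unfolding u'_def using abs_triangle_ineq[of "u x - w k x" "m / V"] V by (simp add: abs_divide)
      then show "\<bar>F ((T ^^ n) x) * (u x - u' x)\<bar> \<le> K * (\<bar>u x - w k x\<bar> + \<bar>m\<bar> / V)"
        unfolding abs_mult using FK K by (intro mult_mono) auto
    qed
    also have "\<dots> = K * (d k + \<bar>m\<bar> / V * V)"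
      using u wi by (simp add: d_def V_def algebra_simps)
    also have "\<dots> \<le> K * (d k + d k)"
      using m K by (intro mult_left_mono add_left_mono) (auto simp: d_def)
    also have "\<dots> < \<epsilon> / 2" using Kd by (simp add: algebra_simps)
    finally show ?thesis using N[OF that] unfolding real_norm_def by linarith
  qed
  then show "\<exists>no. \<forall>n\<ge>no. norm ((\<integral>x. F ((T ^^ n) x) * u x \<partial>M) - 0) < \<epsilon>" by blast
qed

text \<open>Triviality of the tail depends on the null sets only, and so survives the passage to an
  equivalent finite measure \<open>Q\<close> with density \<open>h\<close>; the function
  \<open>u = g / h\<close> turns integrals against \<open>g\<close> into integrals over
  \<open>Q\<close>. In general \<open>T\<close> does not preserve \<open>Q\<close>, which is why the
  finite case asks only for measurability of \<open>T\<close>.\<close>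

lemma (in sigma_finite_measure) tail_trivial_mixing_real:
  fixes g F :: "'a \<Rightarrow> real"
  assumes T[measurable]: "T \<in> measurable M M"
    and tail: "\<And>A. A \<in> sets M \<Longrightarrow> (\<And>n. \<exists>B\<in>sets M. A = (T ^^ n) -` B \<inter> space M) \<Longrightarrow>
      A \<in> null_sets M \<or> space M - A \<in> null_sets M"
    and g: "integrable M g" and g0: "(\<integral>x. g x \<partial>M) = 0"
    and F[measurable]: "F \<in> borel_measurable M" and FK: "\<And>x. \<bar>F x\<bar> \<le> K"
  shows "(\<lambda>n. \<integral>x. F ((T ^^ n) x) * g x \<partial>M) \<longlonglongrightarrow> 0"
proof -
  obtain h0 :: "'a \<Rightarrow> ennreal" where h0[measurable]: "h0 \<in> borel_measurable M"
    and h0fin: "integral\<^sup>N M h0 \<noteq> \<infinity>" and h0pos: "\<And>x. x \<in> space M \<Longrightarrow> 0 < h0 x \<and> h0 x < \<infinity>"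
    using Ex_finite_integrable_function by blast
  define h where "h x = enn2real (h0 x)" for x
  have hm[measurable]: "h \<in> borel_measurable M" unfolding h_def by simp
  have hpos: "h x > 0" if "x \<in> space M" for x
    using h0pos[OF that] by (simp add: h_def enn2real_positive_iff)
  have hh0: "ennreal (h x) = h0 x" if "x \<in> space M" for x
    using h0pos[OF that] by (simp add: h_def less_top)
  define Q where "Q = density M (\<lambda>x. ennreal (h x))"
  have spQ[simp]: "space Q = space M" and seQ[measurable_cong, simp]: "sets Q = sets M" by (auto simp: Q_def)
  have "emeasure Q (space M) = integral\<^sup>N M h0"
    unfolding Q_def by (subst emeasure_density) (auto intro!: nn_integral_cong simp: hh0)
  then interpret Q: finite_measure Q
    using h0fin by (intro finite_measureI) simp
  have nQ: "A \<in> null_sets Q \<longleftrightarrow> A \<in> null_sets M" for A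
  proof -
    have "A \<in> null_sets Q \<longleftrightarrow> A \<in> sets M \<and> (AE x in M. x \<in> A \<longrightarrow> ennreal (h x) = 0)"
      unfolding Q_def by (rule null_sets_density_iff) simp
    also have "\<dots> \<longleftrightarrow> A \<in> sets M \<and> (AE x in M. x \<notin> A)"
      using hpos by (intro conj_cong refl AE_cong) (force simp: ennreal_eq_0_iff)
    also have "\<dots> \<longleftrightarrow> A \<in> null_sets M" using AE_iff_null_sets[of A M] by auto
    finally show ?thesis .
  qed
  define u where "u x = g x / h x" for x
  have um: "u \<in> borel_measurable M" unfolding u_def using g by simp
  have gu: "h x * u x = g x" if "x \<in> space M" for x using hpos[OF that] by (simp add: u_def)
  have int_eq: "(\<integral>x. f x * u x \<partial>Q) = (\<integral>x. f x * g x \<partial>M)" if [measurable]: "f \<in> borel_measurable M" for f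
  proof -
    have "(\<integral>x. f x * u x \<partial>Q) = (\<integral>x. h x *\<^sub>R (f x * u x) \<partial>M)"
      unfolding Q_def using um hpos by (intro integral_density) (auto intro!: less_imp_le)
    also have "\<dots> = (\<integral>x. f x * g x \<partial>M)"
      using gu by (intro Bochner_Integration.integral_cong) (auto simp: mult.left_commute)
    finally show ?thesis .
  qed
  have ui: "integrable Q u"
  proof -
    have "integrable M (\<lambda>x. h x *\<^sub>R u x)" using g gu by (subst Bochner_Integration.integrable_cong[of M M _ g]) auto
    then show ?thesis unfolding Q_def using um hpos
      by (subst integrable_density) (auto intro!: less_imp_le)
  qed
  have u0: "(\<integral>x. u x \<partial>Q) = 0" using int_eq[of "\<lambda>_. 1"] g0 by simp
  have "(\<lambda>n. \<integral>x. F ((T ^^ n) x) * u x \<partial>Q) \<longlonglongrightarrow> 0"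
  proof (rule Q.tail_trivial_mixing_finite[OF _ _ ui u0 _ FK])
    fix A assume "A \<in> sets Q" "\<And>n. \<exists>B\<in>sets Q. A = (T ^^ n) -` B \<inter> space Q"
    then show "A \<in> null_sets Q \<or> space Q - A \<in> null_sets Q" using tail[of A] by (simp add: nQ)
  qed auto
  then show ?thesis by (simp add: int_eq)
qed

lemma (in sigma_finite_measure) tail_trivial_mixing:
  fixes g F :: "'a \<Rightarrow> complex"
  assumes T[measurable]: "T \<in> measurable M M"
    and tail: "\<And>A. A \<in> sets M \<Longrightarrow> (\<And>n. \<exists>B\<in>sets M. A = (T ^^ n) -` B \<inter> space M) \<Longrightarrow>
      A \<in> null_sets M \<or> space M - A \<in> null_sets M"
    and g: "integrable M g" and g0: "(\<integral>x. g x \<partial>M) = 0"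
    and F[measurable]: "F \<in> borel_measurable M" and FK: "\<And>x. norm (F x) \<le> K"
  shows "(\<lambda>n. \<integral>x. F ((T ^^ n) x) * g x \<partial>M) \<longlonglongrightarrow> 0"
proof -
  have gm[measurable]: "g \<in> borel_measurable M" using g by simp
  have K: "K \<ge> 0" using FK[of undefined] norm_ge_zero order_trans by blast
  have RF: "(\<lambda>x. Re (F x)) \<in> borel_measurable M" "(\<lambda>x. Im (F x)) \<in> borel_measurable M" by simp_all
  have RK: "\<bar>Re (F x)\<bar> \<le> K" "\<bar>Im (F x)\<bar> \<le> K" for x
    using FK[of x] abs_Re_le_cmod[of "F x"] abs_Im_le_cmod[of "F x"] by linarith+
  have Rg: "integrable M (\<lambda>x. Re (g x))" "integrable M (\<lambda>x. Im (g x))" using g by auto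
  have Rg0: "(\<integral>x. Re (g x) \<partial>M) = 0" "(\<integral>x. Im (g x) \<partial>M) = 0"
    using g g0 by simp_all
  note L = tail_trivial_mixing_real[OF T tail Rg(1) Rg0(1) RF(1) RK(1)]
    tail_trivial_mixing_real[OF T tail Rg(1) Rg0(1) RF(2) RK(2)]
    tail_trivial_mixing_real[OF T tail Rg(2) Rg0(2) RF(1) RK(1)]
    tail_trivial_mixing_real[OF T tail Rg(2) Rg0(2) RF(2) RK(2)]
  have Fint: "integrable M (\<lambda>x. f ((T ^^ n) x) * v x)"
    if "integrable M v" "f \<in> borel_measurable M" "\<And>x. \<bar>f x\<bar> \<le> K" for f v :: "'a \<Rightarrow> real" and n
  proof (rule Bochner_Integration.integrable_bound[of _ "\<lambda>x. K * v x"])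
    show "AE x in M. norm (f ((T ^^ n) x) * v x) \<le> norm (K * v x)"
      using that(3) K by (auto simp: abs_mult intro!: mult_right_mono)
  qed (use that in auto)
  have FI: "integrable M (\<lambda>x. F ((T ^^ n) x) * g x)" for n
  proof (rule Bochner_Integration.integrable_bound[of _ "\<lambda>x. K * norm (g x)"])
    show "AE x in M. norm (F ((T ^^ n) x) * g x) \<le> norm (K * norm (g x))"
      using FK K by (auto simp: norm_mult intro!: mult_right_mono)
  qed (use g in auto)
  have eq: "(\<integral>x. F ((T ^^ n) x) * g x \<partial>M) =
      Complex ((\<integral>x. Re (F ((T ^^ n) x)) * Re (g x) \<partial>M) - (\<integral>x. Im (F ((T ^^ n) x)) * Im (g x) \<partial>M))
       ((\<integral>x. Re (F ((T ^^ n) x)) * Im (g x) \<partial>M) + (\<integral>x. Im (F ((T ^^ n) x)) * Re (g x) \<partial>M))" for n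
  proof (rule complex_eqI)
    show "Re (\<integral>x. F ((T ^^ n) x) * g x \<partial>M) = Re (Complex ((\<integral>x. Re (F ((T ^^ n) x)) * Re (g x) \<partial>M) - (\<integral>x. Im (F ((T ^^ n) x)) * Im (g x) \<partial>M))
       ((\<integral>x. Re (F ((T ^^ n) x)) * Im (g x) \<partial>M) + (\<integral>x. Im (F ((T ^^ n) x)) * Re (g x) \<partial>M)))"
      using Fint[OF Rg(1) RF(1) RK(1), of n] Fint[OF Rg(2) RF(2) RK(2), of n]
      by (simp add: integral_Re[OF FI, symmetric] Bochner_Integration.integral_diff)
    show "Im (\<integral>x. F ((T ^^ n) x) * g x \<partial>M) = Im (Complex ((\<integral>x. Re (F ((T ^^ n) x)) * Re (g x) \<partial>M) - (\<integral>x. Im (F ((T ^^ n) x)) * Im (g x) \<partial>M))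
       ((\<integral>x. Re (F ((T ^^ n) x)) * Im (g x) \<partial>M) + (\<integral>x. Im (F ((T ^^ n) x)) * Re (g x) \<partial>M)))"
      using Fint[OF Rg(2) RF(1) RK(1), of n] Fint[OF Rg(1) RF(2) RK(2), of n]
      by (simp add: integral_Im[OF FI, symmetric] Bochner_Integration.integral_add)
  qed
  have "(\<lambda>n. \<integral>x. F ((T ^^ n) x) * g x \<partial>M) \<longlonglongrightarrow> Complex (0 - 0) (0 + 0)"
    unfolding eq by (intro tendsto_Complex tendsto_diff tendsto_add L)
  then show ?thesis by (simp add: zero_complex.code[symmetric])
qed

section \<open>Piecewise expanding Markov maps\<close>

text \<open>Here, unlike in the definitions above, the map follows the branch of the half-open cell also at
  the endpoints of the cells; this changes it on a null set only.\<close>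

locale markov_map =
  fixes a :: real and T :: "real \<Rightarrow> real" and \<tau> \<tau>' \<tau>'' :: "int \<Rightarrow> real \<Rightarrow> real"
    and p q :: "int \<Rightarrow> int" and l \<eta> B :: real and N :: int
  assumes a_pos: "0 < a"
    and T_eq: "\<And>x. T x = \<tau> \<lfloor>x / a\<rfloor> x"
    and bij: "\<And>j. bij_betw (\<tau> j) {a * j .. a * (j + 1)} {a * p j .. a * (q j + 1)}"
    and deriv: "\<And>j x. x \<in> {a * j .. a * (j + 1)} \<Longrightarrow>
      (\<tau> j has_real_derivative \<tau>' j x) (at x within {a * j .. a * (j + 1)})"
    and deriv2: "\<And>j x. x \<in> {a * j .. a * (j + 1)} \<Longrightarrow>
      (\<tau>' j has_real_derivative \<tau>'' j x) (at x within {a * j .. a * (j + 1)})"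
    and l_gt_1: "1 < l"
    and expanding: "\<And>j x. x \<in> {a * j .. a * (j + 1)} \<Longrightarrow> l \<le> \<bar>\<tau>' j x\<bar>"
    and slope_le: "\<And>j x. x \<in> {a * j .. a * (j + 1)} \<Longrightarrow> \<bar>\<tau>' j x\<bar> \<le> B"
    and \<eta>_nonneg: "0 \<le> \<eta>"
    and distortion: "\<And>j x. x \<in> {a * j .. a * (j + 1)} \<Longrightarrow> \<bar>\<tau>'' j x / (\<tau>' j x)\<^sup>2\<bar> \<le> \<eta>"
    and jump: "\<And>j. \<bar>p j - j\<bar> \<le> N" "\<And>j. \<bar>q j - j\<bar> \<le> N"
begin

abbreviation I :: "int \<Rightarrow> real set" where
  "I j \<equiv> {a * real_of_int j .. a * (real_of_int j + 1)}"

abbreviation J :: "int \<Rightarrow> real set" where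
  "J j \<equiv> {a * real_of_int (p j) .. a * (real_of_int (q j) + 1)}"

abbreviation cell :: "real \<Rightarrow> int" where
  "cell x \<equiv> \<lfloor>x / a\<rfloor>"

text \<open>Every point lies in exactly one half-open cell, which gives it an itinerary; the closed
  cells \<open>I j\<close> carry the branches and their derivatives.\<close>

definition H :: "int \<Rightarrow> real set" where
  "H j = {x. cell x = j}"

lemma H_eq: "H j = {a * j ..< a * (j + 1)}"
proof -
  have "cell x = j \<longleftrightarrow> a * j \<le> x \<and> x < a * (j + 1)" for x
    using a_pos by (simp add: floor_eq_iff pos_le_divide_eq pos_divide_less_eq mult.commute)
  then show ?thesis
    unfolding H_def set_eq_iff mem_Collect_eq atLeastLessThan_iff by blast
qed

lemma mem_H: "x \<in> H j \<longleftrightarrow> cell x = j"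
  by (simp add: H_def)

lemma H_sub_I: "H j \<subseteq> I j"
  by (auto simp: H_eq)

lemma sets_H[measurable]: "H j \<in> sets borel"
  by (simp add: H_eq)

lemma measurable_cell[measurable]: "cell \<in> borel \<rightarrow>\<^sub>M count_space UNIV"
proof (rule measurableI)
  fix X :: "int set"
  have "cell -` X = (\<Union>j\<in>X. H j)" by (auto simp: H_def)
  also have "\<dots> \<in> sets borel"
    by (intro sets.countable_UN'') (auto intro: countable_subset[OF _ countableI_type])
  finally show "cell -` X \<inter> space borel \<in> sets borel" by simp
qed simp

lemma I_diam: "u \<in> I j \<Longrightarrow> v \<in> I j \<Longrightarrow> \<bar>u - v\<bar> \<le> a"
  by (auto simp: abs_le_iff distrib_left)

lemma measure_H: "measure lborel (H j) = a"
  using a_pos by (simp add: H_eq algebra_simps)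

lemma emeasure_H: "emeasure lborel (H j) = ennreal a"
  using a_pos by (simp add: H_eq algebra_simps)

lemma H_fmeasurable: "H j \<in> fmeasurable lborel"
  by (auto intro!: fmeasurableI simp: emeasure_H)

lemma B_gt_1: "1 < B"
  using l_gt_1 expanding[of 0 0] slope_le[of 0 0] a_pos by force

lemma cont_\<tau>: "continuous_on (I j) (\<tau> j)"
  unfolding continuous_on_eq_continuous_within using DERIV_continuous[OF deriv] by blast

lemma cont_\<tau>': "continuous_on (I j) (\<tau>' j)"
  unfolding continuous_on_eq_continuous_within using DERIV_continuous[OF deriv2] by blast

lemma \<tau>_inj: "inj_on (\<tau> j) (I j)" and \<tau>_image: "\<tau> j ` I j = J j"
  using bij[of j] by (auto simp: bij_betw_def)

lemma slope_pos: "x \<in> I j \<Longrightarrow> 0 < \<bar>\<tau>' j x\<bar>"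
  using expanding[of x j] l_gt_1 by linarith

lemma T_measurable[measurable]: "T \<in> borel \<rightarrow>\<^sub>M borel"
proof -
  define f where "f j x = (if x \<in> I j then \<tau> j x else 0)" for j x
  have "f j \<in> borel \<rightarrow>\<^sub>M borel" for j
    unfolding f_def by (intro borel_measurable_continuous_on_if cont_\<tau>) auto
  then have "(\<lambda>x. f (cell x) x) \<in> borel \<rightarrow>\<^sub>M borel"
    by (rule measurable_compose_countable[OF _ measurable_cell])
  also have "(\<lambda>x. f (cell x) x) = T"
  proof
    fix x
    have "x \<in> I (cell x)" using H_sub_I mem_H by blast
    then show "f (cell x) x = T x" by (simp add: T_eq f_def)
  qed
  finally show ?thesis .
qed

text \<open>The sign of the derivative is constant on a branch, so that adding a suitable multiple of the
  branch to the logarithm of its slope gives a monotone function.\<close>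

lemma slope_ratio:
  assumes "u \<in> I j" "v \<in> I j"
  shows "\<bar>\<tau>' j v\<bar> \<le> exp (\<eta> * \<bar>\<tau> j u - \<tau> j v\<bar>) * \<bar>\<tau>' j u\<bar>"
proof -
  obtain s :: real where s: "\<bar>s\<bar> = 1" "\<And>x. x \<in> I j \<Longrightarrow> 0 < s * \<tau>' j x"
  proof -
    have conn: "connected (\<tau>' j ` I j)" by (intro connected_continuous_image cont_\<tau>' connected_Icc)
    have nz: "0 \<notin> \<tau>' j ` I j" using slope_pos by force
    show ?thesis
    proof (cases "\<tau>' j u > 0")
      case True
      have "0 < \<tau>' j x" if "x \<in> I j" for x
      proof (rule ccontr)
        assume "\<not> 0 < \<tau>' j x"
        then have "0 \<in> \<tau>' j ` I j"
          using connectedD_interval[OF conn, of "\<tau>' j x" "\<tau>' j u" 0] that assms True by auto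
        with nz show False by simp
      qed
      then show ?thesis by (intro that[of 1]) auto
    next
      case False
      have "\<tau>' j x < 0" if "x \<in> I j" for x
      proof (rule ccontr)
        assume "\<not> \<tau>' j x < 0"
        then have "0 \<in> \<tau>' j ` I j"
          using connectedD_interval[OF conn, of "\<tau>' j u" "\<tau>' j x" 0] that assms False by auto
        with nz show False by simp
      qed
      then show ?thesis by (intro that[of "-1"]) auto
    qed
  qed
  have abs_eq: "\<bar>\<tau>' j x\<bar> = s * \<tau>' j x" if "x \<in> I j" for x
    using s(2)[OF that] s(1) by (metis abs_mult abs_of_pos mult_1)
  \<comment> \<open>The second derivative need not be continuous, so logarithms of slopes are
    compared through the sign of a derivative rather than by integration. The distortion bound says
    \<open>\<bar>\<tau>'' / \<tau>'\<bar> \<le> \<eta> * \<bar>\<tau>'\<bar>\<close>, hence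
    \<open>f 1\<close> increases and \<open>f (-1)\<close> decreases.\<close>
  define f where "f \<sigma> x = ln (s * \<tau>' j x) + \<sigma> * (\<eta> * (s * \<tau> j x))" for \<sigma> x
  have contf: "continuous_on (I j) (f \<sigma>)" for \<sigma>
    unfolding f_def using s(2) by (intro continuous_intros cont_\<tau> cont_\<tau>') force
  have derf: "DERIV (f \<sigma>) x :> \<tau>'' j x / \<tau>' j x + \<sigma> * (\<eta> * (s * \<tau>' j x))"
    if x: "a * j < x" "x < a * (j + 1)" for x \<sigma>
  proof -
    have "x \<in> I j" using x by simp
    then have D: "DERIV (\<tau> j) x :> \<tau>' j x" "DERIV (\<tau>' j) x :> \<tau>'' j x"
      using deriv[of x j] deriv2[of x j] x by (simp_all add: at_within_Icc_at)
    show ?thesis unfolding f_def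
      using s(2)[OF \<open>x \<in> I j\<close>] s(1)
      by (auto intro!: derivative_eq_intros D simp: field_simps)
  qed
  have bound: "\<bar>\<tau>'' j x / \<tau>' j x\<bar> \<le> \<eta> * (s * \<tau>' j x)" if x: "x \<in> I j" for x
  proof -
    have "\<tau>'' j x / \<tau>' j x = \<tau>'' j x / (\<tau>' j x)\<^sup>2 * \<tau>' j x"
      by (simp add: power2_eq_square)
    then have "\<bar>\<tau>'' j x / \<tau>' j x\<bar> = \<bar>\<tau>'' j x / (\<tau>' j x)\<^sup>2\<bar> * \<bar>\<tau>' j x\<bar>"
      by (simp only: abs_mult)
    also have "\<dots> \<le> \<eta> * \<bar>\<tau>' j x\<bar>" using distortion[of x j] x by (intro mult_right_mono) auto
    finally show ?thesis using abs_eq[OF x] by simp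
  qed
  have incr: "f 1 x \<le> f 1 y" if xy: "x \<in> I j" "y \<in> I j" "x \<le> y" for x y
  proof (rule DERIV_nonneg_imp_increasing_open[OF xy(3)])
    show "continuous_on {x..y} (f 1)" using xy by (intro continuous_on_subset[OF contf]) auto
    fix z assume z: "x < z" "z < y"
    then have "a * j < z" "z < a * (j + 1)" using xy by auto
    then have "DERIV (f 1) z :> \<tau>'' j z / \<tau>' j z + 1 * (\<eta> * (s * \<tau>' j z))" "z \<in> I j"
      using derf[of z 1] by auto
    then show "\<exists>D. DERIV (f 1) z :> D \<and> 0 \<le> D"
    proof (intro exI conjI)
      show "0 \<le> \<tau>'' j z / \<tau>' j z + 1 * (\<eta> * (s * \<tau>' j z))"
        using bound[OF \<open>z \<in> I j\<close>] unfolding abs_le_iff by linarith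
    qed
  qed
  have decr: "f (-1) y \<le> f (-1) x" if xy: "x \<in> I j" "y \<in> I j" "x \<le> y" for x y
  proof (rule DERIV_nonpos_imp_decreasing_open[OF xy(3)])
    show "continuous_on {x..y} (f (-1))" using xy by (intro continuous_on_subset[OF contf]) auto
    fix z assume z: "x < z" "z < y"
    then have "a * j < z" "z < a * (j + 1)" using xy by auto
    then have "DERIV (f (-1)) z :> \<tau>'' j z / \<tau>' j z + (-1) * (\<eta> * (s * \<tau>' j z))" "z \<in> I j"
      using derf[of z "-1"] by auto
    then show "\<exists>D. DERIV (f (-1)) z :> D \<and> D \<le> 0"
    proof (intro exI conjI)
      show "\<tau>'' j z / \<tau>' j z + (-1) * (\<eta> * (s * \<tau>' j z)) \<le> 0"
        using bound[OF \<open>z \<in> I j\<close>] unfolding abs_le_iff by linarith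
    qed
  qed
  have le: "s * t \<le> \<bar>t\<bar>" for t :: real using s(1) by (metis abs_ge_self abs_mult mult_1)
  have "ln (s * \<tau>' j v) - ln (s * \<tau>' j u) \<le> \<eta> * \<bar>\<tau> j u - \<tau> j v\<bar>"
  proof (cases "u \<le> v")
    case True
    have "ln (s * \<tau>' j v) - ln (s * \<tau>' j u) \<le> \<eta> * (s * (\<tau> j v - \<tau> j u))"
      using decr[OF assms True] by (simp add: f_def algebra_simps)
    also have "\<dots> \<le> \<eta> * \<bar>\<tau> j u - \<tau> j v\<bar>"
      using le[of "\<tau> j v - \<tau> j u"] \<eta>_nonneg by (intro mult_left_mono) (auto simp: abs_minus_commute)
    finally show ?thesis .
  next
    case False
    have "ln (s * \<tau>' j v) - ln (s * \<tau>' j u) \<le> \<eta> * (s * (\<tau> j u - \<tau> j v))"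
      using incr[OF assms(2,1)] False by (simp add: f_def algebra_simps)
    also have "\<dots> \<le> \<eta> * \<bar>\<tau> j u - \<tau> j v\<bar>"
      using le[of "\<tau> j u - \<tau> j v"] \<eta>_nonneg by (intro mult_left_mono) auto
    finally show ?thesis .
  qed
  then have "exp (ln (s * \<tau>' j v)) \<le> exp (\<eta> * \<bar>\<tau> j u - \<tau> j v\<bar> + ln (s * \<tau>' j u))"
    by simp
  then show ?thesis using s(2)[OF assms(1)] s(2)[OF assms(2)] abs_eq assms
    by (simp add: exp_add)
qed

lemma branch_expanding:
  assumes "u \<in> I j" "v \<in> I j"
  shows "l * \<bar>u - v\<bar> \<le> \<bar>\<tau> j u - \<tau> j v\<bar>"
proof -
  have *: "l * (y - x) \<le> \<bar>\<tau> j y - \<tau> j x\<bar>" if xy: "x \<in> I j" "y \<in> I j" "x < y" for x y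
  proof -
    have "\<exists>\<xi>\<in>{x<..<y}. \<tau> j y - \<tau> j x = \<tau>' j \<xi> * (y - x)"
    proof (rule mvt_simple[OF xy(3), where f' = "\<lambda>z h. \<tau>' j z * h"])
      fix z assume "x \<le> z" "z \<le> y"
      then have "(\<tau> j has_real_derivative \<tau>' j z) (at z within {x..y})"
        using xy by (intro DERIV_subset[OF deriv]) auto
      then show "(\<tau> j has_derivative (*) (\<tau>' j z)) (at z within {x..y})"
        by (simp add: has_field_derivative_def)
    qed
    then obtain \<xi> where \<xi>: "\<xi> \<in> {x<..<y}" "\<tau> j y - \<tau> j x = \<tau>' j \<xi> * (y - x)" by blast
    then have "l \<le> \<bar>\<tau>' j \<xi>\<bar>" using xy by (intro expanding) auto
    then show ?thesis using \<xi> xy by (simp add: abs_mult mult_right_mono)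
  qed
  show ?thesis
    using *[of u v] *[of v u] assms by (cases u v rule: linorder_cases) (auto simp: abs_minus_commute)
qed

section \<open>Transfer of densities along a single branch\<close>

definition branch_inv :: "int \<Rightarrow> real \<Rightarrow> real" where
  "branch_inv j = inv_into (I j) (\<tau> j)"

text \<open>The transfer operator of one branch: if a measure on the cell has density
  \<open>d\<close>, its image under \<open>\<tau> j\<close> has density
  \<open>push j d\<close>.\<close>

definition push :: "int \<Rightarrow> (real \<Rightarrow> real) \<Rightarrow> real \<Rightarrow> real" where
  "push j d y = (if y \<in> J j then d (branch_inv j y) / \<bar>\<tau>' j (branch_inv j y)\<bar> else 0)"

lemma branch_inv:
  assumes "y \<in> J j"
  shows "branch_inv j y \<in> I j" "\<tau> j (branch_inv j y) = y"
  using assms unfolding branch_inv_def \<tau>_image[symmetric] by (rule inv_into_into, rule f_inv_into_f)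

lemma branch_inv_\<tau>: "x \<in> I j \<Longrightarrow> branch_inv j (\<tau> j x) = x"
  unfolding branch_inv_def by (rule inv_into_f_f[OF \<tau>_inj])

lemma cont_branch_inv: "continuous_on (J j) (branch_inv j)"
  using continuous_on_inv[OF cont_\<tau> compact_Icc, of j "branch_inv j"] branch_inv_\<tau>
  by (simp add: \<tau>_image)

lemma push_measurable[measurable]:
  assumes [measurable]: "d \<in> borel_measurable borel"
  shows "push j d \<in> borel_measurable borel"
proof -
  have [measurable]: "(\<lambda>y. if y \<in> J j then branch_inv j y else 0) \<in> borel_measurable borel"
    by (intro borel_measurable_continuous_on_if cont_branch_inv) auto
  have [measurable]: "(\<lambda>y. if y \<in> J j then \<tau>' j (branch_inv j y) else 0) \<in> borel_measurable borel"
    using branch_inv(1)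
    by (intro borel_measurable_continuous_on_if continuous_on_compose2[OF cont_\<tau>' cont_branch_inv]) auto
  have "push j d = (\<lambda>y. if y \<in> J j then d (if y \<in> J j then branch_inv j y else 0) /
      \<bar>if y \<in> J j then \<tau>' j (branch_inv j y) else 0\<bar> else 0)"
    by (auto simp: push_def)
  also have "\<dots> \<in> borel_measurable borel" by measurable
  finally show ?thesis .
qed

text \<open>Change of variables along an injective branch. The bound \<open>D\<close> makes
  \<open>d\<close> integrable on the cell, so that the formula for absolutely integrable functions
  applies before both sides are read as nonnegative integrals again.\<close>

lemma nn_integral_push:
  assumes d[measurable]: "d \<in> borel_measurable borel"
    and d0: "\<And>x. x \<in> I j \<Longrightarrow> 0 \<le> d x" and dD: "\<And>x. x \<in> I j \<Longrightarrow> d x \<le> D"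
    and S[measurable]: "S \<in> sets borel"
  shows "(\<integral>\<^sup>+x. ennreal (d x) * indicator (H j \<inter> T -` S) x \<partial>lborel) =
    (\<integral>\<^sup>+y. ennreal (push j d y) * indicator S y \<partial>lborel)"
proof -
  define X where "X = H j \<inter> T -` S"
  have X[measurable]: "X \<in> sets borel"
    unfolding X_def using measurable_sets[OF T_measurable S] by simp
  have XI: "X \<subseteq> I j" using H_sub_I by (auto simp: X_def)
  have TX: "T x = \<tau> j x" if "x \<in> X" for x using that by (simp add: X_def T_eq mem_H)
  have eq: "\<bar>\<tau>' j x\<bar> * push j d (\<tau> j x) = d x" if "x \<in> X" for x
  proof -
    have x: "x \<in> I j" using that XI by blast
    have "push j d (\<tau> j x) = d x / \<bar>\<tau>' j x\<bar>"
      using \<tau>_image[of j] x unfolding push_def branch_inv_\<tau>[OF x] by (metis imageI)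
    then show ?thesis using slope_pos[OF x] by simp
  qed
  have Xfin: "emeasure lborel X < \<infinity>"
    using emeasure_mono[of X "H j" lborel] emeasure_H[of j] by (auto simp: X_def less_top[symmetric] top_unique)
  have "integrable lborel (\<lambda>x. indicator X x *\<^sub>R d x)"
    using d0 dD XI Xfin by (intro integrableI_bounded_set_indicator[of _ _ _ D]) (auto simp: subset_iff)
  then have dX: "d absolutely_integrable_on X"
    unfolding set_integrable_def by (subst integrable_completion) auto
  then have "(\<lambda>x. \<bar>\<tau>' j x\<bar> * push j d (\<tau> j x)) absolutely_integrable_on X \<and>
      integral X (\<lambda>x. \<bar>\<tau>' j x\<bar> * push j d (\<tau> j x)) = integral X d"
    using eq by (subst set_integrable_cong[OF refl refl, of X _ d]) (auto intro: integral_cong)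
  moreover have "inj_on (\<tau> j) X" by (rule inj_on_subset[OF \<tau>_inj XI])
  moreover have "(\<tau> j has_real_derivative \<tau>' j x) (at x within X)" if "x \<in> X" for x
    using that XI by (intro DERIV_subset[OF deriv XI]) blast
  ultimately have pX: "push j d absolutely_integrable_on \<tau> j ` X" "integral (\<tau> j ` X) (push j d) = integral X d"
    using has_absolute_integral_change_of_variables_1'[of X "\<tau> j" "\<tau>' j" "push j d" "integral X d"] by auto
  have "(d has_integral integral X d) X"
    using dX set_lebesgue_integral_eq_integral(1) by blast
  then have 1: "(\<integral>\<^sup>+x. ennreal (d x) * indicator X x \<partial>lborel) = ennreal (integral X d)"
    using d0 XI by (intro nn_integral_has_integral_lebesgue') auto
  have "(push j d has_integral integral X d) (\<tau> j ` X)"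
    using pX set_lebesgue_integral_eq_integral(1) by (metis integrable_integral)
  then have 2: "(\<integral>\<^sup>+y. ennreal (push j d y) * indicator (\<tau> j ` X) y \<partial>lborel) = ennreal (integral X d)"
  proof (rule nn_integral_has_integral_lebesgue'[rotated])
    show "0 \<le> push j d y" for y
      unfolding push_def using d0[OF branch_inv(1)] by (metis abs_ge_zero divide_nonneg_nonneg order_refl)
  qed
  have 3: "(\<integral>\<^sup>+y. ennreal (push j d y) * indicator (\<tau> j ` X) y \<partial>lborel) =
      (\<integral>\<^sup>+y. ennreal (push j d y) * indicator S y \<partial>lborel)"
  proof (rule nn_integral_cong_AE)
    \<comment> \<open>The half-open cell lacks its right endpoint, so the image of \<open>X\<close>
      may miss this one value.\<close>
    have "AE y in lborel. y \<noteq> \<tau> j (a * (j + 1))" by (rule AE_lborel_singleton)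
    then show "AE y in lborel. ennreal (push j d y) * indicator (\<tau> j ` X) y = ennreal (push j d y) * indicator S y"
    proof eventually_elim
      case (elim y)
      show ?case
      proof (cases "y \<in> J j")
        case True
        have "y \<in> \<tau> j ` X \<longleftrightarrow> y \<in> S"
        proof
          assume "y \<in> S"
          have "branch_inv j y \<in> H j"
            using branch_inv[OF True] elim by (force simp: H_eq less_le)
          moreover have "T (branch_inv j y) = y"
            using branch_inv[OF True] \<open>branch_inv j y \<in> H j\<close> by (simp add: T_eq mem_H)
          ultimately show "y \<in> \<tau> j ` X"
            using \<open>y \<in> S\<close> branch_inv[OF True] by (force simp: X_def)
        next
          assume "y \<in> \<tau> j ` X"
          then show "y \<in> S" using TX by (auto simp: X_def)
        qed
        then show ?thesis by (simp add: indicator_def)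
      next
        case False
        then show ?thesis by (simp only: push_def if_False ennreal_0 mult_zero_left)
      qed
    qed
  qed
  show ?thesis using 1 2 3 by (simp add: X_def)
qed

text \<open>Each branch carries Lebesgue measure on its cell to a measure with a density, and
  countably many cells exhaust the line.\<close>

lemma null_vimage_T:
  assumes "A \<in> null_sets lborel"
  shows "T -` A \<in> null_sets lborel"
proof -
  have A[measurable]: "A \<in> sets borel" using assms by (simp add: null_sets_def)
  have meas: "T -` A \<in> sets borel" using measurable_sets[OF T_measurable A] by simp
  have "H j \<inter> T -` A \<in> null_sets lborel" for j
  proof -
    have "emeasure lborel (H j \<inter> T -` A) = (\<integral>\<^sup>+x. ennreal 1 * indicator (H j \<inter> T -` A) x \<partial>lborel)"
      using meas by simp
    also have "\<dots> = (\<integral>\<^sup>+y. ennreal (push j (\<lambda>_. 1) y) * indicator A y \<partial>lborel)"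
      by (rule nn_integral_push[where D = 1]) auto
    also have "\<dots> = 0" using AE_not_in[OF assms] by (subst nn_integral_0_iff_AE) auto
    finally show ?thesis using meas by (auto simp: null_sets_def)
  qed
  then have "(\<Union>j. H j \<inter> T -` A) \<in> null_sets lborel" by (intro null_sets_UN) auto
  also have "(\<Union>j. H j \<inter> T -` A) = T -` A" by (auto simp: H_def)
  finally show ?thesis .
qed

lemma Tn_measurable[measurable]: "T ^^ n \<in> borel \<rightarrow>\<^sub>M borel"
  by simp

lemma null_vimage_Tn: "A \<in> null_sets lborel \<Longrightarrow> (T ^^ n) -` A \<in> null_sets lborel"
proof (induction n)
  case (Suc n)
  have "(T ^^ Suc n) -` A = T -` ((T ^^ n) -` A)"
    by (simp only: funpow_Suc_right vimage_comp)
  then show ?case using null_vimage_T[OF Suc.IH[OF Suc.prems]] by (simp only:)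
qed simp

lemma AE_Tn: "AE x in lborel. P x \<Longrightarrow> AE x in lborel. \<forall>n. P ((T ^^ n) x)"
proof -
  assume "AE x in lborel. P x"
  then obtain A where A: "A \<in> null_sets lborel" "{x. \<not> P x} \<subseteq> A"
    by (auto simp: eventually_ae_filter)
  have "AE x in lborel. P ((T ^^ n) x)" for n
    using AE_not_in[OF null_vimage_Tn[OF A(1), of n]] by eventually_elim (use A(2) in auto)
  then show ?thesis by (simp add: AE_all_countable)
qed

text \<open>By the Markov property a branch either covers a cell completely or meets its half-open
  version in at most one point; an edge stands for the first alternative.\<close>

definition edge :: "int \<Rightarrow> int \<Rightarrow> bool" where
  "edge i j \<longleftrightarrow> p i \<le> j \<and> j \<le> q i"

lemma edge_sub: "edge i j \<Longrightarrow> I j \<subseteq> J i"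
proof -
  assume "edge i j"
  then have "real_of_int (p i) \<le> j" "real_of_int j + 1 \<le> q i + 1" by (auto simp: edge_def)
  then have "a * p i \<le> a * j" "a * (real_of_int j + 1) \<le> a * (q i + 1)"
    using a_pos by (intro mult_left_mono; simp)+
  then show ?thesis by auto
qed

text \<open>\<open>J i\<close> is closed while the cells are half-open, so the right endpoint of
  \<open>J i\<close> already belongs to the following cell.\<close>

lemma not_edge_Int: "\<not> edge i j \<Longrightarrow> H j \<inter> J i \<subseteq> {a * (q i + 1)}"
proof
  fix x assume ne: "\<not> edge i j" and x: "x \<in> H j \<inter> J i"
  then have xj: "a * j \<le> x" "x < a * (j + 1)" "a * p i \<le> x" "x \<le> a * (q i + 1)" by (auto simp: H_eq)
  from ne consider "j < p i" | "q i < j" by (auto simp: edge_def)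
  then show "x \<in> {a * (q i + 1)}"
  proof cases
    case 1
    then have "a * (real_of_int j + 1) \<le> a * p i" using a_pos by (intro mult_left_mono) auto
    with xj show ?thesis by simp
  next
    case 2
    then have "a * (q i + 1) \<le> a * real_of_int j" using a_pos by (intro mult_left_mono) auto
    with xj show ?thesis by simp
  qed
qed

text \<open>Branch \<open>i\<close> covers all of \<open>S\<close> and stretches by a factor of at
  most \<open>B\<close>.\<close>

lemma measure_le_edge:
  assumes e: "edge i j" and S[measurable]: "S \<in> sets borel" and SH: "S \<subseteq> H j"
  shows "measure lborel S \<le> B * measure lborel (H i \<inter> T -` S)"
proof -
  have meas: "T -` S \<in> sets borel" using measurable_sets[OF T_measurable S] by simp
  have fS: "S \<in> fmeasurable lborel" using SH by (intro fmeasurableI2[OF H_fmeasurable]) auto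
  have fX: "H i \<inter> T -` S \<in> fmeasurable lborel"
    using meas by (intro fmeasurable_Int_fmeasurable H_fmeasurable) auto
  have "emeasure lborel S = (\<integral>\<^sup>+y. indicator S y \<partial>lborel)" by simp
  also have "\<dots> \<le> (\<integral>\<^sup>+y. ennreal B * (ennreal (push i (\<lambda>_. 1) y) * indicator S y) \<partial>lborel)"
  proof (rule nn_integral_mono)
    fix y
    show "indicator S y \<le> ennreal B * (ennreal (push i (\<lambda>_. 1) y) * indicator S y)"
    proof (cases "y \<in> S")
      case True
      then have y: "y \<in> J i" using SH edge_sub[OF e] H_sub_I by blast
      have "1 \<le> B * (1 / \<bar>\<tau>' i (branch_inv i y)\<bar>)"
        using slope_le[OF branch_inv(1)[OF y]] slope_pos[OF branch_inv(1)[OF y]] by (simp add: field_simps)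
      then show ?thesis using True y B_gt_1
        by (simp add: push_def ennreal_mult[symmetric] del: ennreal_1 add: ennreal_1[symmetric])
    qed simp
  qed
  also have "\<dots> = ennreal B * (\<integral>\<^sup>+y. ennreal (push i (\<lambda>_. 1) y) * indicator S y \<partial>lborel)"
    by (rule nn_integral_cmult) measurable
  also have "(\<integral>\<^sup>+y. ennreal (push i (\<lambda>_. 1) y) * indicator S y \<partial>lborel) =
      (\<integral>\<^sup>+x. ennreal 1 * indicator (H i \<inter> T -` S) x \<partial>lborel)"
    by (rule nn_integral_push[symmetric, where D = 1]) auto
  also have "\<dots> = emeasure lborel (H i \<inter> T -` S)" using meas by simp
  finally show ?thesis using fS fX B_gt_1
    by (simp add: emeasure_eq_measure2 ennreal_mult[symmetric])
qed

text \<open>The solution of \<open>M / l + \<eta> = M\<close>, that is \<eta> times the geometric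
  series in \<open>1 / l\<close>. One push divides the Lipschitz constant of the logarithm of a
  density by \<open>l\<close>, because inverse branches contract, and adds \<open>\<eta>\<close> for
  the change of slope; the constant \<open>M\<close> is therefore kept for ever.\<close>

definition M :: real where "M = \<eta> * l / (l - 1)"

lemma M_nonneg: "0 \<le> M" and M_eq: "M / l + \<eta> = M"
  using \<eta>_nonneg l_gt_1 by (auto simp: M_def field_simps)

text \<open>The logarithm of the density has Lipschitz constant \<open>M\<close>. The multiplicative
  form admits the density 0, which belongs to null cylinders.\<close>

definition regular :: "int \<Rightarrow> (real \<Rightarrow> real) \<Rightarrow> bool" where
  "regular j d \<longleftrightarrow> (\<forall>x\<in>I j. 0 \<le> d x) \<and> (\<forall>x\<in>I j. \<forall>y\<in>I j. d x \<le> exp (M * \<bar>x - y\<bar>) * d y)"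

lemma regular_push:
  assumes d: "regular i d" and e: "edge i j"
  shows "regular j (push i d)"
  unfolding regular_def
proof (intro conjI ballI)
  fix y assume "y \<in> I j"
  then have y: "y \<in> J i" using edge_sub[OF e] by blast
  note u = branch_inv[OF y]
  show "0 \<le> push i d y" using d u y by (simp add: push_def regular_def)
  fix z assume "z \<in> I j"
  then have z: "z \<in> J i" using edge_sub[OF e] by blast
  note v = branch_inv[OF z]
  let ?u = "branch_inv i y" and ?v = "branch_inv i z"
  have "l * \<bar>?u - ?v\<bar> \<le> \<bar>y - z\<bar>" using branch_expanding[OF u(1) v(1)] u v by simp
  then have "\<bar>?u - ?v\<bar> \<le> \<bar>y - z\<bar> / l" using l_gt_1 by (simp add: field_simps)
  then have "M * \<bar>?u - ?v\<bar> \<le> M * (\<bar>y - z\<bar> / l)" using M_nonneg by (rule mult_left_mono)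
  then have ee: "exp (M * \<bar>?u - ?v\<bar>) \<le> exp (M / l * \<bar>y - z\<bar>)" by simp
  have dd: "d ?u \<le> exp (M * \<bar>?u - ?v\<bar>) * d ?v" "0 \<le> d ?v" "0 \<le> d ?u"
    using d u(1) v(1) unfolding regular_def by blast+
  have 1: "d ?u \<le> exp (M / l * \<bar>y - z\<bar>) * d ?v"
    using dd(1) mult_right_mono[OF ee dd(2)] by linarith
  have 2: "\<bar>\<tau>' i ?v\<bar> \<le> exp (\<eta> * \<bar>y - z\<bar>) * \<bar>\<tau>' i ?u\<bar>"
    using slope_ratio[OF u(1) v(1)] u v by simp
  have pos: "0 < \<bar>\<tau>' i ?u\<bar>" "0 < \<bar>\<tau>' i ?v\<bar>" using slope_pos u(1) v(1) by auto
  have "1 / \<bar>\<tau>' i ?u\<bar> \<le> exp (\<eta> * \<bar>y - z\<bar>) / \<bar>\<tau>' i ?v\<bar>"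
    using 2 pos by (simp add: divide_simps)
  then have "d ?u * (1 / \<bar>\<tau>' i ?u\<bar>) \<le> (exp (M / l * \<bar>y - z\<bar>) * d ?v) * (exp (\<eta> * \<bar>y - z\<bar>) / \<bar>\<tau>' i ?v\<bar>)"
    using 1 dd by (intro mult_mono) auto
  also have "\<dots> = exp (M / l * \<bar>y - z\<bar> + \<eta> * \<bar>y - z\<bar>) * (d ?v / \<bar>\<tau>' i ?v\<bar>)"
    by (simp add: exp_add)
  also have "M / l * \<bar>y - z\<bar> + \<eta> * \<bar>y - z\<bar> = M * \<bar>y - z\<bar>"
    by (simp only: distrib_right[symmetric] M_eq)
  finally show "push i d y \<le> exp (M * \<bar>y - z\<bar>) * push i d z"
    using y z by (simp add: push_def)
qed

section \<open>Itineraries, cylinders and bounded distortion\<close>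

definition it :: "real \<Rightarrow> nat \<Rightarrow> int" where
  "it x n = cell ((T ^^ n) x)"

definition cyl :: "nat \<Rightarrow> real \<Rightarrow> real set" where
  "cyl n x = {y. \<forall>m\<le>n. it y m = it x m}"

lemma it_funpow: "it ((T ^^ m) x) n = it x (n + m)"
  by (simp add: it_def funpow_add)

lemma measurable_it[measurable]: "(\<lambda>x. it x n) \<in> borel \<rightarrow>\<^sub>M count_space UNIV"
  unfolding it_def by measurable

lemma sets_cyl[measurable]: "cyl n x \<in> sets borel"
proof -
  have "{y \<in> space borel. \<forall>m\<in>{..n}. it y m = it x m} \<in> sets borel" by measurable
  then show ?thesis by (simp add: cyl_def)
qed

text \<open>The density is that of the image under \<open>T ^^ n\<close> of Lebesgue measure on the
  cylinder; it arises by pushing the constant 1 along the itinerary. What matters is that one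
  regularity constant serves for all \<open>n\<close>.\<close>

lemma cyl_density:
  "\<exists>d\<in>borel_measurable borel. regular (it x n) d \<and> (\<forall>S\<in>sets borel. S \<subseteq> H (it x n) \<longrightarrow>
     emeasure lborel (cyl n x \<inter> (T ^^ n) -` S) = (\<integral>\<^sup>+y. ennreal (d y) * indicator S y \<partial>lborel))"
proof (induction n)
  case 0
  have "cyl 0 x \<inter> S = S" if "S \<subseteq> H (it x 0)" for S
    using that by (auto simp: cyl_def it_def H_def)
  then show ?case
    using M_nonneg by (intro bexI[of _ "\<lambda>_. 1"]) (auto simp: regular_def)
next
  case (Suc n)
  then obtain d where d[measurable]: "d \<in> borel_measurable borel" and reg: "regular (it x n) d"
    and dS: "\<And>S. S \<in> sets borel \<Longrightarrow> S \<subseteq> H (it x n) \<Longrightarrow>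
      emeasure lborel (cyl n x \<inter> (T ^^ n) -` S) = (\<integral>\<^sup>+y. ennreal (d y) * indicator S y \<partial>lborel)"
    by blast
  define i where "i = it x n"
  define j where "j = it x (Suc n)"
  have step: "emeasure lborel (cyl (Suc n) x \<inter> (T ^^ Suc n) -` S) =
      (\<integral>\<^sup>+y. ennreal (push i d y) * indicator S y \<partial>lborel)"
    if S[measurable]: "S \<in> sets borel" and SH: "S \<subseteq> H j" for S
  proof -
    have "cyl (Suc n) x \<inter> (T ^^ Suc n) -` S = cyl n x \<inter> (T ^^ n) -` (H i \<inter> T -` S)"
    proof (rule set_eqI)
      fix y
      have "T ((T ^^ n) y) \<in> S \<Longrightarrow> it y (Suc n) = it x (Suc n)"
        using SH by (auto simp: it_def j_def H_def)
      moreover have "it y n = it x n \<Longrightarrow> (T ^^ n) y \<in> H i" by (auto simp: it_def i_def H_def)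
      ultimately show "y \<in> cyl (Suc n) x \<inter> (T ^^ Suc n) -` S \<longleftrightarrow> y \<in> cyl n x \<inter> (T ^^ n) -` (H i \<inter> T -` S)"
        by (auto simp: cyl_def le_Suc_eq)
    qed
    also have "emeasure lborel \<dots> = (\<integral>\<^sup>+y. ennreal (d y) * indicator (H i \<inter> T -` S) y \<partial>lborel)"
      using measurable_sets[OF T_measurable S] by (intro dS) (auto simp: i_def)
    also have "\<dots> = (\<integral>\<^sup>+y. ennreal (push i d y) * indicator S y \<partial>lborel)"
    proof (rule nn_integral_push[where D = "exp (M * a) * d (a * i)"])
      fix y assume y: "y \<in> I i"
      then show "0 \<le> d y" using reg by (auto simp: regular_def i_def)
      have ai: "a * i \<in> I i" using a_pos by (simp add: algebra_simps)
      have "d y \<le> exp (M * \<bar>y - a * i\<bar>) * d (a * i)"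
        using reg y ai unfolding regular_def i_def[symmetric] by blast
      also have "\<dots> \<le> exp (M * a) * d (a * i)"
        using mult_left_mono[OF I_diam[OF y ai] M_nonneg] reg ai unfolding regular_def i_def[symmetric]
        by (intro mult_right_mono) auto
      finally show "d y \<le> exp (M * a) * d (a * i)" .
    qed auto
    finally show ?thesis .
  qed
  show ?case
  proof (cases "edge i j")
    case True
    then show ?thesis
      using step regular_push[OF reg[folded i_def]] unfolding j_def[symmetric]
      by (intro bexI[of _ "push i d"]) (auto simp del: funpow.simps)
  next
    \<comment> \<open>Exceptional points may follow a transition that is not an edge. The image then
      meets the next cell in at most one point, so the cylinder is null and the density is
      0.\<close>
    case False
    have "(\<integral>\<^sup>+y. ennreal (push i d y) * indicator S y \<partial>lborel) = 0"
      if [measurable]: "S \<in> sets borel" and SH: "S \<subseteq> H j" for S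
    proof (subst nn_integral_0_iff_AE)
      have "AE y in lborel. y \<noteq> a * (q i + 1)" by (rule AE_lborel_singleton)
      then show "AE y in lborel. ennreal (push i d y) * indicator S y = 0"
        by eventually_elim (use not_edge_Int[OF False] SH in \<open>auto simp: push_def indicator_def\<close>)
    qed simp
    then show ?thesis
      using step unfolding j_def[symmetric]
      by (intro bexI[of _ "\<lambda>_. 0"]) (auto simp: regular_def simp del: funpow.simps)
  qed
qed

lemma cyl_sub_H: "cyl n x \<subseteq> H (it x 0)"
  by (force simp: cyl_def it_def H_def)

lemma cyl_fmeasurable: "cyl n x \<in> fmeasurable lborel"
  using cyl_sub_H by (intro fmeasurableI2[OF H_fmeasurable]) auto

text \<open>On a cell of length \<open>a\<close> a regular density stays within a factor
  \<open>exp (M * a)\<close> of its value at the left endpoint, above and below; this explains the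
  square \<open>exp (2 * M * a)\<close>, and the factor \<open>a\<close> is the length of the cell.
  The product form is valid for null cylinders too.\<close>

lemma cyl_distortion:
  assumes S[measurable]: "S \<in> sets borel" and SH: "S \<subseteq> H (it x n)"
  shows "measure lborel (cyl n x) * measure lborel S
    \<le> a * exp (2 * M * a) * measure lborel (cyl n x \<inter> (T ^^ n) -` S)"
proof -
  define i where "i = it x n"
  define e where "e = exp (M * a)"
  have e: "e > 0" by (simp add: e_def)
  obtain d where d[measurable]: "d \<in> borel_measurable borel" and reg: "regular i d"
    and dS: "\<And>S. S \<in> sets borel \<Longrightarrow> S \<subseteq> H i \<Longrightarrow>
      emeasure lborel (cyl n x \<inter> (T ^^ n) -` S) = (\<integral>\<^sup>+y. ennreal (d y) * indicator S y \<partial>lborel)"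
    using cyl_density[of x n] unfolding i_def by blast
  define d0 where "d0 = d (a * i)"
  have ai: "a * i \<in> I i" using a_pos by (simp add: algebra_simps)
  have d0: "0 \<le> d0" using reg ai by (auto simp: regular_def d0_def)
  have bnd: "d y \<le> e * d0" "d0 / e \<le> d y" "0 \<le> d y" if y: "y \<in> I i" for y
  proof -
    show y0: "0 \<le> d y" using reg y by (auto simp: regular_def)
    have le: "exp (M * \<bar>y - a * i\<bar>) \<le> e" "exp (M * \<bar>a * i - y\<bar>) \<le> e"
      using mult_left_mono[OF I_diam[OF y ai] M_nonneg] mult_left_mono[OF I_diam[OF ai y] M_nonneg]
      unfolding e_def by auto
    have "d y \<le> exp (M * \<bar>y - a * i\<bar>) * d0" "d0 \<le> exp (M * \<bar>a * i - y\<bar>) * d y"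
      using reg y ai unfolding regular_def d0_def by blast+
    then show "d y \<le> e * d0" "d0 / e \<le> d y"
      using le mult_right_mono[OF le(1) d0] mult_right_mono[OF le(2) y0] e by (auto simp: field_simps)
  qed
  have fS: "S \<in> fmeasurable lborel" using SH by (intro fmeasurableI2[OF H_fmeasurable]) auto
  have vS: "(T ^^ n) -` S \<in> sets borel" using measurable_sets[OF Tn_measurable S] by simp
  have fX: "cyl n x \<inter> (T ^^ n) -` S \<in> fmeasurable lborel"
    using vS by (intro fmeasurable_Int_fmeasurable cyl_fmeasurable) auto
  have "cyl n x \<inter> (T ^^ n) -` H i = cyl n x" by (auto simp: cyl_def it_def H_def i_def)
  then have "emeasure lborel (cyl n x) = (\<integral>\<^sup>+y. ennreal (d y) * indicator (H i) y \<partial>lborel)"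
    using dS[of "H i"] by simp
  also have "\<dots> \<le> (\<integral>\<^sup>+y. ennreal (e * d0) * indicator (H i) y \<partial>lborel)"
  proof (rule nn_integral_mono)
    fix y show "ennreal (d y) * indicator (H i) y \<le> ennreal (e * d0) * indicator (H i) y"
      using bnd(1)[of y] H_sub_I[of i] by (cases "y \<in> H i") (auto intro!: ennreal_leI)
  qed
  also have "\<dots> = ennreal (e * d0) * ennreal a" by (simp add: nn_integral_cmult_indicator emeasure_H)
  finally have 1: "measure lborel (cyl n x) \<le> e * d0 * a"
    using cyl_fmeasurable[of n x] e d0 a_pos by (simp add: emeasure_eq_measure2 ennreal_mult[symmetric])
  have "ennreal (d0 / e) * emeasure lborel S = (\<integral>\<^sup>+y. ennreal (d0 / e) * indicator S y \<partial>lborel)"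
    by (simp add: nn_integral_cmult_indicator)
  also have "\<dots> \<le> (\<integral>\<^sup>+y. ennreal (d y) * indicator S y \<partial>lborel)"
  proof (rule nn_integral_mono)
    fix y show "ennreal (d0 / e) * indicator S y \<le> ennreal (d y) * indicator S y"
      using bnd(2)[of y] H_sub_I[of i] SH unfolding i_def[symmetric]
      by (cases "y \<in> S") (auto intro!: ennreal_leI)
  qed
  also have "\<dots> = emeasure lborel (cyl n x \<inter> (T ^^ n) -` S)"
    using dS[of S] SH by (simp add: i_def)
  finally have 2: "d0 / e * measure lborel S \<le> measure lborel (cyl n x \<inter> (T ^^ n) -` S)"
    using fS fX e d0 by (simp add: emeasure_eq_measure2 ennreal_mult[symmetric])
  have "measure lborel (cyl n x) * measure lborel S \<le> e * d0 * a * measure lborel S"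
    using 1 by (intro mult_right_mono) auto
  also have "\<dots> = a * (e * e) * (d0 / e * measure lborel S)" using e by (simp add: field_simps)
  also have "\<dots> \<le> a * (e * e) * measure lborel (cyl n x \<inter> (T ^^ n) -` S)"
    using 2 a_pos e by (intro mult_left_mono) auto
  also have "e * e = exp (2 * M * a)" by (simp add: e_def exp_add[symmetric])
  finally show ?thesis .
qed

lemma cyl_diam:
  assumes "\<And>m. m \<le> n \<Longrightarrow> it x m = it y m"
  shows "\<bar>x - y\<bar> \<le> a / l ^ n"
proof -
  have same: "(T ^^ m) x \<in> H (it x m)" "(T ^^ m) y \<in> H (it x m)" if "m \<le> n" for m
    using assms[OF that] by (auto simp: H_def it_def)
  have "l ^ m * \<bar>x - y\<bar> \<le> \<bar>(T ^^ m) x - (T ^^ m) y\<bar>" if "m \<le> n" for m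
    using that
  proof (induction m)
    case (Suc m)
    have "l ^ Suc m * \<bar>x - y\<bar> \<le> l * \<bar>(T ^^ m) x - (T ^^ m) y\<bar>"
      using Suc l_gt_1 by simp
    also have "\<dots> \<le> \<bar>\<tau> (it x m) ((T ^^ m) x) - \<tau> (it x m) ((T ^^ m) y)\<bar>"
      using same[of m] Suc.prems by (intro branch_expanding subsetD[OF H_sub_I]) auto
    also have "\<dots> = \<bar>(T ^^ Suc m) x - (T ^^ Suc m) y\<bar>"
      using same[of m] Suc.prems by (simp add: T_eq mem_H)
    finally show ?case .
  qed simp
  from this[of n] have "l ^ n * \<bar>x - y\<bar> \<le> \<bar>(T ^^ n) x - (T ^^ n) y\<bar>" by simp
  also have "\<dots> \<le> a" using same[of n] by (auto simp: H_eq algebra_simps)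
  finally show ?thesis using l_gt_1 by (simp add: field_simps)
qed

lemma cyl_eq: "{y. map (it y) [0..<Suc n] = map (it x) [0..<Suc n]} = cyl n x"
proof -
  have "map (it y) [0..<Suc n] = map (it x) [0..<Suc n] \<longleftrightarrow> (\<forall>m\<le>n. it y m = it x m)" for y
    by (simp only: list_eq_iff_nth_eq) (auto simp del: upt_Suc simp: less_Suc_eq_le)
  then show ?thesis by (simp only: cyl_def)
qed

text \<open>For large \<open>n\<close> the set \<open>A\<close> occupies almost all of the cylinder
  of \<open>x\<close>, and \<open>T ^^ n\<close> sends it into \<open>An n\<close>; bounded
  distortion turns the small missing proportion of the cylinder into a small missing part of the
  cell that is reached. The target may vary with \<open>n\<close>, as it does for tail sets.\<close>

lemma fill:
  assumes A[measurable]: "A \<in> sets borel" and An[measurable]: "\<And>n. An n \<in> sets borel"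
    and sub: "\<And>n. A - (T ^^ n) -` An n \<in> null_sets lborel"
  shows "AE x in lborel. x \<in> A \<longrightarrow> (\<lambda>n. measure lborel (H (it x n) - An n)) \<longlonglongrightarrow> 0"
proof -
  define \<pi> where "\<pi> n x = map (it x) [0..<Suc n]" for n x
  have fib: "{y. \<pi> n y = \<pi> n x} = cyl n x" for n x unfolding \<pi>_def by (rule cyl_eq)
  have sets_fib: "{y. \<pi> n y = c} \<in> sets borel" for n c
  proof (cases "\<exists>x. \<pi> n x = c")
    case True
    then show ?thesis using fib by auto
  next
    case False
    then have "{y. \<pi> n y = c} = {}" by auto
    then show ?thesis by (metis sets.empty_sets)
  qed
  have agree: "it x m = it y m" if "\<pi> n x = \<pi> n y" "m \<le> n" for x y m n
    using fib[of n y] that unfolding cyl_def by blast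
  have dens: "AE x in lborel. x \<in> A \<longrightarrow> (\<forall>\<epsilon>>0. \<forall>\<^sub>F n in sequentially.
      measure lborel ({y. \<pi> n y = \<pi> n x} - A) \<le> \<epsilon> * measure lborel {y. \<pi> n y = \<pi> n x})"
  proof (rule AE_fibre_density)
    show "\<pi> m x = \<pi> m y" if "m \<le> n" "\<pi> n x = \<pi> n y" for m n x y
      using agree[OF that(2)] that(1) by (auto simp: \<pi>_def)
    show "\<bar>x - y\<bar> \<le> a / l ^ n" if "\<pi> n x = \<pi> n y" for n x y
      using agree[OF that] by (rule cyl_diam)
    show "(\<lambda>n. a / l ^ n) \<longlonglongrightarrow> 0"
      using l_gt_1 by (rule LIMSEQ_divide_realpow_zero)
  qed (auto intro: sets_fib)
  have pos: "AE x in lborel. \<forall>n. 0 < measure lborel (cyl n x)"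
  proof (subst AE_all_countable, intro allI)
    fix n
    \<comment> \<open>There are only countably many cylinders of each length, so almost no point
      lies in a null one; for the others the measure can be cancelled in the distortion
      inequality.\<close>
    define Z where "Z = (\<Union>c\<in>{c. {y. \<pi> n y = c} \<in> null_sets lborel}. {y. \<pi> n y = c})"
    have "Z \<in> null_sets lborel" unfolding Z_def
      by (intro null_sets_UN') auto
    then have "AE x in lborel. x \<notin> Z" by (rule AE_not_in)
    then show "AE x in lborel. 0 < measure lborel (cyl n x)"
    proof eventually_elim
      case (elim x)
      show ?case
      proof (rule ccontr)
        assume "\<not> 0 < measure lborel (cyl n x)"
        then have "measure lborel (cyl n x) = 0" using measure_nonneg[of lborel "cyl n x"] by linarith
        then have "cyl n x \<in> null_sets lborel"
          using cyl_fmeasurable[of n x] by (simp add: null_sets_def emeasure_eq_measure2)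
        then have "x \<in> Z" unfolding Z_def fib[symmetric] by blast
        with elim show False by simp
      qed
    qed
  qed
  show ?thesis
    using dens pos
  proof eventually_elim
    case (elim x)
    show ?case
    proof (intro impI LIMSEQ_I)
      fix r :: real assume x: "x \<in> A" and r: "r > 0"
      define K where "K = a * exp (2 * M * a)"
      have K: "K > 0" using a_pos by (simp add: K_def)
      have "\<forall>\<^sub>F n in sequentially. measure lborel (cyl n x - A) \<le> r / (2 * K) * measure lborel (cyl n x)"
        using elim(1)[rule_format, OF x, of "r / (2 * K)"] r K unfolding fib by simp
      then obtain n0 where n0: "\<And>n. n \<ge> n0 \<Longrightarrow>
          measure lborel (cyl n x - A) \<le> r / (2 * K) * measure lborel (cyl n x)"
        by (auto simp: eventually_sequentially)
      have "norm (measure lborel (H (it x n) - An n) - 0) < r" if "n \<ge> n0" for n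
      proof -
        let ?S = "H (it x n) - An n" and ?Z = "A - (T ^^ n) -` An n"
        have vS: "(T ^^ n) -` ?S \<in> sets borel" using measurable_sets[OF Tn_measurable, of ?S n] by simp
        have "measure lborel (cyl n x) * measure lborel ?S \<le> K * measure lborel (cyl n x \<inter> (T ^^ n) -` ?S)"
          unfolding K_def by (rule cyl_distortion) auto
        \<comment> \<open>A point of the cylinder that lands outside \<open>An n\<close> is outside
          \<open>A\<close>, up to the exceptional null set \<open>?Z\<close>.\<close>
        also have "measure lborel (cyl n x \<inter> (T ^^ n) -` ?S) \<le> measure lborel ((cyl n x - A) \<union> ?Z)"
        proof (rule measure_mono_fmeasurable)
          show "(cyl n x - A) \<union> ?Z \<in> fmeasurable lborel"
            using sub[of n] by (intro fmeasurable.Un fmeasurable_Diff cyl_fmeasurable fmeasurableI_null_sets) auto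
        qed (use vS in auto)
        also have "\<dots> = measure lborel (cyl n x - A)"
          using sub[of n] by (intro measure_Un_null_set) auto
        also have "\<dots> \<le> r / (2 * K) * measure lborel (cyl n x)" by (rule n0[OF that])
        finally have "measure lborel (cyl n x) * measure lborel ?S \<le> measure lborel (cyl n x) * (r / 2)"
          using K by (simp add: mult.commute)
        then have "measure lborel ?S \<le> r / 2" using elim(2) by (simp add: mult_le_cancel_left_pos)
        then show ?thesis using r by simp
      qed
      then show "\<exists>no. \<forall>n\<ge>no. norm (measure lborel (H (it x n) - An n) - 0) < r" by blast
    qed
  qed
qed

end

section \<open>Exactness of modified lifts\<close>

lemma nonnull_obtain:
  assumes "A \<in> sets borel" "A \<notin> null_sets lborel" "AE x in lborel. x \<in> A \<longrightarrow> P x"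
  obtains x where "x \<in> A" "P x"
proof -
  have "\<exists>x\<in>A. P x"
  proof (rule ccontr)
    assume "\<not> (\<exists>x\<in>A. P x)"
    then have "AE x in lborel. x \<notin> A" using assms(3) by (auto elim!: AE_mp)
    then show False using assms AE_iff_null_sets[of A lborel] by auto
  qed
  then show ?thesis using that by blast
qed

text \<open>The first value that reaches \<open>i0\<close> exceeds its predecessor, still below
  \<open>i0\<close>, by at most \<open>L\<close>, so it lies in a window of length \<open>L\<close>.
  The bound on the initial values delays this passage beyond time \<open>n0\<close>.\<close>

lemma first_passage:
  fixes f :: "nat \<Rightarrow> int"
  assumes jump: "\<And>n. f (Suc n) - f n \<le> L" and unb: "\<exists>n. i0 \<le> f n" and small: "\<And>n. n \<le> n0 \<Longrightarrow> f n < i0"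
  obtains n where "n0 \<le> n" "i0 \<le> f n" "f n < i0 + L"
proof -
  define n where "n = (LEAST n. i0 \<le> f n)"
  have n: "i0 \<le> f n" unfolding n_def using unb by (rule LeastI_ex)
  have lt: "f m < i0" if "m < n" for m using not_less_Least[of m "\<lambda>n. i0 \<le> f n"] that by (auto simp: n_def)
  have "n0 < n" using small[of n] n by (meson leI not_less)
  then obtain m where m: "n = Suc m" by (cases n) auto
  show ?thesis using jump[of m] lt[of m] n \<open>n0 < n\<close> m by (intro that[of n]) auto
qed

lemma infinitely_often_value:
  fixes f :: "nat \<Rightarrow> int"
  assumes "\<exists>\<^sub>F n in sequentially. f n \<in> X" "finite X"
  obtains j where "\<exists>\<^sub>F n in sequentially. f n = j"
proof -
  have inf: "infinite {n. f n \<in> X}"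
    using assms(1) by (simp add: cofinite_eq_sequentially[symmetric] frequently_cofinite)
  have "finite (f ` {n. f n \<in> X})" by (rule finite_subset[OF _ assms(2)]) auto
  then obtain j where "infinite (f -` {j})"
    using inf_img_fin_dom[OF _ inf] by blast
  then have "infinite {n. f n = j}" by (simp add: vimage_def)
  then show ?thesis
    by (intro that[of j]) (simp add: cofinite_eq_sequentially[symmetric] frequently_cofinite)
qed

context markov_map
begin

section \<open>Orbits as paths along edges, and cells filled by an invariant set\<close>

lemma AE_edge: "AE x in lborel. \<forall>n. edge (it x n) (it x (Suc n))"
proof -
  have "range (\<lambda>j::int. a * j) \<in> null_sets lborel"
    by (intro countable_imp_null_set_lborel countable_image) auto
  then have "AE x in lborel. x \<notin> range (\<lambda>j::int. a * j)" by (rule AE_not_in)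
  then have "AE x in lborel. \<forall>n. (T ^^ n) x \<notin> range (\<lambda>j::int. a * j)" by (rule AE_Tn)
  then show ?thesis
  proof eventually_elim
    case (elim x)
    show ?case
    proof
      fix n
      define y where "y = (T ^^ n) x"
      define i where "i = cell y"
      have "y \<in> I i" using H_sub_I[of i] mem_H[of y i] by (simp add: subset_iff i_def)
      then have "T y \<in> J i" using \<tau>_image[of i] by (auto simp: T_eq i_def)
      \<comment> \<open>The right endpoint is the only point of \<open>J i\<close> outside the
        half-open cells from \<open>p i\<close> to \<open>q i\<close>; it is a grid point, and the
        orbit avoids the grid.\<close>
      moreover have "T y \<noteq> a * (q i + 1)" using elim[rule_format, of "Suc n"]
        by (auto simp: y_def image_iff) (metis of_int_1 of_int_add)
      ultimately have "a * p i \<le> T y" "T y < a * (q i + 1)" by auto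
      then have "real_of_int (p i) \<le> T y / a" "T y / a < real_of_int (q i + 1)"
        using a_pos by (auto simp: pos_le_divide_eq pos_divide_less_eq mult.commute)
      then have "p i \<le> cell (T y)" "cell (T y) < q i + 1"
        unfolding le_floor_iff floor_less_iff .
      then show "edge (it x n) (it x (Suc n))"
        by (simp add: edge_def it_def i_def y_def)
    qed
  qed
qed

lemma N_nonneg: "0 \<le> N"
  using jump(1)[of 0] by linarith

lemma edge_jump: "edge i j \<Longrightarrow> \<bar>j - i\<bar> \<le> N"
  using jump[of i] by (auto simp: edge_def)

lemma sub_vimage_funpow:
  assumes A: "A \<in> sets borel" and inv: "A - T -` A \<in> null_sets lborel"
  shows "A - (T ^^ n) -` A \<in> null_sets lborel"
proof (induction n)
  case (Suc n)
  have "(A - (T ^^ n) -` A) \<union> (T ^^ n) -` (A - T -` A) \<in> null_sets lborel"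
    using Suc null_vimage_Tn[OF inv] by (rule null_sets.Un)
  moreover have "A - (T ^^ Suc n) -` A \<in> sets lborel"
    using A measurable_sets[OF Tn_measurable A, of "Suc n"] by simp
  moreover have "A - (T ^^ Suc n) -` A \<subseteq> (A - (T ^^ n) -` A) \<union> (T ^^ n) -` (A - T -` A)" by auto
  ultimately show ?case by (rule null_sets_subset)
qed simp

text \<open>Up to a null set, a point of cell \<open>i\<close> that lands in cell \<open>j\<close>
  outside \<open>A\<close> cannot belong to \<open>A\<close>; the slope bound then compares the two
  missing parts.\<close>

lemma measure_compl_push:
  assumes A[measurable]: "A \<in> sets borel" and inv: "A - T -` A \<in> null_sets lborel" and e: "edge i j"
  shows "measure lborel (H j - A) \<le> B * measure lborel (H i - A)"
proof -
  have vA: "T -` (H j - A) \<in> sets borel" using measurable_sets[OF T_measurable, of "H j - A"] by simp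
  have "measure lborel (H j - A) \<le> B * measure lborel (H i \<inter> T -` (H j - A))"
    by (rule measure_le_edge[OF e]) auto
  also have "measure lborel (H i \<inter> T -` (H j - A)) \<le> measure lborel ((H i - A) \<union> (A - T -` A))"
    using vA inv by (intro measure_mono_fmeasurable fmeasurable.Un fmeasurable_Diff H_fmeasurable fmeasurableI_null_sets) auto
  also have "\<dots> = measure lborel (H i - A)" using inv by (intro measure_Un_null_set) auto
  finally show ?thesis using B_gt_1 by (simp add: mult_left_mono)
qed

lemma measure_compl_push_chain:
  assumes A: "A \<in> sets borel" and inv: "A - T -` A \<in> null_sets lborel"
    and e: "\<And>r'. r' < r \<Longrightarrow> edge (i + u * int r') (i + u * int (Suc r'))"
  shows "measure lborel (H (i + u * int r) - A) \<le> B ^ r * measure lborel (H i - A)"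
  using e
proof (induction r)
  case (Suc r)
  have "measure lborel (H (i + u * int (Suc r)) - A) \<le> B * measure lborel (H (i + u * int r) - A)"
    by (intro measure_compl_push A inv Suc.prems) simp
  also have "\<dots> \<le> B * (B ^ r * measure lborel (H i - A))"
    using B_gt_1 by (intro mult_left_mono Suc) auto
  finally show ?case by simp
qed simp

definition full :: "real set \<Rightarrow> int set" where
  "full A = {j. measure lborel (H j - A) = 0}"

lemma full_closed:
  assumes "A \<in> sets borel" "A - T -` A \<in> null_sets lborel" "i \<in> full A" "edge i j"
  shows "j \<in> full A"
  using measure_compl_push[OF assms(1,2,4)] assms(3)
  by (auto simp: full_def intro: antisym)

lemma full_null: "A \<in> sets borel \<Longrightarrow> j \<in> full A \<Longrightarrow> H j - A \<in> null_sets lborel"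
  using fmeasurable_Diff[OF H_fmeasurable[of j], of A]
  by (simp add: full_def null_sets_def emeasure_eq_measure2)

text \<open>Along the visits to \<open>j\<close> the error is one fixed number, and it tends to
  0.\<close>

lemma recurrent_full:
  assumes "(\<lambda>n. measure lborel (H (it x n) - A)) \<longlonglongrightarrow> 0" "\<exists>\<^sub>F n in sequentially. it x n = j"
  shows "j \<in> full A"
proof (rule ccontr)
  assume "j \<notin> full A"
  then have "0 < measure lborel (H j - A)" by (simp add: full_def zero_less_measure_iff)
  then have "\<forall>\<^sub>F n in sequentially. measure lborel (H (it x n) - A) < measure lborel (H j - A)"
    using assms(1) by (simp add: order_tendsto_iff)
  then have "\<exists>\<^sub>F n in sequentially. it x n = j \<and> measure lborel (H (it x n) - A) < measure lborel (H j - A)"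
    using assms(2) by (intro frequently_eventually_frequently)
  then show False by (auto simp: frequently_ex dest!: frequently_ex)
qed

end

text \<open>The unmodified lift \<open>T\<^sub>1\<close> takes part as a second Markov map with the
  same cells, and \<open>k\<close> is the radius of the modified region. The case that
  \<open>T\<close> is the lift itself is included and yields the exactness of the lift.
  Indecomposability has the form of a cut condition: a proper nonempty set of cells is joined to its
  complement by an edge.\<close>

locale modified_lift = markov_map a T \<tau> \<tau>' \<tau>'' p q l \<eta> B N
  + T1: markov_map a T\<^sub>1 \<sigma> \<sigma>' \<sigma>'' p\<^sub>1 q\<^sub>1 l\<^sub>1 \<eta>\<^sub>1 B\<^sub>1 N\<^sub>1
  for a :: real and T \<tau> \<tau>' \<tau>'' p q l \<eta> B N T\<^sub>1 \<sigma> \<sigma>' \<sigma>'' p\<^sub>1 q\<^sub>1 l\<^sub>1 \<eta>\<^sub>1 B\<^sub>1 N\<^sub>1 +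
  fixes k k\<^sub>1 k\<^sub>2 :: int and \<mu> :: "real measure"
  assumes k12: "k\<^sub>1 \<le> 0" "0 \<le> k\<^sub>2" "k\<^sub>1 < k\<^sub>2"
    and pq: "\<And>j. k < \<bar>j\<bar> \<Longrightarrow> p j = j + k\<^sub>1" "\<And>j. k < \<bar>j\<bar> \<Longrightarrow> q j = j + k\<^sub>2"
    and agree: "\<And>x. k < \<bar>\<lfloor>x / a\<rfloor>\<bar> \<Longrightarrow> T x = T\<^sub>1 x"
    and shift: "\<And>x. T\<^sub>1 (x + a) = T\<^sub>1 x + a"
    and connected: "\<And>E. E \<noteq> {} \<Longrightarrow> E \<noteq> UNIV \<Longrightarrow> \<exists>i\<in>E. \<exists>j. j \<notin> E \<and> (edge i j \<or> edge j i)"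
    and sets_\<mu>: "sets \<mu> = sets borel"
    and null_\<mu>: "null_sets \<mu> = null_sets lborel"
    and inv_\<mu>: "\<And>A. A \<in> sets borel \<Longrightarrow> emeasure \<mu> (T -` A) = emeasure \<mu> A"
    and fin_\<mu>: "\<And>x y. emeasure \<mu> {x..y} < \<infinity>"
begin

lemma space_\<mu>[simp]: "space \<mu> = UNIV"
  using sets_eq_imp_space_eq[OF sets_\<mu>] by simp

lemma AE_\<mu>_iff: "(AE x in \<mu>. P x) \<longleftrightarrow> (AE x in lborel. P x)"
  by (simp add: eventually_ae_filter null_\<mu>)

lemma edge_right: "k < \<bar>i\<bar> \<Longrightarrow> 1 \<le> k\<^sub>2 \<Longrightarrow> edge i (i + 1)"
  and edge_left: "k < \<bar>i\<bar> \<Longrightarrow> k\<^sub>1 \<le> -1 \<Longrightarrow> edge i (i - 1)"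
  and edge_refl: "k < \<bar>i\<bar> \<Longrightarrow> edge i i"
  using k12 by (auto simp: edge_def pq)

text \<open>Orbits never leave \<open>E\<close>, so the set of points about to enter \<open>E\<close> is wandering, and the measures of
  the visits of its orbits to a bounded set are summable.\<close>

lemma escape:
  assumes closed: "\<And>i j. i \<in> E \<Longrightarrow> edge i j \<Longrightarrow> j \<in> E" and E: "E \<noteq> {}" "E \<noteq> UNIV"
  obtains W where "W \<in> sets borel" "W \<notin> null_sets lborel"
    "AE x in lborel. x \<in> W \<longrightarrow> (\<forall>n\<ge>1. it x n \<in> E) \<and> (\<forall>m. \<forall>\<^sub>F n in sequentially. m < \<bar>it x n\<bar>)"
proof -
  \<comment> \<open>Since \<open>E\<close> is closed under edges, the edge across the cut can only
    lead into \<open>E\<close>.\<close>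
  obtain e f where ef: "e \<notin> E" "f \<in> E" "edge e f" using connected[OF E] closed by blast
  define W where "W = {x. it x 0 = e \<and> (\<forall>n\<in>{1..}. it x n \<in> E)}"
  have W[measurable]: "W \<in> sets borel"
  proof -
    have "{x \<in> space borel. it x 0 = e \<and> (\<forall>n\<in>{1..}. it x n \<in> E)} \<in> sets borel" by measurable
    then show ?thesis by (simp add: W_def)
  qed
  have inv_n: "emeasure \<mu> ((T ^^ n) -` A) = emeasure \<mu> A" if A: "A \<in> sets borel" for A n
  proof (induction n)
    case (Suc n)
    have "(T ^^ Suc n) -` A = T -` ((T ^^ n) -` A)" by (simp only: funpow_Suc_right vimage_comp)
    moreover have "(T ^^ n) -` A \<in> sets borel" using measurable_sets[OF Tn_measurable A, of n] by simp
    ultimately show ?case using inv_\<mu>[of "(T ^^ n) -` A"] Suc by (simp only:)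
  qed simp
  have nonnull: "W \<notin> null_sets lborel"
  proof
    assume W0: "W \<in> null_sets lborel"
    have "AE x in lborel. x \<notin> H e \<inter> T -` H f"
      using AE_edge AE_not_in[OF W0]
    proof eventually_elim
      case (elim x)
      show ?case
      proof
        assume x: "x \<in> H e \<inter> T -` H f"
        then have x01: "it x 0 = e" "it x 1 = f" by (auto simp: it_def H_def)
        have "it x (Suc n) \<in> E" for n
        proof (induction n)
          case 0 then show ?case using x01 ef by simp
        next
          case (Suc n) then show ?case using closed elim(1) by blast
        qed
        then have "it x n \<in> E" if "n \<ge> 1" for n using that by (cases n) auto
        then show False using elim(2) x01 by (auto simp: W_def)
      qed
    qed
    moreover have meas: "H e \<inter> T -` H f \<in> sets borel" using measurable_sets[OF T_measurable sets_H[of f]] by simp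
    ultimately have "H e \<inter> T -` H f \<in> null_sets lborel" using AE_iff_null_sets[of "H e \<inter> T -` H f" lborel] by simp
    then have "measure lborel (H e \<inter> T -` H f) = 0" by (rule measure_eq_0_null_sets)
    then show False using measure_le_edge[OF ef(3) sets_H order_refl] a_pos by (simp add: measure_H)
  qed
  have "AE x in \<mu>. \<forall>\<^sub>F n in sequentially. x \<in> space \<mu> - (W \<inter> (T ^^ n) -` {x. \<bar>cell x\<bar> \<le> m})" for m
  proof (rule borel_cantelli_AE1)
    define K where "K = {x. \<bar>cell x\<bar> \<le> m}"
    have K[measurable]: "K \<in> sets borel"
    proof -
      have "cell -` {- m..m} \<in> sets borel" using measurable_sets[OF measurable_cell, of "{- m..m}"] by simp
      also have "cell -` {- m..m} = K" by (auto simp: K_def)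
      finally show ?thesis .
    qed
    have "K \<subseteq> {- a * (real_of_int m + 1) .. a * (real_of_int m + 1)}"
    proof
      fix x assume "x \<in> K"
      then have "- m \<le> cell x" "cell x \<le> m" by (auto simp: K_def abs_le_iff)
      then have "real_of_int (- m) \<le> x / a" "x / a < real_of_int m + 1"
        by (auto simp: le_floor_iff floor_le_iff)
      then show "x \<in> {- a * (real_of_int m + 1) .. a * (real_of_int m + 1)}"
        using a_pos by (auto simp: field_simps)
    qed
    then have "emeasure \<mu> K \<le> emeasure \<mu> {- a * (real_of_int m + 1) .. a * (real_of_int m + 1)}"
      by (intro emeasure_mono) (auto simp: sets_\<mu>)
    then have Kfin: "emeasure \<mu> K < \<infinity>" using fin_\<mu> by (rule le_less_trans)
    define D where "D n = W \<inter> (T ^^ n) -` K" for n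
    have vm: "(T ^^ n) -` X \<in> sets borel" if "X \<in> sets borel" for X n
      using measurable_sets[OF Tn_measurable that, of n] by simp
    have D[measurable]: "D n \<in> sets borel" for n using vm[OF K] by (auto simp: D_def)
    have Dfin: "emeasure \<mu> (D n) < \<infinity>" for n
    proof -
      have "emeasure \<mu> (D n) \<le> emeasure \<mu> ((T ^^ n) -` K)"
        using vm[OF K, of n] by (intro emeasure_mono) (auto simp: D_def sets_\<mu>)
      then show ?thesis using Kfin inv_n[OF K, of n] by simp
    qed
    have "(\<Sum>n<r. measure \<mu> (D n)) \<le> measure \<mu> K" for r
    proof -
      \<comment> \<open>By invariance the visits \<open>D n\<close> with \<open>n < r\<close> are
        moved into the preimage of \<open>K\<close> under \<open>T ^^ r\<close>. They become
        disjoint there: a common point of \<open>X m\<close> and \<open>X n\<close> would be in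
        \<open>W\<close> at two different times, although after the first of them its orbit stays in
        \<open>E\<close>, whereas \<open>W\<close> lies over the cell \<open>e\<close> outside
        \<open>E\<close>. Hence all partial sums are at most the measure of
        \<open>K\<close>.\<close>
      define X where "X n = (T ^^ (r - n)) -` D n" for n
      have X: "X n \<in> sets borel" for n unfolding X_def by (rule vm[OF D])
      have disj: "disjoint_family_on X {..<r}"
        unfolding disjoint_family_on_def
      proof (intro ballI impI)
        fix m n assume mn: "m \<in> {..<r}" "n \<in> {..<r}" "m \<noteq> n"
        have *: "X m \<inter> X n = {}" if "m < n" "n < r" for m n
        proof (rule equals0I)
          fix z assume z: "z \<in> X m \<inter> X n"
          then have "(T ^^ (r - n)) z \<in> W" "(T ^^ (r - m)) z \<in> W" by (auto simp: X_def D_def)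
          moreover have "(T ^^ (r - m)) z = (T ^^ (n - m)) ((T ^^ (r - n)) z)"
            using that by (simp add: funpow_add[symmetric, THEN fun_cong, unfolded o_apply])
          moreover have "it ((T ^^ (r - n)) z) (n - m) \<in> E"
            using \<open>(T ^^ (r - n)) z \<in> W\<close> that by (auto simp: W_def)
          ultimately have "it ((T ^^ (r - m)) z) 0 \<in> E" by (simp add: it_def)
          then show False using \<open>(T ^^ (r - m)) z \<in> W\<close> ef(1) by (simp add: W_def)
        qed
        show "X m \<inter> X n = {}" using *[of m n] *[of n m] mn by (cases m n rule: linorder_cases) auto
      qed
      have XK: "X n \<subseteq> (T ^^ r) -` K" if "n < r" for n
        using that by (auto simp: X_def D_def funpow_add[symmetric, THEN fun_cong, unfolded o_apply])
      have "(\<Sum>n<r. emeasure \<mu> (D n)) = (\<Sum>n<r. emeasure \<mu> (X n))"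
        by (simp add: X_def inv_n)
      also have "\<dots> = emeasure \<mu> (\<Union>n<r. X n)"
        using X disj by (intro sum_emeasure) (auto simp: sets_\<mu>)
      also have "\<dots> \<le> emeasure \<mu> ((T ^^ r) -` K)"
        using XK vm[OF K] by (intro emeasure_mono) (auto simp: sets_\<mu>)
      also have "\<dots> = emeasure \<mu> K" by (rule inv_n[OF K])
      finally show ?thesis
        using Dfin Kfin by (simp add: emeasure_eq_ennreal_measure less_top sum_ennreal measure_nonneg sum_nonneg)
    qed
    then show "summable (\<lambda>n. measure \<mu> (W \<inter> (T ^^ n) -` {x. \<bar>cell x\<bar> \<le> m}))"
      unfolding D_def[symmetric] K_def[symmetric] by (intro summableI_nonneg_bounded) auto
    show "emeasure \<mu> (W \<inter> (T ^^ n) -` {x. \<bar>cell x\<bar> \<le> m}) < \<infinity>"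
      "W \<inter> (T ^^ n) -` {x. \<bar>cell x\<bar> \<le> m} \<in> sets \<mu>" for n
      using Dfin[of n] D[of n] unfolding D_def K_def by (auto simp: sets_\<mu>)
  qed
  then have "AE x in lborel. \<forall>m. \<forall>\<^sub>F n in sequentially. x \<in> space \<mu> - (W \<inter> (T ^^ n) -` {x. \<bar>cell x\<bar> \<le> m})"
    unfolding AE_all_countable AE_\<mu>_iff[symmetric] by blast
  then have "AE x in lborel. x \<in> W \<longrightarrow> (\<forall>n\<ge>1. it x n \<in> E) \<and> (\<forall>m. \<forall>\<^sub>F n in sequentially. m < \<bar>it x n\<bar>)"
    by eventually_elim (auto simp: W_def it_def not_le elim!: eventually_mono)
  with W nonnull show ?thesis by (rule that)
qed

text \<open>The points whose orbit stays within \<open>m\<close> form a forward invariant set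
  \<open>Q\<close>. If it were not null, \<open>fill\<close> and the pigeonhole principle would
  provide a cell filled by \<open>Q\<close>. The cells filled by \<open>Q\<close> are closed under
  edges and all lie within \<open>m\<close>, yet by \<open>escape\<close> some orbit would remain in
  them and leave every bounded region.\<close>

lemma unbounded_orbits: "AE x in lborel. \<forall>m. \<exists>\<^sub>F n in sequentially. m < \<bar>it x n\<bar>"
proof -
  have "AE x in lborel. \<exists>n. m < \<bar>it x n\<bar>" for m
  proof -
    define Q where "Q = {x. \<forall>n. \<bar>it x n\<bar> \<le> m}"
    have Q[measurable]: "Q \<in> sets borel"
    proof -
      have "(\<lambda>x. it x n) -` {- m..m} \<in> sets borel" for n
        using measurable_sets[OF measurable_it, of "{- m..m}" n] by simp
      then have "(\<Inter>n. (\<lambda>x. it x n) -` {- m..m}) \<in> sets borel" by (intro sets.countable_INT'') auto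
      also have "(\<Inter>n. (\<lambda>x. it x n) -` {- m..m}) = Q" by (auto simp: Q_def abs_le_iff minus_le_iff)
      finally show ?thesis .
    qed
    have "Q \<in> null_sets lborel"
    proof (rule ccontr)
      assume nn: "Q \<notin> null_sets lborel"
      have "(T ^^ n) x \<in> Q" if "x \<in> Q" for x n using that by (auto simp: Q_def it_funpow)
      then have sub: "Q - (T ^^ n) -` Q = {}" for n by auto
      have "Q - T -` Q = {}" using sub[of 1] by auto
      then have sub1: "Q - T -` Q \<in> null_sets lborel" by (simp only: null_sets.empty_sets)
      obtain x where x: "x \<in> Q" "(\<lambda>n. measure lborel (H (it x n) - Q)) \<longlonglongrightarrow> 0"
        using nonnull_obtain[OF Q nn fill[of Q "\<lambda>_. Q"]] sub by auto
      have "\<exists>\<^sub>F n in sequentially. it x n \<in> {- m..m}"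
        using x(1) by (auto simp: Q_def abs_le_iff minus_le_iff intro!: eventually_frequently always_eventually)
      then obtain j where "\<exists>\<^sub>F n in sequentially. it x n = j" by (rule infinitely_often_value) simp
      with x have "j \<in> full Q" by (intro recurrent_full)
      have small: "\<bar>i\<bar> \<le> m" if "i \<in> full Q" for i
      proof (rule ccontr)
        assume "\<not> \<bar>i\<bar> \<le> m"
        then have "H i - Q = H i" by (auto simp: Q_def H_def it_def dest: spec[of _ 0])
        then show False using that a_pos by (simp add: full_def measure_H)
      qed
      obtain W where W: "W \<in> sets borel" "W \<notin> null_sets lborel"
        "AE x in lborel. x \<in> W \<longrightarrow> (\<forall>n\<ge>1. it x n \<in> full Q) \<and> (\<forall>m. \<forall>\<^sub>F n in sequentially. m < \<bar>it x n\<bar>)"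
      proof (rule escape[of "full Q"])
        show "full Q \<noteq> UNIV" using small[of "\<bar>m\<bar> + 1"] by force
      qed (use \<open>j \<in> full Q\<close> full_closed[OF Q sub1] in auto)
      obtain y where y: "\<forall>n\<ge>1. it y n \<in> full Q" "\<forall>\<^sub>F n in sequentially. m < \<bar>it y n\<bar>"
        using nonnull_obtain[OF W] by metis
      then obtain n0 where "\<And>n. n \<ge> n0 \<Longrightarrow> m < \<bar>it y n\<bar>" by (auto simp: eventually_sequentially)
      from this[of "max n0 1"] y(1) small show False by (meson max.cobounded1 max.cobounded2 not_le)
    qed
    then have "AE x in lborel. x \<notin> Q" by (rule AE_not_in)
    then show ?thesis by eventually_elim (auto simp: Q_def not_le)
  qed
  then have "AE x in lborel. \<forall>m. \<exists>n. m < \<bar>it x n\<bar>" by (simp add: AE_all_countable)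
  \<comment> \<open>Applied to all later points of the orbit, a single exceedance becomes infinitely
    many.\<close>
  then have "AE x in lborel. \<forall>r. \<forall>m. \<exists>n. m < \<bar>it ((T ^^ r) x) n\<bar>" by (rule AE_Tn)
  then show ?thesis
    by eventually_elim (simp add: it_funpow frequently_sequentially, meson le_add2)
qed

text \<open>The defect \<open>D\<close> of invariance is itself a tail set, with targets
  \<open>Dn n\<close>, so at some time \<open>Dn n\<close> nearly fills a far cell. The branch of
  that cell covers the cell itself, yet \<open>T\<close> sends \<open>Dn n\<close> out of
  \<open>An n\<close>. Thus the part of \<open>An n\<close> in the cell has almost no preimage there
  and must be small, although it contains nearly the whole cell because it contains
  \<open>Dn n\<close>.\<close>

lemma tail_sub:
  assumes A: "A \<in> sets borel" and An: "\<And>n. An n \<in> sets borel" "\<And>n. A = (T ^^ n) -` An n"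
  shows "A - T -` A \<in> null_sets lborel"
proof (rule ccontr)
  assume nn: "A - T -` A \<notin> null_sets lborel"
  have vm: "T -` X \<in> sets borel" if "X \<in> sets borel" for X
    using measurable_sets[OF T_measurable that] by simp
  define D where "D = A - T -` A"
  define Dn where "Dn n = An n - T -` An n" for n
  have D: "D \<in> sets borel" "\<And>n. Dn n \<in> sets borel" unfolding D_def Dn_def using A An vm by auto
  have "T -` A = (T ^^ n) -` (T -` An n)" for n
    using An(2)[of n] by (metis funpow_Suc_right funpow.simps(2) vimage_comp)
  then have "(T ^^ n) -` Dn n = D" for n
    unfolding D_def Dn_def vimage_Diff by (simp only: An(2)[symmetric])
  then have "D - (T ^^ n) -` Dn n \<in> null_sets lborel" for n
    by (simp only: Diff_cancel null_sets.empty_sets)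
  then have "AE x in lborel. x \<in> D \<longrightarrow> (\<lambda>n. measure lborel (H (it x n) - Dn n)) \<longlonglongrightarrow> 0"
    by (intro fill D)
  then have "AE x in lborel. x \<in> D \<longrightarrow> (\<lambda>n. measure lborel (H (it x n) - Dn n)) \<longlonglongrightarrow> 0 \<and>
      (\<exists>\<^sub>F n in sequentially. k < \<bar>it x n\<bar>)"
    using unbounded_orbits by eventually_elim auto
  from nonnull_obtain[OF D(1) nn[folded D_def] this]
  obtain x where x: "(\<lambda>n. measure lborel (H (it x n) - Dn n)) \<longlonglongrightarrow> 0"
      "\<exists>\<^sub>F n in sequentially. k < \<bar>it x n\<bar>"
    by blast
  \<comment> \<open>Chosen so that the bound \<open>\<epsilon>\<close> for the part of the cell
    outside \<open>An n\<close> and the bound \<open>B * \<epsilon>\<close> for the part inside add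
    up to \<open>a / 2\<close>, half the length of the cell.\<close>
  define \<epsilon> where "\<epsilon> = a / 2 / (B + 1)"
  have "\<epsilon> > 0" using a_pos B_gt_1 by (simp add: \<epsilon>_def)
  then have "\<forall>\<^sub>F n in sequentially. measure lborel (H (it x n) - Dn n) < \<epsilon>"
    using x(1) by (simp add: order_tendsto_iff)
  with x(2) have "\<exists>\<^sub>F n in sequentially. k < \<bar>it x n\<bar> \<and> measure lborel (H (it x n) - Dn n) < \<epsilon>"
    by (rule frequently_eventually_frequently)
  then obtain n where n: "k < \<bar>it x n\<bar>" "measure lborel (H (it x n) - Dn n) < \<epsilon>"
    by (blast dest: frequently_ex)
  define i where "i = it x n"
  define S where "S = H i \<inter> An n"
  have S: "S \<in> sets borel" using An by (simp add: S_def)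
  have "measure lborel (H i \<inter> T -` S) \<le> measure lborel (H i - Dn n)"
    using vm[OF S] D(2)
    by (intro measure_mono_fmeasurable fmeasurable_Diff H_fmeasurable) (auto simp: Dn_def S_def)
  then have 1: "measure lborel (H i \<inter> T -` S) < \<epsilon>" using n(2) by (simp add: i_def)
  have "(H i - An n) \<union> S = H i" by (auto simp: S_def)
  then have "a = measure lborel ((H i - An n) \<union> S)" by (simp only: measure_H)
  also have "\<dots> \<le> measure lborel (H i - An n) + measure lborel S"
    using S An by (intro measure_Un_le) auto
  also have "measure lborel (H i - An n) \<le> measure lborel (H i - Dn n)"
    using An D(2) by (intro measure_mono_fmeasurable fmeasurable_Diff H_fmeasurable) (auto simp: Dn_def)
  also have "measure lborel S \<le> B * measure lborel (H i \<inter> T -` S)"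
    using S edge_refl n(1) by (intro measure_le_edge[of i i]) (auto simp: i_def S_def)
  finally have "a \<le> \<epsilon> + B * \<epsilon>"
    using n(2)[folded i_def] B_gt_1 mult_left_mono[OF less_imp_le[OF 1], of B] by linarith
  also have "\<epsilon> + B * \<epsilon> = (B + 1) * \<epsilon>" by (simp add: algebra_simps)
  also have "\<dots> = a / 2"
  proof -
    have "c * (a / 2 / c) = a / 2" if "c \<noteq> 0" for c :: real using that by simp
    from this[of "B + 1"] show ?thesis using B_gt_1 unfolding \<epsilon>_def by linarith
  qed
  finally show False using a_pos by simp
qed


text \<open>Both orbits visit every sufficiently distant window longer than a jump, and from there the
  filled cells can be pushed to a common cell.\<close>

lemma windows_meet:
  fixes s :: int
  assumes s: "s = 1 \<or> s = -1"
    and A: "A \<in> sets borel" and inv: "A - T -` A \<in> null_sets lborel" "- A - T -` (- A) \<in> null_sets lborel"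
    and x: "\<And>n. edge (it x n) (it x (Suc n))" "(\<lambda>n. measure lborel (H (it x n) - A)) \<longlonglongrightarrow> 0"
      "\<And>m. \<exists>n. m \<le> s * it x n"
    and y: "\<And>n. edge (it y n) (it y (Suc n))" "(\<lambda>n. measure lborel (H (it y n) - (- A))) \<longlonglongrightarrow> 0"
      "\<And>m. \<exists>n. m \<le> s * it y n"
  shows False
proof -
  have ss: "s * s = 1" and abs_s: "\<bar>s * j\<bar> = \<bar>j\<bar>" for j using s by auto
  \<comment> \<open>Beyond the modified region every cell has an edge to its neighbour in one common
    direction \<open>u\<close>, since \<open>k\<^sub>1 < k\<^sub>2\<close>. This need not be the
    direction \<open>s\<close> in which the orbits are unbounded.\<close>
  obtain u :: int where u: "u = 1 \<or> u = -1" "\<And>i. k < \<bar>i\<bar> \<Longrightarrow> edge i (i + u)"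
  proof (cases "1 \<le> k\<^sub>2")
    case True
    then show ?thesis using edge_right by (intro that[of 1]) auto
  next
    case False
    then have "k\<^sub>1 \<le> -1" using k12 by auto
    then show ?thesis using edge_left by (intro that[of "-1"]) auto
  qed
  define r where "r = nat N"
  \<comment> \<open>At most \<open>r\<close> pushes, each costing a factor \<open>B\<close>, then
    leave an error of at most \<open>a / 4\<close> for either set.\<close>
  define \<epsilon> where "\<epsilon> = a / (4 * B ^ r)"
  have Bp: "0 < B ^ j" for j using B_gt_1 by simp
  have \<epsilon>: "0 < \<epsilon>" using a_pos Bp by (simp add: \<epsilon>_def)
  obtain n1 where n1: "\<And>n. n \<ge> n1 \<Longrightarrow> measure lborel (H (it x n) - A) < \<epsilon>"
    using x(2) \<epsilon> unfolding order_tendsto_iff eventually_sequentially by blast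
  obtain n2 where n2: "\<And>n. n \<ge> n2 \<Longrightarrow> measure lborel (H (it y n) - (- A)) < \<epsilon>"
    using y(2) \<epsilon> unfolding order_tendsto_iff eventually_sequentially by blast
  define n0 where "n0 = max n1 n2"
  define S where "S = (\<lambda>n. s * it x n) ` {..n0} \<union> (\<lambda>n. s * it y n) ` {..n0} \<union> {k}"
  define i0 where "i0 = Max S + 1"
  have "v < i0" if "v \<in> S" for v
    using Max_ge[of S v] that unfolding i0_def by (simp add: S_def)
  then have i0: "k < i0" "\<And>n. n \<le> n0 \<Longrightarrow> s * it x n < i0" "\<And>n. n \<le> n0 \<Longrightarrow> s * it y n < i0"
    by (auto simp: S_def)
  \<comment> \<open>The window for \<open>s * it\<close> is \<open>{i0..<i0 + N}\<close>. The target
    is the end to which steps in direction \<open>u\<close> lead: \<open>i0 + N\<close> if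
    \<open>u\<close> points outwards, \<open>i0\<close> if it points inwards. It does not depend on
    the orbit, is at most \<open>N\<close> steps away, and all edges used start in cells beyond
    \<open>k\<close>.\<close>
  have target: "measure lborel (H (s * (if s * u = 1 then i0 + N else i0)) - C) \<le> a / 4"
    if C: "C \<in> sets borel" "C - T -` C \<in> null_sets lborel"
      and z: "\<And>n. edge (it z n) (it z (Suc n))" "\<And>n. n \<ge> n0 \<Longrightarrow> measure lborel (H (it z n) - C) < \<epsilon>"
        "\<And>m. \<exists>n. m \<le> s * it z n" "\<And>n. n \<le> n0 \<Longrightarrow> s * it z n < i0" for C z
  proof -
    have jmp: "s * it z (Suc n) - s * it z n \<le> N" for n
      using edge_jump[OF z(1)[of n]] s by auto
    obtain n where n: "n0 \<le> n" "i0 \<le> s * it z n" "s * it z n < i0 + N"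
      using first_passage[of "\<lambda>n. s * it z n" N i0 n0, OF jmp z(3) z(4)] by blast
    define t where "t = (if s * u = 1 then i0 + N else i0)"
    define r' where "r' = nat \<bar>t - s * it z n\<bar>"
    have r'r: "r' \<le> r" using n by (auto simp: r'_def r_def t_def)
    have tz: "it z n + u * int r' = s * t"
    proof (cases "s * u = 1")
      case True
      then have "u = s" using s u by auto
      have "int r' = t - s * it z n" using n True by (simp add: r'_def t_def)
      then show ?thesis using \<open>u = s\<close> ss by (simp add: right_diff_distrib mult.assoc[symmetric])
    next
      case False
      then have "u = - s" using s u by auto
      have "int r' = s * it z n - t" using n False by (simp add: r'_def t_def)
      then show ?thesis using \<open>u = - s\<close> ss by (simp add: right_diff_distrib mult.assoc[symmetric])
    qed
    have "measure lborel (H (it z n + u * int r') - C) \<le> B ^ r' * measure lborel (H (it z n) - C)"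
    proof (rule measure_compl_push_chain[OF C])
      fix j assume j: "j < r'"
      have "i0 \<le> s * (it z n + u * int j)"
      proof (cases "s * u = 1")
        case True
        then have "s * (it z n + u * int j) = s * it z n + int j" by (simp add: distrib_left mult.assoc[symmetric])
        then show ?thesis using n by simp
      next
        case False
        then have "s * u = -1" using s u by auto
        then have "s * (it z n + u * int j) = s * it z n - int j" by (simp add: distrib_left mult.assoc[symmetric])
        moreover have "int j < s * it z n - i0" using j n False by (simp add: r'_def t_def)
        ultimately show ?thesis by simp
      qed
      then have "k < \<bar>it z n + u * int j\<bar>" using i0(1) abs_s[of "it z n + u * int j"] by linarith
      then show "edge (it z n + u * int j) (it z n + u * int (Suc j))"
        using u(2)[of "it z n + u * int j"] by (simp add: distrib_left add.assoc add.commute[of u])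
    qed
    also have "\<dots> \<le> B ^ r * \<epsilon>"
      using z(2)[OF n(1)] B_gt_1 r'r Bp by (intro mult_mono power_increasing) (auto intro: less_imp_le)
    also have "\<dots> = a / 4" using B_gt_1 by (simp add: \<epsilon>_def)
    finally show ?thesis by (simp only: tz t_def)
  qed
  define j where "j = s * (if s * u = 1 then i0 + N else i0)"
  have mA: "- A \<in> sets borel" using A by simp
  have "measure lborel (H j - A) \<le> a / 4"
    unfolding j_def using n1 by (intro target[OF A inv(1) x(1) _ x(3) i0(2)]) (auto simp: n0_def)
  moreover have "measure lborel (H j - (- A)) \<le> a / 4"
    unfolding j_def using n2 by (intro target[OF mA inv(2) y(1) _ y(3) i0(3)]) (auto simp: n0_def)
  \<comment> \<open>The parts missed by \<open>A\<close> and by its complement make up the whole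
    cell, so two bounds of \<open>a / 4\<close> are incompatible with its length
    \<open>a\<close>.\<close>
  moreover have "H j = (H j - A) \<union> (H j - (- A))" by auto
  then have "measure lborel (H j) \<le> measure lborel (H j - A) + measure lborel (H j - (- A))"
    using measure_Un_le[of "H j - A" lborel "H j - (- A)"] A by simp
  ultimately show False using a_pos by (simp add: measure_H)
qed

section \<open>Orbits that tend to one end of the line\<close>

definition escaping :: "int \<Rightarrow> real set" where
  "escaping s = {x. \<forall>m. \<forall>\<^sub>F n in sequentially. m < s * it x n}"

definition lift_escaping :: "int \<Rightarrow> real set" where
  "lift_escaping s = {x. \<forall>m. \<forall>\<^sub>F n in sequentially. m < s * T1.it x n}"

lemma sets_lift_escaping[measurable]: "lift_escaping s \<in> sets borel"
proof -
  have "(\<lambda>x. T1.it x n) -` {j. m < s * j} \<in> sets borel" for n m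
    using measurable_sets[OF T1.measurable_it, of "{j. m < s * j}" n] by simp
  then have "(\<Inter>m. \<Union>N. \<Inter>n. (\<lambda>x. T1.it x (N + n)) -` {j. m < s * j}) \<in> sets borel"
    by (intro sets.countable_INT'' sets.countable_UN'') auto
  also have "(\<Inter>m. \<Union>N. \<Inter>n. (\<lambda>x. T1.it x (N + n)) -` {j. m < s * j}) = lift_escaping s"
  proof -
    have "(\<forall>\<^sub>F n in sequentially. P n) \<longleftrightarrow> (\<exists>N. \<forall>n. P (N + n))" for P
      unfolding eventually_sequentially by (metis le_add1 le_iff_add)
    then show ?thesis by (simp add: lift_escaping_def set_eq_iff)
  qed
  finally show ?thesis .
qed

lemma shift_int: "T\<^sub>1 (x + a * real_of_int j) = T\<^sub>1 x + a * real_of_int j"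
proof (induction j rule: int_induct[where k = 0])
  case (step1 i)
  then show ?case using shift[of "x + a * i"] by (simp add: algebra_simps)
next
  case (step2 i)
  then show ?case using shift[of "x + a * real_of_int (i - 1)"] by (simp add: algebra_simps)
qed simp

lemma shift_funpow: "(T\<^sub>1 ^^ n) (x + a * real_of_int j) = (T\<^sub>1 ^^ n) x + a * real_of_int j"
  by (induction n) (auto simp: shift_int)

lemma lift_it_shift: "T1.it (x + a * real_of_int j) n = T1.it x n + j"
  using a_pos by (simp add: T1.it_def shift_funpow add_divide_distrib)

text \<open>The set is invariant under translation by cells, so the part it misses has the same
  measure in every cell; along the orbit of a density point this constant tends to 0.\<close>

lemma lift_escaping_full:
  assumes "lift_escaping s \<notin> null_sets lborel"
  shows "H 0 - lift_escaping s \<in> null_sets lborel"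
proof -
  let ?E = "lift_escaping s"
  have "(T\<^sub>1 ^^ m) x \<in> ?E" if "x \<in> ?E" for x m
  proof -
    have "\<forall>\<^sub>F n in sequentially. i < s * T1.it x (n + m)" for i
      using that eventually_sequentially_seg[of "\<lambda>n. i < s * T1.it x n" m] by (simp add: lift_escaping_def)
    then show ?thesis by (simp add: lift_escaping_def T1.it_funpow)
  qed
  then have "?E - (T\<^sub>1 ^^ m) -` ?E = {}" for m by auto
  then have "?E - (T\<^sub>1 ^^ m) -` ?E \<in> null_sets lborel" for m by (simp only: null_sets.empty_sets)
  then have "AE x in lborel. x \<in> ?E \<longrightarrow> (\<lambda>n. measure lborel (H (T1.it x n) - ?E)) \<longlonglongrightarrow> 0"
    by (intro T1.fill sets_lift_escaping)
  from nonnull_obtain[OF sets_lift_escaping assms this]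
  obtain x where x: "(\<lambda>n. measure lborel (H (T1.it x n) - ?E)) \<longlonglongrightarrow> 0" by blast
  have inv: "x + a * real_of_int j \<in> ?E \<longleftrightarrow> x \<in> ?E" for x j
  proof -
    have *: "x + a * real_of_int j \<in> ?E" if "x \<in> ?E" for x j
    proof -
      have "\<forall>\<^sub>F n in sequentially. m < s * T1.it (x + a * real_of_int j) n" for m
      proof -
        have "\<forall>\<^sub>F n in sequentially. m - s * j < s * T1.it x n" using that by (simp add: lift_escaping_def)
        then show ?thesis by eventually_elim (simp add: lift_it_shift distrib_left)
      qed
      then show ?thesis by (simp add: lift_escaping_def)
    qed
    from *[of x j] *[of "x + a * j" "- j"] show ?thesis by auto
  qed
  have eqm: "measure lborel (H j - ?E) = measure lborel (H 0 - ?E)" for j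
  proof -
    have "H j - ?E = (+) (a * j) ` (H 0 - ?E)"
    proof (intro equalityI subsetI)
      fix z assume "z \<in> H j - ?E"
      then have "z + a * real_of_int (- j) \<in> H 0 - ?E" using inv[of z "- j"] by (auto simp: H_eq algebra_simps)
      then show "z \<in> (+) (a * j) ` (H 0 - ?E)" by (intro image_eqI[of _ _ "z + a * real_of_int (- j)"]) auto
    next
      fix z assume "z \<in> (+) (a * j) ` (H 0 - ?E)"
      then obtain w where "z = w + a * real_of_int j" "w \<in> H 0 - ?E" by (auto simp: add.commute)
      then show "z \<in> H j - ?E" using inv[of w j] by (auto simp: H_eq algebra_simps)
    qed
    then have "measure lebesgue (H j - ?E) = measure lebesgue (H 0 - ?E)"
      by (simp only: measure_translation)
    then show ?thesis by simp
  qed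
  have "(\<lambda>n. measure lborel (H (T1.it x n) - ?E)) = (\<lambda>n. measure lborel (H 0 - ?E))" by (intro ext eqm)
  then have "(\<lambda>n::nat. measure lborel (H 0 - ?E)) \<longlonglongrightarrow> 0" using x by (simp only:)
  then have "measure lborel (H 0 - ?E) = 0" by (simp only: LIMSEQ_const_iff)
  then show ?thesis using fmeasurable_Diff[OF H_fmeasurable[of 0], of ?E]
    by (simp add: null_sets_def emeasure_eq_measure2)
qed

text \<open>Once an orbit stays beyond the modified region it is an orbit of the lift, so some
  iterate of an escaping point escapes under the lift as well; preimages of null sets are
  null.\<close>

lemma escaping_null:
  assumes s: "s = 1 \<or> s = -1" and E: "lift_escaping s \<in> null_sets lborel"
  shows "AE x in lborel. x \<notin> escaping s"
proof -
  have "AE x in lborel. x \<notin> lift_escaping s" by (rule AE_not_in[OF E])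
  then have "AE x in lborel. \<forall>n. (T ^^ n) x \<notin> lift_escaping s" by (rule AE_Tn)
  then show ?thesis
  proof eventually_elim
    case (elim x)
    show ?case
    proof
      assume x: "x \<in> escaping s"
      then obtain n0 where n0: "\<And>n. n \<ge> n0 \<Longrightarrow> k < s * it x n"
        unfolding escaping_def eventually_sequentially by blast
      have big: "k < \<bar>cell ((T ^^ n) x)\<bar>" if "n \<ge> n0" for n
        using n0[OF that] s by (auto simp: it_def)
      have "(T\<^sub>1 ^^ m) ((T ^^ n0) x) = (T ^^ (n0 + m)) x" for m
      proof (induction m)
        case (Suc m)
        then show ?case using agree[OF big[of "n0 + m"]] by simp
      qed simp
      then have "T1.it ((T ^^ n0) x) m = it x (n0 + m)" for m by (simp add: T1.it_def it_def)
      moreover have "\<forall>\<^sub>F m in sequentially. j < s * it x (n0 + m)" for j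
        using x eventually_sequentially_seg[of "\<lambda>n. j < s * it x n" n0]
        by (simp add: escaping_def add.commute)
      ultimately have "(T ^^ n0) x \<in> lift_escaping s" by (simp add: lift_escaping_def)
      with elim show False by blast
    qed
  qed
qed

text \<open>Otherwise the two disjoint escaping sets of the lift would each fill the cell 0.\<close>

lemma not_both_escaping:
  "(AE x in lborel. x \<notin> escaping 1) \<or> (AE x in lborel. x \<notin> escaping (-1))"
proof (rule ccontr)
  assume "\<not> ?thesis"
  then have "H 0 - lift_escaping 1 \<in> null_sets lborel" "H 0 - lift_escaping (-1) \<in> null_sets lborel"
    using escaping_null lift_escaping_full by blast+
  then have "(H 0 - lift_escaping 1) \<union> (H 0 - lift_escaping (-1)) \<in> null_sets lborel"
    by (rule null_sets.Un)
  moreover have "lift_escaping 1 \<inter> lift_escaping (-1) = {}"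
  proof (rule equals0I)
    fix x assume "x \<in> lift_escaping 1 \<inter> lift_escaping (-1)"
    then have "\<forall>\<^sub>F n in sequentially. 0 < T1.it x n" "\<forall>\<^sub>F n in sequentially. 0 < - T1.it x n"
      by (auto simp: lift_escaping_def dest: spec[of _ 0])
    then have "\<forall>\<^sub>F n in sequentially. False" by eventually_elim auto
    then show False by simp
  qed
  then have "(H 0 - lift_escaping 1) \<union> (H 0 - lift_escaping (-1)) = H 0" by auto
  ultimately have "H 0 \<in> null_sets lborel" by simp
  then show False using a_pos measure_H[of 0] measure_eq_0_null_sets[of "H 0" lborel] by simp
qed

text \<open>If almost no orbit tended to the end \<open>s\<close>, a typical orbit in
  \<open>A\<close>, being bounded on the other side, would return to some cell infinitely often, and
  \<open>A\<close> would fill it. Not all cells are filled, as the complement is not null. Orbits in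
  the complement run arbitrarily far to the other side without touching filled cells, which confines
  the filled cells to the side of \<open>s\<close>. Then \<open>escape\<close> provides orbits in
  filled cells that leave every bounded region, and these can only tend to the end
  \<open>s\<close>.\<close>

lemma escaping_nonnull:
  fixes s :: int
  assumes s: "s = 1 \<or> s = -1"
    and A: "A \<in> sets borel" and inv: "A - T -` A \<in> null_sets lborel" "- A - T -` (- A) \<in> null_sets lborel"
    and nn: "A \<notin> null_sets lborel" "- A \<notin> null_sets lborel"
    and bdd: "AE x in lborel. x \<in> A \<longrightarrow> (\<exists>m. \<forall>n. m \<le> s * it x n)"
    and unb: "AE x in lborel. x \<in> - A \<longrightarrow> (\<forall>m. \<exists>n. s * it x n < m)"
  shows "\<not> (AE x in lborel. x \<notin> escaping s)"
proof
  assume ne: "AE x in lborel. x \<notin> escaping s"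
  have ss: "s * s = 1" and abs_s: "\<bar>s * j\<bar> = \<bar>j\<bar>" for j using s by auto
  have mA: "- A \<in> sets borel" using A by simp
  have "AE x in lborel. x \<in> A \<longrightarrow> (\<lambda>n. measure lborel (H (it x n) - A)) \<longlonglongrightarrow> 0"
    by (intro fill A sub_vimage_funpow inv)
  then have "AE x in lborel. x \<in> A \<longrightarrow> (\<lambda>n. measure lborel (H (it x n) - A)) \<longlonglongrightarrow> 0 \<and>
      x \<notin> escaping s \<and> (\<exists>m. \<forall>n. m \<le> s * it x n)"
    using ne bdd by eventually_elim auto
  note ae_x = this
  obtain x where "(\<lambda>n. measure lborel (H (it x n) - A)) \<longlonglongrightarrow> 0 \<and>
      x \<notin> escaping s \<and> (\<exists>m. \<forall>n. m \<le> s * it x n)"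
    by (rule nonnull_obtain[OF A nn(1) ae_x])
  then obtain m0 where x: "(\<lambda>n. measure lborel (H (it x n) - A)) \<longlonglongrightarrow> 0" "x \<notin> escaping s"
    "\<And>n. m0 \<le> s * it x n" by metis
  from x(2) obtain m1 where "\<exists>\<^sub>F n in sequentially. \<not> m1 < s * it x n"
    by (auto simp: escaping_def not_eventually)
  then have "\<exists>\<^sub>F n in sequentially. it x n \<in> (\<lambda>j. s * j) ` {m0..m1}"
  proof (rule frequently_mono[rotated], intro allI impI)
    fix n assume "\<not> m1 < s * it x n"
    then have "s * it x n \<in> {m0..m1}" using x(3)[of n] by simp
    moreover have "it x n = s * (s * it x n)" using ss by (simp add: mult.assoc[symmetric])
    ultimately show "it x n \<in> (\<lambda>j. s * j) ` {m0..m1}" by blast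
  qed
  then obtain j where "\<exists>\<^sub>F n in sequentially. it x n = j" by (rule infinitely_often_value) simp
  then have j: "j \<in> full A" by (rule recurrent_full[OF x(1)])
  note closed = full_closed[OF A inv(1)]
  have not_all: "full A \<noteq> UNIV"
  proof
    assume "full A = UNIV"
    then have "(\<Union>j. H j - A) \<in> null_sets lborel" using full_null[OF A] by (intro null_sets_UN) auto
    also have "(\<Union>j. H j - A) = - A" by (auto simp: H_def)
    finally show False using nn(2) by simp
  qed
  \<comment> \<open>Suppose that a filled cell lies beyond \<open>k\<close> on the wrong side. If
    far cells have edges in direction \<open>-s\<close>, all cells further out on that side are
    filled as well, and the orbit of \<open>y\<close> in the complement visits one of them. If not,
    orbits far out never move in direction \<open>-s\<close>, so that of \<open>y\<close> is bounded
    there.\<close>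
  have side: "- k \<le> s * i" if i: "i \<in> full A" for i
  proof (rule ccontr)
    assume "\<not> - k \<le> s * i"
    then have si: "s * i < - k" by simp
    have "(\<Union>j\<in>full A. H j - A) \<in> null_sets lborel" using full_null[OF A] by (intro null_sets_UN') auto
    then have "AE x in lborel. x \<notin> (\<Union>j\<in>full A. H j - A)" by (rule AE_not_in)
    then have 1: "AE x in lborel. \<forall>n. (T ^^ n) x \<notin> (\<Union>j\<in>full A. H j - A)" by (rule AE_Tn)
    have "AE x in lborel. \<forall>n. x \<notin> - A - (T ^^ n) -` (- A)"
      using AE_not_in[OF sub_vimage_funpow[OF mA inv(2)]] unfolding AE_all_countable by blast
    then have "AE x in lborel. x \<in> - A \<longrightarrow> (\<forall>n. it x n \<notin> full A) \<and> (\<forall>m. \<exists>n. s * it x n < m) \<and>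
        (\<forall>n. edge (it x n) (it x (Suc n)))"
      using 1 unb AE_edge by eventually_elim (auto simp: it_def H_def)
    note ae_y = this
    obtain y where "(\<forall>n. it y n \<notin> full A) \<and> (\<forall>m. \<exists>n. s * it y n < m) \<and>
        (\<forall>n. edge (it y n) (it y (Suc n)))"
      by (rule nonnull_obtain[OF mA nn(2) ae_y])
    then have y: "\<And>n. it y n \<notin> full A" "\<And>m. \<exists>n. s * it y n < m" "\<And>n. edge (it y n) (it y (Suc n))"
      by auto
    show False
    proof (cases "\<forall>i. k < \<bar>i\<bar> \<longrightarrow> edge i (i - s)")
      case True
      have out: "i - s * int r \<in> full A" for r
      proof (induction r)
        case (Suc r)
        have "s * (i - s * int r) = s * i - int r" using ss by (simp add: right_diff_distrib mult.assoc[symmetric])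
        then have "k < \<bar>i - s * int r\<bar>" using si abs_s[of "i - s * int r"] by linarith
        then have "edge (i - s * int r) (i - s * int r - s)" using True by blast
        then have "i - s * int r - s \<in> full A" using closed[OF Suc] by blast
        then show ?case by (simp add: algebra_simps)
      qed (use i in simp)
      obtain n where n: "s * it y n < s * i" using y(2) by blast
      define r where "r = nat (s * i - s * it y n)"
      have "int r = s * i - s * it y n" using n by (simp add: r_def)
      then have "i - s * int r = it y n" using ss by (simp add: right_diff_distrib mult.assoc[symmetric])
      then show False using out[of r] y(1)[of n] by simp
    next
      case False
      have mono: "s * j \<le> s * j'" if "k < \<bar>j\<bar>" "edge j j'" for j j'
        using s
      proof
        assume "s = 1"
        then have "\<not> k\<^sub>1 \<le> -1" using False edge_left by auto
        then show ?thesis using that pq[OF that(1)] k12 \<open>s = 1\<close> by (simp add: edge_def)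
      next
        assume "s = -1"
        then have "\<not> 1 \<le> k\<^sub>2" using False edge_right by auto
        then show ?thesis using that pq[OF that(1)] k12 \<open>s = -1\<close> by (simp add: edge_def)
      qed
      \<comment> \<open>A step in direction \<open>-s\<close> can start only from a cell within
        \<open>k\<close>, and it loses at most \<open>N\<close>.\<close>
      have "min (s * it y 0) (- k - N) \<le> s * it y n" for n
      proof (induction n)
        case (Suc n)
        show ?case
        proof (cases "k < \<bar>it y n\<bar>")
          case True
          then show ?thesis using mono[OF True y(3)[of n]] Suc by linarith
        next
          case False
          then have "- k \<le> s * it y n" using abs_s[of "it y n"] by linarith
          moreover have "s * it y n - N \<le> s * it y (Suc n)" using edge_jump[OF y(3)[of n]] s by auto
          ultimately show ?thesis by linarith
        qed
      qed simp
      then show False using y(2)[of "min (s * it y 0) (- k - N)"] by (meson not_le)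
    qed
  qed
  obtain W where W: "W \<in> sets borel" "W \<notin> null_sets lborel"
    "AE x in lborel. x \<in> W \<longrightarrow> (\<forall>n\<ge>1. it x n \<in> full A) \<and> (\<forall>m. \<forall>\<^sub>F n in sequentially. m < \<bar>it x n\<bar>)"
    using escape[of "full A"] closed j not_all by blast
  from W(3) ne have "AE x in lborel. x \<in> W \<longrightarrow> (\<forall>n\<ge>1. it x n \<in> full A) \<and>
      (\<forall>m. \<forall>\<^sub>F n in sequentially. m < \<bar>it x n\<bar>) \<and> x \<notin> escaping s"
    by eventually_elim auto
  note ae_w = this
  obtain w where "(\<forall>n\<ge>1. it w n \<in> full A) \<and>
      (\<forall>m. \<forall>\<^sub>F n in sequentially. m < \<bar>it w n\<bar>) \<and> w \<notin> escaping s"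
    by (rule nonnull_obtain[OF W(1,2) ae_w])
  then have w: "\<And>n. n \<ge> 1 \<Longrightarrow> it w n \<in> full A" "\<And>m. \<forall>\<^sub>F n in sequentially. m < \<bar>it w n\<bar>" "w \<notin> escaping s"
    by auto
  have "\<forall>\<^sub>F n in sequentially. m < s * it w n" for m
    using w(2)[of "max m k"] eventually_ge_at_top[of 1]
  proof eventually_elim
    case (elim n)
    then show ?case using side[OF w(1)[of n]] abs_s[of "it w n"] by linarith
  qed
  then show False using w(3) by (simp add: escaping_def)
qed

text \<open>Almost every orbit is unbounded towards some end, and for a given end this cannot happen
  with positive measure both in \<open>A\<close> and in its complement. If neither set is null, each
  of them is therefore attached to one end and bounded towards the other. Then orbits of positive
  measure tend to either end, which is impossible.\<close>

lemma ergodic: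
  assumes A: "A \<in> sets borel" and inv: "A - T -` A \<in> null_sets lborel" "- A - T -` (- A) \<in> null_sets lborel"
  shows "A \<in> null_sets lborel \<or> - A \<in> null_sets lborel"
proof (rule ccontr)
  assume "\<not> ?thesis"
  then have nn: "A \<notin> null_sets lborel" "- A \<notin> null_sets lborel" by auto
  have mA: "- A \<in> sets borel" and inv': "- (- A) - T -` (- (- A)) \<in> null_sets lborel" using A inv by auto
  define up where "up s x \<longleftrightarrow> (\<forall>m. \<exists>n. m \<le> s * it x n)" for s x
  have updown: "AE x in lborel. up 1 x \<or> up (-1) x"
    using unbounded_orbits
  proof eventually_elim
    case (elim x)
    show ?case
    proof (rule ccontr)
      assume "\<not> ?thesis"
      then obtain m1 m2 where m: "\<And>n. it x n < m1" "\<And>n. - it x n < m2"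
        unfolding up_def by (auto simp: not_le)
      obtain n where "max m1 m2 < \<bar>it x n\<bar>" using elim by (blast dest: frequently_ex)
      then show False using m(1)[of n] m(2)[of n] by linarith
    qed
  qed
  have fillA: "AE x in lborel. x \<in> A \<longrightarrow> (\<lambda>n. measure lborel (H (it x n) - A)) \<longlonglongrightarrow> 0"
    and fillB: "AE x in lborel. x \<in> - A \<longrightarrow> (\<lambda>n. measure lborel (H (it x n) - (- A))) \<longlonglongrightarrow> 0"
    by (intro fill A mA sub_vimage_funpow inv)+
  have one: "(AE x in lborel. x \<in> A \<longrightarrow> \<not> up s x) \<or> (AE x in lborel. x \<in> - A \<longrightarrow> \<not> up s x)"
    if s: "s = 1 \<or> s = -1" for s
  proof (rule ccontr)
    assume no: "\<not> ?thesis"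
    obtain x where x: "up s x" "\<forall>n. edge (it x n) (it x (Suc n))" "(\<lambda>n. measure lborel (H (it x n) - A)) \<longlonglongrightarrow> 0"
    proof -
      have "\<exists>x. up s x \<and> (\<forall>n. edge (it x n) (it x (Suc n))) \<and> (\<lambda>n. measure lborel (H (it x n) - A)) \<longlonglongrightarrow> 0"
      proof (rule ccontr)
        assume nt: "\<not> ?thesis"
        have "AE x in lborel. x \<in> A \<longrightarrow> \<not> up s x" using AE_edge fillA by eventually_elim (use nt in blast)
        with no show False by blast
      qed
      then show ?thesis using that by blast
    qed
    obtain y where y: "up s y" "\<forall>n. edge (it y n) (it y (Suc n))" "(\<lambda>n. measure lborel (H (it y n) - (- A))) \<longlonglongrightarrow> 0"
    proof -
      have "\<exists>x. up s x \<and> (\<forall>n. edge (it x n) (it x (Suc n))) \<and> (\<lambda>n. measure lborel (H (it x n) - (- A))) \<longlonglongrightarrow> 0"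
      proof (rule ccontr)
        assume nt: "\<not> ?thesis"
        have "AE x in lborel. x \<in> - A \<longrightarrow> \<not> up s x" using AE_edge fillB by eventually_elim (use nt in blast)
        with no show False by blast
      qed
      then show ?thesis using that by blast
    qed
    show False
      using windows_meet[OF s A inv, of x y] x y unfolding up_def by blast
  qed
  have excl: "\<not> ((AE x in lborel. x \<in> C \<longrightarrow> \<not> up 1 x) \<and> (AE x in lborel. x \<in> C \<longrightarrow> \<not> up (-1) x))"
    if C: "C \<in> sets borel" "C \<notin> null_sets lborel" for C
  proof
    assume "(AE x in lborel. x \<in> C \<longrightarrow> \<not> up 1 x) \<and> (AE x in lborel. x \<in> C \<longrightarrow> \<not> up (-1) x)"
    then have "AE x in lborel. x \<in> C \<longrightarrow> False" using updown by (auto elim!: AE_mp)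
    from nonnull_obtain[OF C this] show False by blast
  qed
  have esc: "\<not> (AE x in lborel. x \<notin> escaping s)"
    if s: "s = 1 \<or> s = -1" and C: "C \<in> sets borel" "C - T -` C \<in> null_sets lborel"
      "- C - T -` (- C) \<in> null_sets lborel" "C \<notin> null_sets lborel" "- C \<notin> null_sets lborel"
      and d: "AE x in lborel. x \<in> C \<longrightarrow> \<not> up (- s) x" "AE x in lborel. x \<in> - C \<longrightarrow> \<not> up s x" for C s
  proof (rule escaping_nonnull[OF s C])
    show "AE x in lborel. x \<in> C \<longrightarrow> (\<exists>m. \<forall>n. m \<le> s * it x n)"
      using d(1)
    proof eventually_elim
      case (elim x)
      show ?case
      proof
        assume "x \<in> C"
        then obtain m where "\<And>n. - s * it x n < m" using elim by (auto simp: up_def not_le)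
        then have "- m \<le> s * it x n" for n by (smt (verit) minus_mult_left)
        then show "\<exists>m. \<forall>n. m \<le> s * it x n" by blast
      qed
    qed
    show "AE x in lborel. x \<in> - C \<longrightarrow> (\<forall>m. \<exists>n. s * it x n < m)"
      using d(2) updown
    proof eventually_elim
      case (elim x)
      show ?case
      proof (intro impI allI)
        fix m assume "x \<in> - C"
        then have "up (- s) x" using elim s by auto
        then obtain n where "1 - m \<le> - s * it x n" by (auto simp: up_def)
        then have "s * it x n < m" by (smt (verit) minus_mult_left)
        then show "\<exists>n. s * it x n < m" ..
      qed
    qed
  qed
  consider "AE x in lborel. x \<in> A \<longrightarrow> \<not> up 1 x" "AE x in lborel. x \<in> - A \<longrightarrow> \<not> up (-1) x"
    | "AE x in lborel. x \<in> - A \<longrightarrow> \<not> up 1 x" "AE x in lborel. x \<in> A \<longrightarrow> \<not> up (-1) x"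
    using one[of 1] one[of "-1"] excl[OF A nn(1)] excl[OF mA nn(2)] by blast
  then show False
  proof cases
    case 1
    then have "\<not> (AE x in lborel. x \<notin> escaping (-1))" "\<not> (AE x in lborel. x \<notin> escaping 1)"
      using esc[of "-1" A] esc[of 1 "- A"] A mA inv inv' nn by auto
    then show False using not_both_escaping by blast
  next
    case 2
    then have "\<not> (AE x in lborel. x \<notin> escaping 1)" "\<not> (AE x in lborel. x \<notin> escaping (-1))"
      using esc[of 1 A] esc[of "-1" "- A"] A mA inv inv' nn by auto
    then show False using not_both_escaping by blast
  qed
qed

text \<open>The complement of a tail set is a tail set, so both are forward invariant modulo null
  sets.\<close>

lemma tail_trivial:
  assumes A: "A \<in> sets borel" and tail: "\<And>n. \<exists>C\<in>sets borel. A = (T ^^ n) -` C"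
  shows "A \<in> null_sets lborel \<or> - A \<in> null_sets lborel"
proof (rule ergodic[OF A])
  obtain C where C: "\<And>n. C n \<in> sets borel" "\<And>n. A = (T ^^ n) -` C n" using tail by metis
  show "A - T -` A \<in> null_sets lborel" by (rule tail_sub[OF A C])
  show "- A - T -` (- A) \<in> null_sets lborel"
  proof (rule tail_sub[of _ "\<lambda>n. - C n"])
    show "- A = (T ^^ n) -` (- C n)" for n unfolding vimage_Compl by (simp only: C(2)[symmetric])
  qed (use A C in auto)
qed

lemma global_local_mixing:
  fixes F g :: "real \<Rightarrow> complex"
  assumes F: "F \<in> borel_measurable borel" and FK: "AE x in lborel. norm (F x) \<le> K"
    and g: "integrable \<mu> g" and g0: "(LINT x|\<mu>. g x) = 0"
  shows "(\<lambda>n. LINT x|\<mu>. F ((T ^^ n) x) * g x) \<longlonglongrightarrow> 0"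
proof -
  have "sigma_finite_measure \<mu>"
  proof
    show "\<exists>A. countable A \<and> A \<subseteq> sets \<mu> \<and> \<Union> A = space \<mu> \<and> (\<forall>a\<in>A. emeasure \<mu> a \<noteq> \<infinity>)"
    proof (intro exI conjI)
      show "\<Union> (range (\<lambda>n. {- real n .. real n})) = space \<mu>"
      proof safe
        fix x :: real
        obtain n where "\<bar>x\<bar> \<le> real n" using real_arch_simple by blast
        then show "x \<in> \<Union> (range (\<lambda>n. {- real n .. real n}))" by (auto simp: abs_le_iff intro!: exI[of _ n])
      qed simp
      show "\<forall>a\<in>range (\<lambda>n. {- real n .. real n}). emeasure \<mu> a \<noteq> \<infinity>"
        using fin_\<mu> by (auto simp: less_top)
    qed (auto simp: sets_\<mu>)
  qed
  then interpret sigma_finite_measure \<mu> .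
  \<comment> \<open>The abstract mixing lemma asks for a bound at every point. Cutting
    \<open>F\<close> off changes it on a null set only, and the preimages of that set under all
    iterates are null.\<close>
  define F' where "F' x = (if norm (F x) \<le> K then F x else 0)" for x
  have [measurable]: "F \<in> borel_measurable \<mu>" using F measurable_cong_sets[OF sets_\<mu> refl] by blast
  have lim: "(\<lambda>n. LINT x|\<mu>. F' ((T ^^ n) x) * g x) \<longlonglongrightarrow> 0"
  proof (rule tail_trivial_mixing[OF _ _ g g0])
    show "T \<in> \<mu> \<rightarrow>\<^sub>M \<mu>" using T_measurable measurable_cong_sets[OF sets_\<mu> sets_\<mu>] by blast
    show "F' \<in> borel_measurable \<mu>" unfolding F'_def by measurable
    show "norm (F' x) \<le> \<bar>K\<bar>" for x by (auto simp: F'_def intro: order_trans[OF _ abs_ge_self])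
    fix A assume A: "A \<in> sets \<mu>" and t: "\<And>n. \<exists>B\<in>sets \<mu>. A = (T ^^ n) -` B \<inter> space \<mu>"
    have "A \<in> null_sets lborel \<or> - A \<in> null_sets lborel"
      by (rule tail_trivial) (use A t in \<open>auto simp: sets_\<mu>\<close>)
    then show "A \<in> null_sets \<mu> \<or> space \<mu> - A \<in> null_sets \<mu>" by (simp add: null_\<mu> Compl_eq_Diff_UNIV)
  qed
  have "(LINT x|\<mu>. F' ((T ^^ n) x) * g x) = (LINT x|\<mu>. F ((T ^^ n) x) * g x)" for n
  proof -
    have Tm[measurable]: "T ^^ n \<in> \<mu> \<rightarrow>\<^sub>M \<mu>" using Tn_measurable measurable_cong_sets[OF sets_\<mu> sets_\<mu>] by blast
    have [measurable]: "F' \<in> borel_measurable \<mu>" unfolding F'_def by measurable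
    show ?thesis
    proof (rule integral_cong_AE)
      have "AE x in lborel. F' ((T ^^ n) x) = F ((T ^^ n) x)"
        using AE_Tn[OF FK] by eventually_elim (simp add: F'_def)
      then show "AE x in \<mu>. F' ((T ^^ n) x) * g x = F ((T ^^ n) x) * g x"
        unfolding AE_\<mu>_iff by eventually_elim simp
    qed (use g in measurable)
  qed
  with lim show ?thesis by simp
qed

end

section \<open>Infinite-volume averages\<close>

text \<open>These properties are shared by the measure of the lift and that of its modification, so
  facts about averages that involve no translation are proved for both at once.\<close>

locale averaging =
  fixes M :: "real measure"
  assumes sets_M: "sets M = sets borel"
    and null_M: "null_sets M = null_sets lborel"
    and fin_M: "\<And>x y. emeasure M {x..y} < \<infinity>"
begin

lemma space_M[simp]: "space M = UNIV"
  using sets_eq_imp_space_eq[OF sets_M] by simp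

lemma AE_M_iff: "(AE x in M. P x) \<longleftrightarrow> (AE x in lborel. P x)"
  by (simp add: eventually_ae_filter null_M)

lemma measurable_M: "f \<in> borel_measurable borel \<Longrightarrow> f \<in> borel_measurable M"
  using measurable_cong_sets[OF sets_M refl] by blast

lemma set_integrable_bounded:
  fixes F :: "real \<Rightarrow> complex"
  assumes F: "F \<in> L_infinity lborel" and A: "A \<in> sets borel" "emeasure M A < \<infinity>"
  shows "set_integrable M A F"
proof -
  obtain B where B: "AE x in lborel. norm (F x) \<le> B" using F by (auto simp: L_infinity_def)
  have "F \<in> borel_measurable M" using F by (intro measurable_M) (simp add: L_infinity_def)
  moreover have "AE x in M. x \<in> A \<longrightarrow> norm (F x) \<le> B" using B unfolding AE_M_iff by eventually_elim simp
  ultimately show ?thesis unfolding set_integrable_def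
    using A by (intro integrableI_bounded_set_indicator[of _ _ _ B]) (auto simp: sets_M)
qed

lemma integrable_indicator_M: "A \<in> sets borel \<Longrightarrow> emeasure M A < \<infinity> \<Longrightarrow> integrable M (indicator A :: real \<Rightarrow> real)"
  by (intro integrable_real_indicator) (auto simp: sets_M)

lemma norm_set_integral_le:
  fixes F :: "real \<Rightarrow> complex"
  assumes B: "AE x in lborel. norm (F x) \<le> B" and F: "F \<in> borel_measurable borel"
    and A: "A \<in> sets borel" "emeasure M A < \<infinity>"
  shows "norm (LINT x:A|M. F x) \<le> B * measure M A"
proof -
  have FL: "F \<in> L_infinity lborel" using B F by (auto simp: L_infinity_def)
  have "norm (LINT x:A|M. F x) \<le> (LINT x:A|M. norm (F x))"
    by (rule set_integral_norm_bound[OF set_integrable_bounded[OF FL A]])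
  also have "\<dots> \<le> (LINT x|M. B * indicator A x)"
    unfolding set_lebesgue_integral_def
  proof (rule integral_mono_AE)
    show "integrable M (\<lambda>x. indicator A x *\<^sub>R norm (F x))"
      using set_integrable_norm[OF set_integrable_bounded[OF FL A]] by (simp add: set_integrable_def)
    show "integrable M (\<lambda>x. B * indicator A x)" using integrable_indicator_M[OF A] by simp
    show "AE x in M. indicator A x *\<^sub>R norm (F x) \<le> B * indicator A x"
      using B unfolding AE_M_iff by eventually_elim (simp add: indicator_def)
  qed
  also have "\<dots> = B * measure M A" using A by (simp add: sets_M)
  finally show ?thesis .
qed

lemma has_average_iff:
  "has_infinite_volume_average M F L \<longleftrightarrow> (\<forall>e>0. \<exists>R. \<forall>r\<ge>R. \<forall>x.
     norm ((LINT y:{x - r..x + r}|M. F y) / of_real (measure M {x - r..x + r}) - L) < e)"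
  unfolding has_infinite_volume_average_def uniform_limit_iff eventually_at_top_linorder dist_norm
  using fin_M by auto

lemma average_unique:
  assumes "has_infinite_volume_average M F L" "has_infinite_volume_average M F L'"
  shows "L = L'"
proof (rule ccontr)
  assume "L \<noteq> L'"
  then have e: "norm (L - L') / 2 > 0" by simp
  obtain R where R: "\<And>r x. r \<ge> R \<Longrightarrow>
      norm ((LINT y:{x - r..x + r}|M. F y) / of_real (measure M {x - r..x + r}) - L) < norm (L - L') / 2"
    using assms(1) e unfolding has_average_iff by metis
  obtain R' where R': "\<And>r x. r \<ge> R' \<Longrightarrow>
      norm ((LINT y:{x - r..x + r}|M. F y) / of_real (measure M {x - r..x + r}) - L') < norm (L - L') / 2"
    using assms(2) e unfolding has_average_iff by metis
  show False
    using norm_triangle_half_r[OF R[of "max R R'" 0] R'[of "max R R'" 0]] by simp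
qed

lemma average_eq: "has_infinite_volume_average M F L \<Longrightarrow> average M F = L"
  unfolding average_def using average_unique by blast

lemma has_average: "average_exists M F \<Longrightarrow> has_infinite_volume_average M F (average M F)"
  unfolding average_exists_def using average_eq by blast

lemma has_average_cong:
  assumes F: "F \<in> borel_measurable borel" "G \<in> borel_measurable borel" and eq: "AE x in lborel. F x = G x"
    and G: "has_infinite_volume_average M G L"
  shows "has_infinite_volume_average M F L"
proof -
  have "(LINT y:{x - r..x + r}|M. F y) = (LINT y:{x - r..x + r}|M. G y)" for x r
    unfolding set_lebesgue_integral_def
  proof (rule integral_cong_AE)
    show "AE y in M. indicator {x - r..x + r} y *\<^sub>R F y = indicator {x - r..x + r} y *\<^sub>R G y"
      using eq unfolding AE_M_iff by eventually_elim simp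
  qed (use F in \<open>auto intro!: measurable_M\<close>)
  then show ?thesis using G by (simp add: has_average_iff)
qed

lemma has_average_cmult:
  assumes "has_infinite_volume_average M F L"
  shows "has_infinite_volume_average M (\<lambda>x. z * F x) (z * L)"
proof -
  have eq: "(\<lambda>r x. (LINT y:{x - r..x + r}|M. z * F y) / of_real (measure M {x - r..x + r})) =
     (\<lambda>r x. z * ((LINT y:{x - r..x + r}|M. F y) / of_real (measure M {x - r..x + r})))"
    by (intro ext) (simp add: set_lebesgue_integral_def scaleR_conv_of_real mult.left_commute)
  show ?thesis
    using assms unfolding has_infinite_volume_average_def eq
    by (intro conjI bounded_linear.uniform_limit[OF bounded_linear_mult_right]) simp_all
qed

lemma has_average_add:
  assumes "has_infinite_volume_average M F L" "has_infinite_volume_average M G K"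
    and "F \<in> L_infinity lborel" "G \<in> L_infinity lborel"
  shows "has_infinite_volume_average M (\<lambda>x. F x + G x) (L + K)"
proof -
  have "(LINT y:{x - r..x + r}|M. F y + G y) = (LINT y:{x - r..x + r}|M. F y) + (LINT y:{x - r..x + r}|M. G y)" for x r
    using assms(3,4) fin_M by (intro set_integral_add set_integrable_bounded) auto
  then have eq: "(\<lambda>r x. (LINT y:{x - r..x + r}|M. F y + G y) / of_real (measure M {x - r..x + r})) =
     (\<lambda>r x. (LINT y:{x - r..x + r}|M. F y) / of_real (measure M {x - r..x + r})
       + (LINT y:{x - r..x + r}|M. G y) / of_real (measure M {x - r..x + r}))"
    by (simp add: add_divide_distrib)
  show ?thesis
    using assms(1,2) unfolding has_infinite_volume_average_def eq
    by (auto intro!: uniform_limit_intros)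
qed

lemma has_average_zero: "has_infinite_volume_average M (\<lambda>_. 0) 0"
  unfolding has_average_iff by simp

text \<open>The bound is uniform in the position and the size of the window, which is what lets
  averages pass to limits in the essential supremum norm. Windows of measure 0 have quotient 0 for
  both functions.\<close>

lemma quotient_diff_le:
  assumes F: "F \<in> L_infinity lborel" "G \<in> L_infinity lborel"
    and le: "AE x in lborel. norm (F x - G x) \<le> e" and e: "0 \<le> e"
  shows "norm ((LINT y:{x - r..x + r}|M. F y) / of_real (measure M {x - r..x + r})
    - (LINT y:{x - r..x + r}|M. G y) / of_real (measure M {x - r..x + r})) \<le> e"
proof (cases "measure M {x - r..x + r} = 0")
  case False
  then have V: "measure M {x - r..x + r} > 0" by (simp add: zero_less_measure_iff)
  have "(LINT y:{x - r..x + r}|M. F y) - (LINT y:{x - r..x + r}|M. G y) = (LINT y:{x - r..x + r}|M. F y - G y)"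
    using F fin_M by (intro set_integral_diff(2)[symmetric] set_integrable_bounded) auto
  moreover have "norm (LINT y:{x - r..x + r}|M. F y - G y) \<le> e * measure M {x - r..x + r}"
    using F fin_M by (intro norm_set_integral_le le) (auto simp: L_infinity_def)
  ultimately show ?thesis
    using V by (simp add: diff_divide_distrib[symmetric] norm_divide divide_le_eq)
qed (use e in simp)

lemma average_diff_le:
  assumes F: "F \<in> L_infinity lborel" "G \<in> L_infinity lborel"
    and le: "AE x in lborel. norm (F x - G x) \<le> e" and e: "0 \<le> e"
    and avg: "has_infinite_volume_average M F L" "has_infinite_volume_average M G K"
  shows "norm (L - K) \<le> e"
proof (rule field_le_epsilon)
  fix d :: real assume d: "0 < d"
  obtain R where R: "\<And>r x. r \<ge> R \<Longrightarrow> norm ((LINT y:{x - r..x + r}|M. F y) / of_real (measure M {x - r..x + r}) - L) < d / 2"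
    using avg(1) d unfolding has_average_iff by (metis half_gt_zero)
  obtain R' where R': "\<And>r x. r \<ge> R' \<Longrightarrow> norm ((LINT y:{x - r..x + r}|M. G y) / of_real (measure M {x - r..x + r}) - K) < d / 2"
    using avg(2) d unfolding has_average_iff by (metis half_gt_zero)
  define r where "r = max R R'"
  define A where "A = (LINT y:{0 - r..0 + r}|M. F y) / of_real (measure M {0 - r..0 + r})"
  define A' where "A' = (LINT y:{0 - r..0 + r}|M. G y) / of_real (measure M {0 - r..0 + r})"
  have "norm (A - L) < d / 2" "norm (A' - K) < d / 2" "norm (A - A') \<le> e"
    unfolding A_def A'_def by (rule R, simp add: r_def, rule R', simp add: r_def, rule quotient_diff_le[OF F le e])
  moreover have "norm (L - K) \<le> norm (A - L) + norm (A - A') + norm (A' - K)"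
    using norm_triangle_ineq[of "L - A" "A - K"] norm_triangle_ineq[of "A - A'" "A' - K"]
    by (simp add: norm_minus_commute)
  ultimately show "norm (L - K) \<le> e + d" by linarith
qed

text \<open>The averages of the approximants form a Cauchy sequence, since an average changes by no
  more than the function does. Uniformity in the centre survives because the quotients are close in
  all windows simultaneously.\<close>

lemma average_exists_limit:
  assumes F: "F \<in> L_infinity lborel"
    and approx: "\<And>e. e > 0 \<Longrightarrow> \<exists>G\<in>L_infinity lborel. average_exists M G \<and> (AE x in lborel. norm (F x - G x) \<le> e)"
  shows "average_exists M F"
proof -
  have "\<forall>m. \<exists>G. G \<in> L_infinity lborel \<and> average_exists M G \<and> (AE x in lborel. norm (F x - G x) \<le> 1 / real (Suc m))"
  proof
    fix m :: nat
    have "0 < 1 / real (Suc m)" by simp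
    from approx[OF this]
    show "\<exists>G. G \<in> L_infinity lborel \<and> average_exists M G \<and> (AE x in lborel. norm (F x - G x) \<le> 1 / real (Suc m))"
      by blast
  qed
  from choice[OF this] obtain G where "\<forall>m. G m \<in> L_infinity lborel \<and> average_exists M (G m) \<and>
    (AE x in lborel. norm (F x - G m x) \<le> 1 / real (Suc m))" ..
  then have G: "\<And>m. G m \<in> L_infinity lborel" "\<And>m. average_exists M (G m)"
    "\<And>m. AE x in lborel. norm (F x - G m x) \<le> 1 / real (Suc m)" by blast+
  define L where "L m = average M (G m)" for m
  have GL: "has_infinite_volume_average M (G m) (L m)" for m unfolding L_def by (rule has_average[OF G(2)])
  have dL: "norm (L m - L n) \<le> 1 / real (Suc m) + 1 / real (Suc n)" for m n
  proof (rule average_diff_le[OF G(1) G(1) _ _ GL GL])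
    show "AE x in lborel. norm (G m x - G n x) \<le> 1 / real (Suc m) + 1 / real (Suc n)"
      using G(3)[of m] G(3)[of n]
    proof eventually_elim
      case (elim x)
      then show ?case using norm_triangle_ineq[of "G m x - F x" "F x - G n x"] by (simp add: norm_minus_commute)
    qed
  qed simp
  have small: "\<exists>N. \<forall>m\<ge>N. 1 / real (Suc m) < e" if "e > 0" for e
    using LIMSEQ_D[OF LIMSEQ_inverse_real_of_nat that] by (simp add: inverse_eq_divide)
  have "Cauchy L"
  proof (rule CauchyI)
    fix e :: real assume "0 < e"
    then obtain N where N: "\<And>m. m \<ge> N \<Longrightarrow> 1 / real (Suc m) < e / 2" using small[of "e / 2"] by auto
    have "norm (L m - L n) < e" if "m \<ge> N" "n \<ge> N" for m n
      using dL[of m n] N[OF that(1)] N[OF that(2)] by linarith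
    then show "\<exists>N. \<forall>m\<ge>N. \<forall>n\<ge>N. norm (L m - L n) < e" by blast
  qed
  then obtain l where l: "L \<longlonglongrightarrow> l" using Cauchy_convergent_iff convergent_def by blast
  have "has_infinite_volume_average M F l"
    unfolding has_average_iff
  proof (intro allI impI)
    fix e :: real assume e: "0 < e"
    obtain N where N: "\<And>m. m \<ge> N \<Longrightarrow> 1 / real (Suc m) < e / 3" using small[of "e / 3"] e by auto
    obtain N' where N': "\<And>m. m \<ge> N' \<Longrightarrow> norm (L m - l) < e / 3" using LIMSEQ_D[OF l, of "e / 3"] e by auto
    define m where "m = max N N'"
    obtain R where R: "\<And>r x. r \<ge> R \<Longrightarrow>
        norm ((LINT y:{x - r..x + r}|M. G m y) / of_real (measure M {x - r..x + r}) - L m) < e / 3"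
      using GL[of m] e unfolding has_average_iff by (metis divide_pos_pos zero_less_numeral)
    have "norm ((LINT y:{x - r..x + r}|M. F y) / of_real (measure M {x - r..x + r}) - l) < e" if r: "r \<ge> R" for r x
    proof -
      define A where "A = (LINT y:{x - r..x + r}|M. F y) / of_real (measure M {x - r..x + r})"
      define A' where "A' = (LINT y:{x - r..x + r}|M. G m y) / of_real (measure M {x - r..x + r})"
      have "norm (A - A') \<le> 1 / real (Suc m)"
        unfolding A_def A'_def by (rule quotient_diff_le[OF F G(1) G(3)]) simp
      moreover have "norm (A' - L m) < e / 3" unfolding A'_def by (rule R[OF r])
      moreover have "norm (A - l) \<le> norm (A - A') + norm (A' - L m) + norm (L m - l)"
        using norm_triangle_ineq[of "A - A'" "A' - l"] norm_triangle_ineq[of "A' - L m" "L m - l"] by simp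
      ultimately show ?thesis using N[of m] N'[of m] unfolding A_def m_def by fastforce
    qed
    then show "\<exists>R. \<forall>r\<ge>R. \<forall>x. norm ((LINT y:{x - r..x + r}|M. F y) / of_real (measure M {x - r..x + r}) - l) < e"
      by blast
  qed
  then show ?thesis by (auto simp: average_exists_def)
qed

end

lemma L_infinity_add: "F \<in> L_infinity lborel \<Longrightarrow> G \<in> L_infinity lborel \<Longrightarrow> (\<lambda>x. F x + G x) \<in> L_infinity lborel"
proof -
  assume "F \<in> L_infinity lborel" "G \<in> L_infinity lborel"
  then obtain B B' where m: "F \<in> borel_measurable borel" "G \<in> borel_measurable borel"
    and B: "AE x in lborel. norm (F x) \<le> B" "AE x in lborel. norm (G x) \<le> B'" by (auto simp: L_infinity_def)
  have "AE x in lborel. norm (F x + G x) \<le> B + B'"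
    using B by eventually_elim (meson add_mono norm_triangle_ineq order_trans)
  then show ?thesis using m by (auto simp: L_infinity_def)
qed

lemma L_infinity_mult: "F \<in> L_infinity lborel \<Longrightarrow> G \<in> L_infinity lborel \<Longrightarrow> (\<lambda>x. F x * G x) \<in> L_infinity lborel"
proof -
  assume "F \<in> L_infinity lborel" "G \<in> L_infinity lborel"
  then obtain B B' where m: "F \<in> borel_measurable borel" "G \<in> borel_measurable borel"
    and B: "AE x in lborel. norm (F x) \<le> B" "AE x in lborel. norm (G x) \<le> B'" by (auto simp: L_infinity_def)
  have "AE x in lborel. norm (F x * G x) \<le> B * B'"
    using B by eventually_elim (auto simp: norm_mult intro!: mult_mono intro: order_trans[OF norm_ge_zero])
  then show ?thesis using m by (auto simp: L_infinity_def)
qed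

lemma L_infinity_const: "(\<lambda>_. c) \<in> L_infinity lborel"
  by (auto simp: L_infinity_def)

lemma L_infinity_cmult: "F \<in> L_infinity lborel \<Longrightarrow> (\<lambda>x. c * F x) \<in> L_infinity lborel"
  by (rule L_infinity_mult[OF L_infinity_const])

lemma L_infinity_sum:
  assumes "\<And>i. i \<in> A \<Longrightarrow> F i \<in> L_infinity lborel"
  shows "(\<lambda>x. \<Sum>i\<in>A. F i x) \<in> L_infinity lborel"
  using assms by (induction A rule: infinite_finite_induct) (auto intro: L_infinity_add L_infinity_const)

context averaging
begin

lemma has_average_sum:
  assumes "\<And>i. i \<in> A \<Longrightarrow> F i \<in> L_infinity lborel"
    and "\<And>i. i \<in> A \<Longrightarrow> has_infinite_volume_average M (F i) (L i)"
  shows "has_infinite_volume_average M (\<lambda>x. \<Sum>i\<in>A. F i x) (\<Sum>i\<in>A. L i)"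
  using assms
proof (induction A rule: infinite_finite_induct)
  case (insert i A)
  have "has_infinite_volume_average M (\<lambda>x. F i x + (\<Sum>i\<in>A. F i x)) (L i + (\<Sum>i\<in>A. L i))"
    using insert by (intro has_average_add L_infinity_sum) auto
  then show ?case using insert(1,2) by simp
qed (auto intro: has_average_zero)

end

section \<open>Averages with respect to a translation-invariant measure\<close>

locale periodic_averaging = averaging +
  fixes a :: real
  assumes a_pos: "0 < a"
    and shift_M: "preserves_measure (\<lambda>x. x + a) M"
begin

definition H :: "int \<Rightarrow> real set" where
  "H j = {a * real_of_int j ..< a * (real_of_int j + 1)}"

definition vol :: real where
  "vol = measure M (H 0)"

lemma mem_H: "x \<in> H j \<longleftrightarrow> \<lfloor>x / a\<rfloor> = j"
  using a_pos by (simp add: H_def floor_eq_iff pos_le_divide_eq pos_divide_less_eq mult.commute)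

lemma sets_H[measurable]: "H j \<in> sets borel"
  by (simp add: H_def)

lemma fin_H: "emeasure M (H j) < \<infinity>"
proof -
  have "emeasure M (H j) \<le> emeasure M {a * real_of_int j .. a * (real_of_int j + 1)}"
    by (rule emeasure_mono) (auto simp: H_def sets_M)
  then show ?thesis using fin_M by (rule le_less_trans)
qed

lemma distr_shift: "distr M M (\<lambda>x. x + a) = M"
  using shift_M by (simp add: preserves_measure_def)

lemma distr_shift_int: "distr M M (\<lambda>x. x + a * real_of_int j) = M"
proof -
  have m: "(\<lambda>x. x + b) \<in> M \<rightarrow>\<^sub>M M" for b :: real
    using measurable_cong_sets[OF sets_M sets_M] by fastforce
  have comp: "distr M M (\<lambda>x. x + (b + c)) = M"
    if "distr M M (\<lambda>x. x + b) = M" "distr M M (\<lambda>x. x + c) = M" for b c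
  proof -
    have "distr M M (\<lambda>x. x + (b + c)) = distr (distr M M (\<lambda>x. x + b)) M (\<lambda>x. x + c)"
      by (subst distr_distr[OF m m]) (simp add: o_def add.assoc)
    then show ?thesis using that by simp
  qed
  have neg: "distr M M (\<lambda>x. x + - a) = M"
  proof -
    have "distr M M (\<lambda>x. x + - a) = distr (distr M M (\<lambda>x. x + a)) M (\<lambda>x. x + - a)"
      by (simp add: distr_shift)
    also have "\<dots> = distr M M (\<lambda>x. x)" by (subst distr_distr[OF m m]) (simp add: o_def)
    finally show ?thesis by (simp add: distr_id2)
  qed
  show ?thesis
  proof (induction j rule: int_induct[where k = 0])
    case base
    then show ?case by (simp add: distr_id2)
  next
    case (step1 i)
    then show ?case using comp[OF step1(2) distr_shift] by (simp add: algebra_simps)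
  next
    case (step2 i)
    then show ?case using comp[OF step2(2) neg] by (simp add: algebra_simps)
  qed
qed

lemma meas_shift_int: "(\<lambda>x. x + b) \<in> M \<rightarrow>\<^sub>M M"
  using measurable_cong_sets[OF sets_M sets_M] by fastforce

lemma nn_integral_shift:
  assumes "f \<in> borel_measurable borel"
  shows "(\<integral>\<^sup>+x. f (x + a * real_of_int j) \<partial>M) = (\<integral>\<^sup>+x. f x \<partial>M)"
proof -
  have "f \<in> borel_measurable M" using assms measurable_cong_sets[OF sets_M refl] by blast
  then have "f \<in> borel_measurable (distr M M (\<lambda>x. x + a * real_of_int j))" by simp
  from nn_integral_distr[OF meas_shift_int this] show ?thesis by (simp add: distr_shift_int)
qed

lemma integral_shift:
  fixes f :: "real \<Rightarrow> complex"
  assumes "f \<in> borel_measurable borel"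
  shows "(LINT x|M. f (x + a * real_of_int j)) = (LINT x|M. f x)"
  using integral_distr[OF meas_shift_int[of "a * real_of_int j"] measurable_M[OF assms]] distr_shift_int[of j]
  by simp

lemma measure_H: "measure M (H j) = vol"
proof -
  have "measure M (H j) = measure (distr M M (\<lambda>x. x + a * real_of_int j)) (H j)" by (simp only: distr_shift_int)
  also have "\<dots> = measure M ((\<lambda>x. x + a * real_of_int j) -` H j)"
    by (subst measure_distr[OF meas_shift_int]) (auto simp: sets_M)
  also have "(\<lambda>x. x + a * real_of_int j) -` H j = H 0" by (auto simp: H_def algebra_simps)
  finally show ?thesis by (simp add: vol_def)
qed

lemma vol_pos: "0 < vol"
proof (rule ccontr)
  assume "\<not> 0 < vol"
  then have "measure M (H 0) = 0" by (simp add: vol_def not_less measure_le_0_iff)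
  then have "H 0 \<in> null_sets M" using fin_H[of 0]
    by (auto simp: null_sets_def sets_M emeasure_eq_ennreal_measure less_top)
  then have "H 0 \<in> null_sets lborel" by (simp add: null_M)
  then show False using a_pos by (auto simp: H_def null_sets_def)
qed

lemma cells_union: "i \<le> i' \<Longrightarrow> (\<Union>j\<in>{i..<i'}. H j) = {a * real_of_int i ..< a * real_of_int i'}"
proof (intro equalityI subsetI)
  fix x assume "x \<in> (\<Union>j\<in>{i..<i'}. H j)"
  then have "i \<le> \<lfloor>x / a\<rfloor>" "\<lfloor>x / a\<rfloor> < i'" by (auto simp: mem_H)
  then show "x \<in> {a * real_of_int i ..< a * real_of_int i'}"
    using a_pos by (simp add: le_floor_iff floor_less_iff pos_le_divide_eq pos_divide_less_eq mult.commute)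
next
  fix x assume "x \<in> {a * real_of_int i ..< a * real_of_int i'}"
  then have "i \<le> \<lfloor>x / a\<rfloor>" "\<lfloor>x / a\<rfloor> < i'"
    using a_pos by (auto simp: le_floor_iff floor_less_iff pos_le_divide_eq pos_divide_less_eq mult.commute)
  then show "x \<in> (\<Union>j\<in>{i..<i'}. H j)" by (auto simp: mem_H)
qed

text \<open>The union runs from the cell of \<open>u\<close> inclusively to the cell of
  \<open>v\<close> exclusively; it contains too much in the first of them and too little in the
  last, and differs from the interval nowhere else.\<close>

lemma interval_cells:
  assumes "u \<le> v"
  defines "i \<equiv> \<lfloor>u / a\<rfloor>" and "i' \<equiv> \<lfloor>v / a\<rfloor>"
  shows "i \<le> i'" "\<bar>indicator {u..v} x - indicator (\<Union>j\<in>{i..<i'}. H j) x :: real\<bar> \<le> indicator (H i) x + indicator (H i') x"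
proof -
  show le: "i \<le> i'" unfolding i_def i'_def using assms a_pos by (intro floor_mono divide_right_mono) auto
  have u: "u \<in> H i" and v: "v \<in> H i'" by (auto simp: mem_H i_def i'_def)
  have "u < a * (real_of_int i + 1)" "a * real_of_int i \<le> u" "v < a * (real_of_int i' + 1)" "a * real_of_int i' \<le> v"
    using u v by (auto simp: H_def)
  then show "\<bar>indicator {u..v} x - indicator (\<Union>j\<in>{i..<i'}. H j) x :: real\<bar> \<le> indicator (H i) x + indicator (H i') x"
    unfolding cells_union[OF le] by (auto simp: indicator_def H_def)
qed

text \<open>The subtracted 2 pays for rounding and for the incomplete cell at the left end. The
  bound is linear in the length and does not depend on the position.\<close>

lemma measure_interval_ge: "vol * ((v - u) / a - 2) \<le> measure M {u..v}"
proof (cases "u \<le> v")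
  case True
  define i where "i = \<lfloor>u / a\<rfloor>"
  define i' where "i' = \<lfloor>v / a\<rfloor>"
  note ic = interval_cells[OF True, folded i_def i'_def]
  let ?E = "\<Union>j\<in>{i..<i'}. H j"
  have E: "?E \<in> sets borel" by auto
  have "measure M ?E = (\<Sum>j\<in>{i..<i'}. measure M (H j))"
    using fin_H by (intro measure_finite_Union) (auto simp: disjoint_family_on_def mem_H sets_M less_top)
  also have "\<dots> = vol * real_of_int (i' - i)" using ic(1) by (simp add: measure_H)
  finally have mE: "measure M ?E = vol * real_of_int (i' - i)" .
  have uv: "a * real_of_int i' \<le> v" "u < a * (real_of_int i + 1)"
    using mem_H[of u i] mem_H[of v i'] by (auto simp: H_def i_def i'_def)
  have "?E \<subseteq> {u..v} \<union> H i"
    unfolding cells_union[OF ic(1)] using uv by (auto simp: H_def)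
  moreover have "{u..v} \<union> H i \<in> fmeasurable M"
    using fin_M fin_H by (intro fmeasurable.Un fmeasurableI) (auto simp: sets_M)
  ultimately have "measure M ?E \<le> measure M ({u..v} \<union> H i)"
    using E by (intro measure_mono_fmeasurable) (auto simp: sets_M)
  also have "\<dots> \<le> measure M {u..v} + vol"
    unfolding measure_H[of i, symmetric] by (intro measure_Un_le) (auto simp: sets_M)
  finally have 1: "vol * (real_of_int (i' - i) - 1) \<le> measure M {u..v}"
    using mE by (simp add: algebra_simps)
  have "v / a < real_of_int i' + 1" "real_of_int i \<le> u / a" unfolding i_def i'_def by linarith+
  then have "(v - u) / a - 2 \<le> real_of_int (i' - i) - 1" by (simp add: diff_divide_distrib)
  then have "vol * ((v - u) / a - 2) \<le> vol * (real_of_int (i' - i) - 1)"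
    using vol_pos by (intro mult_left_mono) auto
  with 1 show ?thesis by linarith
next
  case False
  then have "(v - u) / a - 2 \<le> 0" using a_pos by (simp add: divide_le_0_iff add_increasing2 field_simps)
  then have "vol * ((v - u) / a - 2) \<le> 0" using vol_pos by (simp add: mult_nonneg_nonpos)
  then show ?thesis using measure_nonneg order_trans by blast
qed

text \<open>The measure of an interval grows linearly with its length, uniformly in its position, so
  a discrepancy bounded by one constant for all intervals disappears in the quotient.\<close>

lemma has_averageI:
  fixes F :: "real \<Rightarrow> complex"
  assumes "\<And>u v. u \<le> v \<Longrightarrow> norm ((LINT x:{u..v}|M. F x) - L * of_real (measure M {u..v})) \<le> C"
  shows "has_infinite_volume_average M F L"
  unfolding has_average_iff
proof (intro allI impI)
  fix e :: real assume e: "0 < e"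
  \<comment> \<open>Solved from \<open>vol * (2 * R / a - 2) = \<bar>C\<bar> / e + 1\<close>, so
    that windows of radius at least \<open>R\<close> have measure above
    \<open>\<bar>C\<bar> / e\<close>.\<close>
  define R where "R = a / 2 * ((\<bar>C\<bar> / e + 1) / vol + 2)"
  have R: "R \<ge> 0" using a_pos vol_pos e by (simp add: R_def)
  have "norm ((LINT y:{x - r..x + r}|M. F y) / of_real (measure M {x - r..x + r}) - L) < e" if r: "r \<ge> R" for r x
  proof -
    define V where "V = measure M {x - r..x + r}"
    have "2 * (a / 2 * (X + 2)) / a - 2 = X" for X using a_pos by (simp add: field_simps)
    then have "2 * R / a - 2 = (\<bar>C\<bar> / e + 1) / vol" unfolding R_def .
    then have "\<bar>C\<bar> / e + 1 = vol * (2 * R / a - 2)" using vol_pos by simp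
    also have "\<dots> \<le> vol * ((x + r - (x - r)) / a - 2)"
      using r a_pos vol_pos by (intro mult_left_mono diff_right_mono divide_right_mono) auto
    also have "\<dots> \<le> V" unfolding V_def by (rule measure_interval_ge)
    finally have V: "\<bar>C\<bar> / e + 1 \<le> V" .
    have "0 \<le> \<bar>C\<bar> / e" using e by simp
    then have Vp: "V > 0" using V by linarith
    have "\<bar>C\<bar> / e < V" using V by linarith
    then have Ve: "\<bar>C\<bar> < V * e" using e by (simp add: field_simps)
    have "(LINT y:{x - r..x + r}|M. F y) / of_real V - L = ((LINT y:{x - r..x + r}|M. F y) - L * of_real V) / of_real V"
      using Vp by (simp add: diff_divide_distrib)
    moreover have "norm ((LINT y:{x - r..x + r}|M. F y) - L * of_real V) \<le> C"
      unfolding V_def using r R by (intro assms) auto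
    ultimately have "norm ((LINT y:{x - r..x + r}|M. F y) / of_real V - L) \<le> C / V"
      using Vp by (simp add: norm_divide divide_right_mono)
    also have "\<dots> < e" using Ve Vp by (simp add: field_simps)
    finally show ?thesis by (simp add: V_def)
  qed
  then show "\<exists>R. \<forall>r\<ge>R. \<forall>x. norm ((LINT y:{x - r..x + r}|M. F y) / of_real (measure M {x - r..x + r}) - L) < e"
    by blast
qed

lemma norm_integral_diff_le:
  fixes F :: "real \<Rightarrow> complex"
  assumes F: "F \<in> borel_measurable borel" and B: "AE x in lborel. norm (F x) \<le> B"
    and E: "E \<in> sets borel" "emeasure M E < \<infinity>" "E' \<in> sets borel" "emeasure M E' < \<infinity>"
    and K: "K \<in> sets borel" "emeasure M K < \<infinity>" "K' \<in> sets borel" "emeasure M K' < \<infinity>"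
    and le: "\<And>x. \<bar>indicator E x - indicator E' x :: real\<bar> \<le> indicator K x + indicator K' x"
  shows "norm ((LINT x:E|M. F x) - (LINT x:E'|M. F x)) \<le> B * (measure M K + measure M K')"
proof -
  have FL: "F \<in> L_infinity lborel" using F B by (auto simp: L_infinity_def)
  note int = set_integrable_bounded[OF FL E(1,2), unfolded set_integrable_def]
    set_integrable_bounded[OF FL E(3,4), unfolded set_integrable_def]
  have "(LINT x:E|M. F x) - (LINT x:E'|M. F x) = (LINT x|M. (indicator E x - indicator E' x) *\<^sub>R F x)"
    unfolding set_lebesgue_integral_def using int by (simp add: scaleR_diff_left)
  also have "norm \<dots> \<le> (LINT x|M. norm ((indicator E x - indicator E' x) *\<^sub>R F x))"
    by (rule integral_norm_bound)
  also have "\<dots> \<le> (LINT x|M. B * (indicator K x + indicator K' x))"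
  proof (rule integral_mono_AE)
    have "integrable M (\<lambda>x. (indicator E x - indicator E' x) *\<^sub>R F x)" using int by (simp add: scaleR_diff_left)
    then show "integrable M (\<lambda>x. norm ((indicator E x - indicator E' x) *\<^sub>R F x))" by (rule integrable_norm)
    show "integrable M (\<lambda>x. B * (indicator K x + indicator K' x))"
      using integrable_indicator_M[OF K(1,2)] integrable_indicator_M[OF K(3,4)] by simp
    show "AE x in M. norm ((indicator E x - indicator E' x) *\<^sub>R F x) \<le> B * (indicator K x + indicator K' x)"
      using B unfolding AE_M_iff
    proof eventually_elim
      case (elim x)
      then have "\<bar>indicator E x - indicator E' x :: real\<bar> * norm (F x) \<le> (indicator K x + indicator K' x) * B"
        using le[of x] by (intro mult_mono) auto
      then show ?case by (simp add: mult.commute)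
    qed
  qed
  also have "\<dots> = B * (measure M K + measure M K')"
    using integrable_indicator_M[OF K(1,2)] integrable_indicator_M[OF K(3,4)] K by (simp add: sets_M)
  finally show ?thesis .
qed

lemma measure_period_le: "measure M {u..u + a} \<le> 3 * vol"
proof -
  define i where "i = \<lfloor>u / a\<rfloor>"
  have "u \<in> H i" by (simp add: mem_H i_def)
  then have sub: "{u..u + a} \<subseteq> H i \<union> (H (i + 1) \<union> H (i + 2))" by (auto simp: H_def algebra_simps)
  have "measure M {u..u + a} \<le> measure M (H i \<union> (H (i + 1) \<union> H (i + 2)))"
    using fin_H sub by (intro measure_mono_fmeasurable fmeasurable.Un fmeasurableI) (auto simp: sets_M)
  also have "\<dots> \<le> measure M (H i) + (measure M (H (i + 1)) + measure M (H (i + 2)))"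
    by (intro order_trans[OF measure_Un_le] add_left_mono measure_Un_le) (auto simp: sets_M)
  finally show ?thesis by (simp add: measure_H)
qed

text \<open>Moving the window by \<open>a\<close> multiplies the integral by
  \<open>\<omega>\<close>, but changes it only by two boundary pieces, each of measure at most
  \<open>3 * vol\<close>. Since \<open>\<omega> \<noteq> 1\<close>, the integrals over all windows
  are bounded.\<close>

lemma average_eigenfunction:
  fixes F :: "real \<Rightarrow> complex"
  assumes F: "F \<in> L_infinity lborel" and eig: "AE x in lborel. F (x + a) = \<omega> * F x" and \<omega>: "\<omega> \<noteq> 1"
  shows "has_infinite_volume_average M F 0"
proof -
  obtain B where Fm: "F \<in> borel_measurable borel" and B: "AE x in lborel. norm (F x) \<le> B"
    using F by (auto simp: L_infinity_def)
  have B': "AE x in lborel. norm (F x) \<le> \<bar>B\<bar>" using B by eventually_elim simp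
  show ?thesis
  proof (rule has_averageI[where C = "6 * vol * \<bar>B\<bar> / norm (1 - \<omega>)"])
    fix u v :: real assume uv: "u \<le> v"
    have "(LINT x:{u + a..v + a}|M. F x) = (LINT x|M. indicator {u + a..v + a} (x + a) *\<^sub>R F (x + a))"
      unfolding set_lebesgue_integral_def
      using integral_shift[of "\<lambda>x. indicator {u + a..v + a} x *\<^sub>R F x" 1] Fm by simp
    also have "\<dots> = (LINT x|M. \<omega> * (indicator {u..v} x *\<^sub>R F x))"
    proof (rule integral_cong_AE)
      show "AE x in M. indicator {u + a..v + a} (x + a) *\<^sub>R F (x + a) = \<omega> * (indicator {u..v} x *\<^sub>R F x)"
        using eig unfolding AE_M_iff by eventually_elim (simp add: indicator_def)
    qed (use Fm in \<open>auto intro!: measurable_M\<close>)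
    also have "\<dots> = \<omega> * (LINT x:{u..v}|M. F x)"
      by (simp only: set_lebesgue_integral_def integral_mult_right_zero)
    finally have "(1 - \<omega>) * (LINT x:{u..v}|M. F x) = (LINT x:{u..v}|M. F x) - (LINT x:{u + a..v + a}|M. F x)"
      by (simp add: algebra_simps)
    moreover have "norm ((LINT x:{u..v}|M. F x) - (LINT x:{u + a..v + a}|M. F x))
        \<le> \<bar>B\<bar> * (measure M {u..u + a} + measure M {v..v + a})"
      by (rule norm_integral_diff_le[OF Fm B']) (use uv a_pos fin_M in \<open>auto simp: indicator_def\<close>)
    moreover have "\<bar>B\<bar> * (measure M {u..u + a} + measure M {v..v + a}) \<le> \<bar>B\<bar> * (6 * vol)"
      using measure_period_le[of u] measure_period_le[of v] vol_pos by (intro mult_left_mono) auto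
    ultimately have "norm (1 - \<omega>) * norm (LINT x:{u..v}|M. F x) \<le> 6 * vol * \<bar>B\<bar>"
      by (simp add: norm_mult[symmetric] mult_ac)
    then show "norm ((LINT x:{u..v}|M. F x) - 0 * of_real (measure M {u..v})) \<le> 6 * vol * \<bar>B\<bar> / norm (1 - \<omega>)"
      using \<omega> by (simp add: field_simps)
  qed
qed

text \<open>Translates of the exceptional null set are null, and there are countably many of
  them.\<close>

lemma AE_periodic:
  fixes F :: "real \<Rightarrow> complex"
  assumes "AE x in lborel. F (x + a) = F x"
  shows "AE x in lborel. \<forall>j::int. F (x + a * real_of_int j) = F x"
proof -
  have "AE x in M. F (x + a * real_of_int j + a) = F (x + a * real_of_int j)" for j
  proof -
    have "AE x in distr M M (\<lambda>x. x + a * real_of_int j). F (x + a) = F x"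
      unfolding distr_shift_int AE_M_iff by (rule assms)
    from AE_distrD[OF meas_shift_int this] show ?thesis .
  qed
  then have "AE x in lborel. \<forall>j::int. F (x + a * real_of_int j + a) = F (x + a * real_of_int j)"
    unfolding AE_all_countable AE_M_iff by blast
  then show ?thesis
  proof eventually_elim
    case (elim x)
    show ?case
    proof
      fix j :: int
      show "F (x + a * real_of_int j) = F x"
      proof (induction j rule: int_induct[where k = 0])
        case (step1 i)
        then show ?case using elim[rule_format, of i] by (simp add: algebra_simps)
      next
        case (step2 i)
        then show ?case using elim[rule_format, of "i - 1"] by (simp add: algebra_simps)
      qed simp
    qed
  qed
qed

text \<open>All cells contribute the same integral. The incomplete cells at the ends cost at most
  \<open>2 * vol * \<bar>B\<bar>\<close> in the integral and as much again in the measure multiplied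
  by \<open>L\<close>, whence the constant 4.\<close>

lemma average_periodic:
  fixes F :: "real \<Rightarrow> complex"
  assumes F: "F \<in> L_infinity lborel" and per: "AE x in lborel. F (x + a) = F x"
  shows "has_infinite_volume_average M F ((LINT x:H 0|M. F x) / of_real vol)"
proof -
  obtain B where Fm: "F \<in> borel_measurable borel" and B: "AE x in lborel. norm (F x) \<le> B"
    using F by (auto simp: L_infinity_def)
  have B': "AE x in lborel. norm (F x) \<le> \<bar>B\<bar>" using B by eventually_elim simp
  define I0 where "I0 = (LINT x:H 0|M. F x)"
  define L where "L = I0 / of_real vol"
  have cell_int: "(LINT x:H j|M. F x) = I0" for j
  proof -
    have "(LINT x:H j|M. F x) = (LINT x|M. indicator (H j) (x + a * real_of_int j) *\<^sub>R F (x + a * real_of_int j))"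
      unfolding set_lebesgue_integral_def
      using integral_shift[of "\<lambda>x. indicator (H j) x *\<^sub>R F x" j] Fm by simp
    also have "\<dots> = (LINT x|M. indicator (H 0) x *\<^sub>R F x)"
    proof (rule integral_cong_AE)
      show "AE x in M. indicator (H j) (x + a * real_of_int j) *\<^sub>R F (x + a * real_of_int j) = indicator (H 0) x *\<^sub>R F x"
        using AE_periodic[OF per] unfolding AE_M_iff
        by eventually_elim (auto simp: indicator_def H_def algebra_simps)
    qed (use Fm in \<open>auto intro!: measurable_M\<close>)
    finally show ?thesis by (simp add: I0_def set_lebesgue_integral_def)
  qed
  have "norm I0 \<le> \<bar>B\<bar> * vol" unfolding I0_def vol_def by (rule norm_set_integral_le[OF B' Fm _ fin_H]) simp
  then have L: "norm L \<le> \<bar>B\<bar>" using vol_pos by (simp add: L_def norm_divide field_simps)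
  show ?thesis unfolding I0_def[symmetric] L_def[symmetric]
  proof (rule has_averageI[where C = "4 * vol * \<bar>B\<bar>"])
    fix u v :: real assume uv: "u \<le> v"
    define i where "i = \<lfloor>u / a\<rfloor>"
    define i' where "i' = \<lfloor>v / a\<rfloor>"
    note ic = interval_cells[OF uv, folded i_def i'_def]
    let ?E = "\<Union>j\<in>{i..<i'}. H j"
    have E: "?E \<in> sets borel" by auto
    have finE: "emeasure M ?E < \<infinity>"
    proof -
      have "emeasure M ?E \<le> emeasure M {a * real_of_int i .. a * real_of_int i'}"
        unfolding cells_union[OF ic(1)] by (intro emeasure_mono) (auto simp: sets_M)
      then show ?thesis using fin_M by (rule le_less_trans)
    qed
    have disj: "disjoint_family_on H {i..<i'}" by (auto simp: disjoint_family_on_def mem_H)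
    have intE: "(LINT x:?E|M. F x) = of_int (i' - i) * I0"
    proof -
      have "(LINT x:?E|M. F x) = (\<Sum>j\<in>{i..<i'}. (LINT x:H j|M. F x))"
        using disj fin_H by (intro set_integral_finite_Union set_integrable_bounded F) (auto simp: sets_M)
      also have "\<dots> = of_int (i' - i) * I0" using ic(1) by (simp add: cell_int)
      finally show ?thesis .
    qed
    have "measure M ?E = (\<Sum>j\<in>{i..<i'}. measure M (H j))"
      using fin_H disj by (intro measure_finite_Union) (auto simp: sets_M less_top)
    also have "\<dots> = vol * real_of_int (i' - i)" using ic(1) by (simp add: measure_H)
    finally have mE: "measure M ?E = vol * real_of_int (i' - i)" .
    have 1: "norm ((LINT x:{u..v}|M. F x) - (LINT x:?E|M. F x)) \<le> \<bar>B\<bar> * (measure M (H i) + measure M (H i'))"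
      by (rule norm_integral_diff_le[OF Fm B' _ fin_M E finE _ fin_H _ fin_H ic(2)]) auto
    have "norm ((LINT x:{u..v}|M. 1) - (LINT x:?E|M. 1 :: complex)) \<le> 1 * (measure M (H i) + measure M (H i'))"
      by (rule norm_integral_diff_le[OF _ _ _ fin_M E finE _ fin_H _ fin_H ic(2)]) auto
    moreover have "(LINT x:A|M. 1 :: complex) = of_real (measure M A)" if "A \<in> sets borel" "emeasure M A < \<infinity>" for A
      using that by (simp add: set_lebesgue_integral_def sets_M scaleR_conv_of_real)
    ultimately have "norm (of_real (measure M {u..v}) - of_real (measure M ?E) :: complex) \<le> 2 * vol"
      using E finE fin_M by (simp add: measure_H)
    then have 2: "norm (L * of_real (measure M ?E) - L * of_real (measure M {u..v})) \<le> \<bar>B\<bar> * (2 * vol)"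
      using L vol_pos unfolding right_diff_distrib[symmetric] norm_mult
      by (intro mult_mono) (auto simp: norm_minus_commute)
    have 3: "(LINT x:?E|M. F x) = L * of_real (measure M ?E)"
      using vol_pos unfolding intE mE by (simp add: L_def)
    have "norm ((LINT x:{u..v}|M. F x) - L * of_real (measure M {u..v}))
        \<le> norm ((LINT x:{u..v}|M. F x) - (LINT x:?E|M. F x)) + norm (L * of_real (measure M ?E) - L * of_real (measure M {u..v}))"
      using norm_triangle_ineq[of "(LINT x:{u..v}|M. F x) - (LINT x:?E|M. F x)" "L * of_real (measure M ?E) - L * of_real (measure M {u..v})"]
      by (simp add: 3)
    also have "\<dots> \<le> 4 * vol * \<bar>B\<bar>" using 1 2 by (simp add: measure_H algebra_simps)
    finally show "norm ((LINT x:{u..v}|M. F x) - L * of_real (measure M {u..v})) \<le> 4 * vol * \<bar>B\<bar>" .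
  qed
qed

text \<open>The difference lives on a bounded set, so its integrals over windows are bounded and its
  average is 0.\<close>

lemma has_average_eq_outside:
  fixes F G :: "real \<Rightarrow> complex"
  assumes F: "F \<in> L_infinity lborel" "G \<in> L_infinity lborel"
    and eq: "AE x in lborel. R < \<bar>x\<bar> \<longrightarrow> F x = G x" and avg: "has_infinite_volume_average M G L"
  shows "has_infinite_volume_average M F L"
proof -
  define D where "D x = F x + (- 1) * G x" for x
  have D: "D \<in> L_infinity lborel" unfolding D_def by (intro L_infinity_add F L_infinity_cmult)
  then obtain B where Dm: "D \<in> borel_measurable borel" and B: "AE x in lborel. norm (D x) \<le> B"
    by (auto simp: L_infinity_def)
  have B': "AE x in lborel. norm (D x) \<le> \<bar>B\<bar>" using B by eventually_elim simp
  have "has_infinite_volume_average M D 0"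
  proof (rule has_averageI[where C = "\<bar>B\<bar> * measure M {- R..R}"])
    fix u v :: real
    have "(LINT x:{u..v}|M. D x) = (LINT x:{u..v} \<inter> {- R..R}|M. D x)"
      unfolding set_lebesgue_integral_def
    proof (rule integral_cong_AE)
      show "AE x in M. indicator {u..v} x *\<^sub>R D x = indicator ({u..v} \<inter> {- R..R}) x *\<^sub>R D x"
        using eq unfolding AE_M_iff by eventually_elim (auto simp: indicator_def D_def)
    qed (use Dm in \<open>auto intro!: measurable_M\<close>)
    also have "norm \<dots> \<le> \<bar>B\<bar> * measure M ({u..v} \<inter> {- R..R})"
      by (rule norm_set_integral_le[OF B' Dm]) (auto simp: fin_M[unfolded infinity_ennreal_def])
    also have "\<dots> \<le> \<bar>B\<bar> * measure M {- R..R}"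
      using fin_M by (intro mult_left_mono measure_mono_fmeasurable) (auto simp: sets_M intro!: fmeasurableI)
    finally show "norm ((LINT x:{u..v}|M. D x) - 0 * of_real (measure M {u..v})) \<le> \<bar>B\<bar> * measure M {- R..R}" by simp
  qed
  from has_average_add[OF this avg D F(2)] show ?thesis by (simp add: D_def)
qed

end

section \<open>Lifts of circle maps\<close>

lemma complex_spanE:
  assumes "F \<in> complex_span S"
  obtains n :: nat and z f where "F = (\<lambda>x. \<Sum>i<n. z i * f i x)" "\<And>i. i < n \<Longrightarrow> f i \<in> S"
proof -
  have "\<exists>n z f. F = (\<lambda>x. \<Sum>i<n::nat. z i * f i x) \<and> (\<forall>i<n. f i \<in> S)"
    using assms unfolding complex_span_def by simp
  then obtain n z f where "F = (\<lambda>x. \<Sum>i<n::nat. z i * f i x)" "\<forall>i<n. f i \<in> S" by blast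
  then show ?thesis by (intro that[of z f n]) auto
qed

locale lift_averaging = periodic_averaging +
  fixes T :: "real \<Rightarrow> real"
  assumes T_meas[measurable]: "T \<in> borel \<rightarrow>\<^sub>M borel"
    and T_shift: "\<And>x. T (x + a) = T x + a"
    and circle: "preserves_measure (\<lambda>x. T x rmod a) (restrict_space M {0..<a})"
begin

lemma T_shift_int: "T (x + a * real_of_int j) = T x + a * real_of_int j"
proof (induction j rule: int_induct[where k = 0])
  case (step1 i)
  then show ?case using T_shift[of "x + a * i"] by (simp add: algebra_simps)
next
  case (step2 i)
  then show ?case using T_shift[of "x + a * real_of_int (i - 1)"] by (simp add: algebra_simps)
qed simp

lemma Tn_shift: "(T ^^ n) (x + a) = (T ^^ n) x + a"
  by (induction n) (auto simp: T_shift)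

lemma H0: "H 0 = {0..<a}"
  by (simp add: H_def)

lemma rmod_eq: "x rmod a = x + a * real_of_int (- \<lfloor>x / a\<rfloor>)"
  using a_pos by (simp add: rmod_def)

lemma measurable_rmod[measurable]: "(\<lambda>x. x rmod a) \<in> borel \<rightarrow>\<^sub>M borel"
  unfolding rmod_eq by measurable

lemma nn_integral_unfold:
  assumes [measurable]: "f \<in> borel_measurable borel"
  shows "(\<integral>\<^sup>+x. f x \<partial>M) = (\<integral>\<^sup>+j. (\<integral>\<^sup>+x. f (x + a * real_of_int j) * indicator (H 0) x \<partial>M) \<partial>count_space UNIV)"
proof -
  have mM: "g \<in> borel_measurable M" if "g \<in> borel_measurable borel" for g :: "real \<Rightarrow> ennreal"
    using that measurable_cong_sets[OF sets_M refl] by blast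
  have single: "(\<integral>\<^sup>+j. f x * indicator (H j) x \<partial>count_space UNIV) = f x" for x
  proof -
    have "(\<integral>\<^sup>+j. f x * indicator (H j) x \<partial>count_space UNIV) =
        (\<integral>\<^sup>+j. f x * indicator {\<lfloor>x / a\<rfloor>} j \<partial>count_space UNIV)"
      by (intro nn_integral_cong) (auto simp: indicator_def mem_H)
    also have "\<dots> = f x" by (subst nn_integral_cmult_indicator) auto
    finally show ?thesis .
  qed
  have "(\<integral>\<^sup>+x. f x \<partial>M) = (\<integral>\<^sup>+x. (\<integral>\<^sup>+j. f x * indicator (H j) x \<partial>count_space UNIV) \<partial>M)"
    by (simp only: single)
  also have "\<dots> = (\<integral>\<^sup>+j. (\<integral>\<^sup>+x. f x * indicator (H j) x \<partial>M) \<partial>count_space UNIV)"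
    by (intro nn_integral_count_space_nn_integral mM) auto
  also have "\<dots> = (\<integral>\<^sup>+j. (\<integral>\<^sup>+x. f (x + a * real_of_int j) * indicator (H 0) x \<partial>M) \<partial>count_space UNIV)"
  proof (rule nn_integral_cong)
    fix j :: int
    have "(\<integral>\<^sup>+x. f x * indicator (H j) x \<partial>M) =
        (\<integral>\<^sup>+x. f (x + a * real_of_int j) * indicator (H j) (x + a * real_of_int j) \<partial>M)"
      by (subst nn_integral_shift) auto
    also have "\<dots> = (\<integral>\<^sup>+x. f (x + a * real_of_int j) * indicator (H 0) x \<partial>M)"
      by (intro nn_integral_cong) (auto simp: indicator_def H_def algebra_simps)
    finally show "(\<integral>\<^sup>+x. f x * indicator (H j) x \<partial>M) = (\<integral>\<^sup>+x. f (x + a * real_of_int j) * indicator (H 0) x \<partial>M)" .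
  qed
  finally show ?thesis .
qed

text \<open>Summing \<open>f\<close> over all translates gives a function \<open>g\<close> on the
  circle. The summation is compatible with \<open>T\<close>, which commutes with translations, and
  the circle map preserves the integral of \<open>g\<close>; unfolding gives invariance on the
  line.\<close>

lemma nn_integral_T:
  assumes [measurable]: "f \<in> borel_measurable borel"
  shows "(\<integral>\<^sup>+x. f (T x) \<partial>M) = (\<integral>\<^sup>+x. f x \<partial>M)"
proof -
  have mM: "g \<in> borel_measurable M" if "g \<in> borel_measurable borel" for g :: "real \<Rightarrow> ennreal"
    using that measurable_cong_sets[OF sets_M refl] by blast
  define R where "R = restrict_space M {0..<a}"
  define g where "g y = (\<integral>\<^sup>+j. f (y + a * real_of_int j) \<partial>count_space UNIV)" for y
  have g[measurable]: "g \<in> borel_measurable borel"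
  proof -
    have "g = (\<lambda>y. \<Sum>i. f (y + a * real_of_int (int_decode i)))"
      unfolding g_def nn_integral_count_space_nat[symmetric]
      by (intro ext nn_integral_bij_count_space[symmetric, where f = "\<lambda>j. f (_ + a * real_of_int j)"] bij_int_decode)
    then show ?thesis by simp
  qed
  have per: "g (y rmod a) = g y" for y
  proof -
    have "g (y rmod a) = (\<integral>\<^sup>+j. f (y + a * real_of_int (j - \<lfloor>y / a\<rfloor>)) \<partial>count_space UNIV)"
      by (simp add: g_def rmod_eq algebra_simps)
    also have "\<dots> = g y" unfolding g_def
      by (rule nn_integral_bij_count_space[where f = "\<lambda>j. f (y + a * real_of_int j)"])
        (auto intro!: bij_betwI[where g = "\<lambda>j. j + \<lfloor>y / a\<rfloor>"])
    finally show ?thesis .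
  qed
  have RM: "(\<integral>\<^sup>+x. h x \<partial>R) = (\<integral>\<^sup>+x. h x * indicator (H 0) x \<partial>M)" for h
    unfolding R_def H0 by (rule nn_integral_restrict_space) (simp add: sets_M)
  have gR: "g \<in> borel_measurable R" unfolding R_def by (intro measurable_restrict_space1 mM g)
  have circ: "(\<lambda>x. T x rmod a) \<in> R \<rightarrow>\<^sub>M R" "distr R R (\<lambda>x. T x rmod a) = R"
    using circle by (auto simp: preserves_measure_def R_def)
  have swap: "(\<integral>\<^sup>+j. (\<integral>\<^sup>+x. f (h x + a * real_of_int j) * indicator (H 0) x \<partial>M) \<partial>count_space UNIV) =
      (\<integral>\<^sup>+x. g (h x) \<partial>R)" if [measurable]: "h \<in> borel \<rightarrow>\<^sub>M borel" for h
  proof -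
    have "(\<integral>\<^sup>+j. (\<integral>\<^sup>+x. f (h x + a * real_of_int j) * indicator (H 0) x \<partial>M) \<partial>count_space UNIV) =
        (\<integral>\<^sup>+x. (\<integral>\<^sup>+j. f (h x + a * real_of_int j) * indicator (H 0) x \<partial>count_space UNIV) \<partial>M)"
      by (intro nn_integral_count_space_nn_integral[symmetric] mM) auto
    also have "\<dots> = (\<integral>\<^sup>+x. g (h x) * indicator (H 0) x \<partial>M)"
      by (simp add: g_def nn_integral_multc)
    finally show ?thesis by (simp add: RM)
  qed
  have "(\<integral>\<^sup>+x. f (T x) \<partial>M) = (\<integral>\<^sup>+x. g (T x) \<partial>R)"
    using nn_integral_unfold[of "\<lambda>x. f (T x)"] swap[OF T_meas] by (simp add: T_shift_int)
  also have "\<dots> = (\<integral>\<^sup>+x. g (T x rmod a) \<partial>R)" by (simp only: per)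
  also have "\<dots> = (\<integral>\<^sup>+x. g x \<partial>distr R R (\<lambda>x. T x rmod a))"
    using gR by (subst nn_integral_distr[OF circ(1)]) auto
  also have "\<dots> = (\<integral>\<^sup>+x. g x \<partial>R)" by (simp only: circ(2))
  also have "\<dots> = (\<integral>\<^sup>+x. f x \<partial>M)" using nn_integral_unfold[of f] swap[of "\<lambda>x. x"] by simp
  finally show ?thesis .
qed

lemma emeasure_vimage_T: "A \<in> sets borel \<Longrightarrow> emeasure M (T -` A) = emeasure M A"
proof -
  assume A: "A \<in> sets borel"
  have "T -` A \<in> sets borel" using measurable_sets[OF T_meas A] by simp
  moreover have "indicator A (T x) = (indicator (T -` A) x :: ennreal)" for x by (simp add: indicator_def)
  ultimately show ?thesis using nn_integral_T[of "indicator A"] A by (simp add: sets_M)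
qed

lemma Tn_meas[measurable]: "T ^^ n \<in> borel \<rightarrow>\<^sub>M borel"
  by simp

lemma AE_T: "AE x in lborel. P x \<Longrightarrow> AE x in lborel. P (T x)"
proof -
  assume "AE x in lborel. P x"
  then obtain A where A: "A \<in> null_sets lborel" "{x. \<not> P x} \<subseteq> A"
    by (auto simp: eventually_ae_filter)
  then have Ab: "A \<in> sets borel" by (simp add: null_sets_def)
  have "A \<in> null_sets M" using A(1) by (simp add: null_M)
  then have "emeasure M (T -` A) = 0" using emeasure_vimage_T[OF Ab] by (simp add: null_sets_def)
  then have "T -` A \<in> null_sets M" using measurable_sets[OF T_meas Ab] by (simp add: null_sets_def sets_M)
  then have "T -` A \<in> null_sets lborel" by (simp only: null_M)
  from AE_not_in[OF this] show ?thesis by eventually_elim (use A(2) in auto)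
qed

lemma AE_Tn: "AE x in lborel. P x \<Longrightarrow> AE x in lborel. P ((T ^^ n) x)"
proof (induction n)
  case (Suc n)
  then have "AE x in lborel. P ((T ^^ n) (T x))" by (intro AE_T[of "\<lambda>x. P ((T ^^ n) x)"]) simp
  then show ?case by (simp only: funpow_Suc_right o_apply)
qed simp

lemma L_infinity_Tn: "F \<in> L_infinity lborel \<Longrightarrow> (\<lambda>x. F ((T ^^ n) x)) \<in> L_infinity lborel"
proof -
  assume "F \<in> L_infinity lborel"
  then obtain B where [measurable]: "F \<in> borel_measurable borel" and B: "AE x in lborel. norm (F x) \<le> B"
    by (auto simp: L_infinity_def)
  have "(\<lambda>x. F ((T ^^ n) x)) \<in> borel_measurable lborel" by simp
  then show ?thesis using AE_Tn[OF B] unfolding L_infinity_def by blast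
qed

text \<open>A periodic function lives on the circle: reducing \<open>T x\<close> modulo
  \<open>a\<close> does not change its value almost everywhere, and the circle map preserves the
  measure.\<close>

lemma set_integral_periodic_T:
  fixes F :: "real \<Rightarrow> complex"
  assumes F[measurable]: "F \<in> borel_measurable borel" and per: "AE x in lborel. F (x + a) = F x"
  shows "(LINT x:H 0|M. F (T x)) = (LINT x:H 0|M. F x)"
proof -
  define R where "R = restrict_space M {0..<a}"
  have circ: "(\<lambda>x. T x rmod a) \<in> R \<rightarrow>\<^sub>M R" "distr R R (\<lambda>x. T x rmod a) = R"
    using circle by (auto simp: preserves_measure_def R_def)
  have RM: "(LINT x|R. h x) = (LINT x:H 0|M. h x)" for h :: "real \<Rightarrow> complex"
    unfolding R_def H0 set_lebesgue_integral_def by (rule integral_restrict_space) (simp add: sets_M)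
  have FR: "F \<in> borel_measurable R" unfolding R_def by (intro measurable_restrict_space1 measurable_M F)
  have "AE x in lborel. F (x rmod a) = F x"
    using AE_periodic[OF per] unfolding rmod_eq by eventually_elim blast
  then have e: "AE x in lborel. F (T x rmod a) = F (T x)" by (rule AE_T)
  have "(LINT x:H 0|M. F (T x)) = (LINT x:H 0|M. F (T x rmod a))"
    unfolding set_lebesgue_integral_def
  proof (rule integral_cong_AE)
    show "AE x in M. indicator (H 0) x *\<^sub>R F (T x) = indicator (H 0) x *\<^sub>R F (T x rmod a)"
      using e unfolding AE_M_iff by eventually_elim simp
  qed (intro measurable_M, measurable)+
  also have "\<dots> = (LINT x|R. F (T x rmod a))" by (simp only: RM)
  also have "\<dots> = (LINT x|distr R R (\<lambda>x. T x rmod a). F x)"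
    by (rule integral_distr[OF circ(1) FR, symmetric])
  also have "\<dots> = (LINT x:H 0|M. F x)" by (simp only: circ(2) RM)
  finally show ?thesis .
qed

lemma AE_eigen_Tn:
  assumes "AE x in lborel. F (x + a) = \<omega> * F x"
  shows "AE x in lborel. F ((T ^^ n) (x + a)) = \<omega> * F ((T ^^ n) x)"
  using AE_Tn[OF assms, of n] by (simp add: Tn_shift)

lemma set_integral_periodic_Tn:
  fixes F :: "real \<Rightarrow> complex"
  assumes F: "F \<in> borel_measurable borel" and per: "AE x in lborel. F (x + a) = F x"
  shows "(LINT x:H 0|M. F ((T ^^ n) x)) = (LINT x:H 0|M. F x)"
proof (induction n)
  case (Suc n)
  have m: "(\<lambda>x. F ((T ^^ n) x)) \<in> borel_measurable borel"
    using F Tn_meas[of n] by measurable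
  have "AE x in lborel. F ((T ^^ n) (x + a)) = F ((T ^^ n) x)" using AE_eigen_Tn[of F 1 n] per by simp
  from set_integral_periodic_T[OF m this] Suc show ?case
    by (simp only: funpow_Suc_right o_apply)
qed simp

end

section \<open>Correlations of global observables under the lift\<close>

locale mixing_lift = lift_averaging +
  assumes mix: "\<And>(F :: real \<Rightarrow> complex) g. F \<in> L_infinity lborel \<Longrightarrow> integrable M g \<Longrightarrow> (LINT x|M. g x) = 0 \<Longrightarrow>
    (\<lambda>n. LINT x|M. F ((T ^^ n) x) * g x) \<longlonglongrightarrow> 0"
begin

definition eigenfunction :: "(real \<Rightarrow> complex) \<Rightarrow> complex \<Rightarrow> bool" where
  "eigenfunction F \<omega> \<longleftrightarrow> F \<in> L_infinity lborel \<and> (AE x in lborel. F (x + a) = \<omega> * F x)"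

lemma eigenfunction_average: "eigenfunction F \<omega> \<Longrightarrow> average_exists M F"
  using average_eigenfunction[of F \<omega>] average_periodic[of F]
  by (cases "\<omega> = 1") (auto simp: eigenfunction_def average_exists_def)

lemma integrable_cell:
  assumes "G \<in> L_infinity lborel"
  shows "integrable M (\<lambda>x. indicator (H 0) x *\<^sub>R G x)"
  using set_integrable_bounded[OF assms sets_H fin_H] by (simp add: set_integrable_def)

text \<open>For a nontrivial eigenvalue the correlation is tested against the difference of a local
  function and its translate, which has mean zero.\<close>

lemma eigenfunction_mixing:
  assumes F: "eigenfunction F \<omega>" and G: "eigenfunction G \<omega>'"
  shows "\<exists>h. (\<forall>n. has_infinite_volume_average M (\<lambda>x. F ((T ^^ n) x) * G x) (h n)) \<and>
    h \<longlonglongrightarrow> average M F * average M G"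
proof -
  have FL: "F \<in> L_infinity lborel" and GL: "G \<in> L_infinity lborel"
    and Fe: "AE x in lborel. F (x + a) = \<omega> * F x" and Ge: "AE x in lborel. G (x + a) = \<omega>' * G x"
    using F G by (auto simp: eigenfunction_def)
  have [measurable]: "F \<in> borel_measurable borel" "G \<in> borel_measurable borel"
    using FL GL by (auto simp: L_infinity_def)
  define P where "P n x = F ((T ^^ n) x) * G x" for n x
  have P_eq: "P n = (\<lambda>x. F ((T ^^ n) x) * G x)" for n by (simp add: P_def fun_eq_iff)
  have PL: "P n \<in> L_infinity lborel" for n
    unfolding P_eq by (intro L_infinity_mult L_infinity_Tn FL GL)
  have Pe: "AE x in lborel. P n (x + a) = \<omega> * \<omega>' * P n x" for n
    using AE_eigen_Tn[OF Fe, of n] Ge unfolding P_def by eventually_elim simp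
  show ?thesis
  proof (cases "\<omega> * \<omega>' = 1")
    \<comment> \<open>The product has the eigenvalue \<open>\<omega> * \<omega>'\<close>, different
      from 1, and so has average 0 for every \<open>n\<close>. At least one factor has a nontrivial
      eigenvalue too, so the product of the averages is 0.\<close>
    case False
    then have "average M F * average M G = 0"
      using average_eq[OF average_eigenfunction[OF FL Fe]] average_eq[OF average_eigenfunction[OF GL Ge]]
      by (cases "\<omega> = 1") auto
    moreover have "has_infinite_volume_average M (P n) 0" for n
      by (rule average_eigenfunction[OF PL Pe False])
    ultimately show ?thesis unfolding P_eq by (intro exI[of _ "\<lambda>_. 0"]) auto
  next
    case True
    define g where "g x = indicator (H 0) x *\<^sub>R G x" for x
    have gm[measurable]: "g \<in> borel_measurable borel" unfolding g_def by measurable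
    have gi: "integrable M g" unfolding g_def by (rule integrable_cell[OF GL])
    \<comment> \<open>The product is periodic, so its average is an integral over one period, that
      is, a correlation of \<open>F\<close> with the integrable function \<open>g\<close>.\<close>
    have avg: "has_infinite_volume_average M (P n) ((LINT x|M. F ((T ^^ n) x) * g x) / of_real vol)" for n
    proof -
      have "AE x in lborel. P n (x + a) = P n x" using Pe[of n] by (simp add: True)
      from average_periodic[OF PL this] show ?thesis
        by (simp add: P_eq g_def set_lebesgue_integral_def)
    qed
    have "(\<lambda>n. (LINT x|M. F ((T ^^ n) x) * g x) / of_real vol) \<longlonglongrightarrow> average M F * average M G"
    proof (cases "\<omega> = 1")
      case w1: False
      \<comment> \<open>Pairing with \<open>v\<close> gives \<open>1 - \<omega>\<close> times the
        pairing with \<open>g\<close>; division by this nonzero factor gives the limit 0 whatever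
        the mean of \<open>g\<close>.\<close>
      define v where "v x = g x - g (x - a)" for x
      have gi': "integrable M (\<lambda>x. g (x + a * real_of_int j))" for j
      proof -
        have "integrable (distr M M (\<lambda>x. x + a * real_of_int j)) g" by (simp only: distr_shift_int gi)
        from integrable_distr[OF meas_shift_int this] show ?thesis .
      qed
      have gs: "integrable M (\<lambda>x. g (x - a))" using gi'[of "-1"] by simp
      have "(LINT x|M. v x) = 0"
        unfolding v_def using gi gs integral_shift[OF gm, of "-1"] by simp
      moreover have vi: "integrable M v" unfolding v_def using gi gs by simp
      ultimately have lim: "(\<lambda>n. LINT x|M. F ((T ^^ n) x) * v x) \<longlonglongrightarrow> 0" using mix[OF FL] by blast
      have Fint: "integrable M (\<lambda>x. F ((T ^^ n) x) * w x)" if w: "integrable M w" for n and w :: "real \<Rightarrow> complex"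
      proof -
        obtain B where B: "AE x in lborel. norm (F ((T ^^ n) x)) \<le> B"
          using L_infinity_Tn[OF FL, of n] by (auto simp: L_infinity_def)
        show ?thesis
        proof (rule Bochner_Integration.integrable_bound[of M "\<lambda>x. B * norm (w x)"])
          show "AE x in M. norm (F ((T ^^ n) x) * w x) \<le> norm (B * norm (w x))"
            using B unfolding AE_M_iff
            by eventually_elim (auto simp: norm_mult abs_mult intro!: mult_right_mono)
          have "(\<lambda>x. F ((T ^^ n) x)) \<in> borel_measurable M" by (intro measurable_M) measurable
          then show "(\<lambda>x. F ((T ^^ n) x) * w x) \<in> borel_measurable M"
            by (rule borel_measurable_times) (use w in auto)
          show "integrable M (\<lambda>x. B * norm (w x))" using w by (intro integrable_mult_right integrable_norm)
        qed
      qed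
      have "(LINT x|M. F ((T ^^ n) x) * v x) = (1 - \<omega>) * (LINT x|M. F ((T ^^ n) x) * g x)" for n
      proof -
        have "(LINT x|M. F ((T ^^ n) x) * g (x - a)) = (LINT x|M. F ((T ^^ n) (x + a)) * g x)"
          using integral_shift[of "\<lambda>x. F ((T ^^ n) x) * g (x - a)" 1] by simp
        also have "\<dots> = (LINT x|M. \<omega> * (F ((T ^^ n) x) * g x))"
        proof (rule integral_cong_AE)
          show "AE x in M. F ((T ^^ n) (x + a)) * g x = \<omega> * (F ((T ^^ n) x) * g x)"
            using AE_eigen_Tn[OF Fe, of n] unfolding AE_M_iff by eventually_elim simp
        qed (intro measurable_M, measurable)+
        also have "\<dots> = \<omega> * (LINT x|M. F ((T ^^ n) x) * g x)" by simp
        finally show ?thesis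
          using Fint[OF gi, of n] Fint[OF gs, of n] by (simp add: v_def right_diff_distrib left_diff_distrib)
      qed
      then have "(\<lambda>n. (1 - \<omega>) * (LINT x|M. F ((T ^^ n) x) * g x) / (1 - \<omega>) / of_real vol) \<longlonglongrightarrow> 0 / (1 - \<omega>) / of_real vol"
        using lim vol_pos w1 by (intro tendsto_divide tendsto_const) auto
      moreover have "average M F = 0" by (rule average_eq[OF average_eigenfunction[OF FL Fe w1]])
      moreover have "(1 - \<omega>) * x / (1 - \<omega>) = x" for x using w1 by simp
      ultimately show ?thesis by (simp only: div_0 mult_zero_left)
    next
      case w1: True
      then have w'1: "\<omega>' = 1" using True by simp
      have Fp: "AE x in lborel. F (x + a) = F x" and Gp: "AE x in lborel. G (x + a) = G x"
        using Fe Ge by (simp_all add: w1 w'1)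
      \<comment> \<open>A multiple of the indicator of the cell takes away the mean of
        \<open>g\<close>. Its own pairing with \<open>F\<close> is the same for all
        \<open>n\<close>, by invariance of the circle measure, and produces the product of the
        averages.\<close>
      define c where "c = (LINT x|M. g x) / of_real vol"
      define v where "v x = g x - indicator (H 0) x *\<^sub>R c" for x
      have ii: "integrable M (\<lambda>x. indicator (H 0) x *\<^sub>R c)"
        by (rule integrable_cell[OF L_infinity_const])
      have "(LINT x|M. indicator (H 0) x *\<^sub>R c) = of_real vol * c"
        using integral_scaleR_left[OF integrable_indicator_M[OF sets_H[of 0] fin_H], of c] sets_H[of 0]
        by (simp add: sets_M vol_def scaleR_conv_of_real)
      then have "(LINT x|M. v x) = 0"
        unfolding v_def using gi ii vol_pos by (simp add: c_def)
      moreover have vi: "integrable M v" unfolding v_def using gi ii by simp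
      ultimately have lim: "(\<lambda>n. LINT x|M. F ((T ^^ n) x) * v x) \<longlonglongrightarrow> 0" using mix[OF FL] by blast
      have eq: "(LINT x|M. F ((T ^^ n) x) * g x) = (LINT x|M. F ((T ^^ n) x) * v x) + c * (LINT x:H 0|M. F x)" for n
      proof -
        have i1: "integrable M (\<lambda>x. F ((T ^^ n) x) * g x)"
          using integrable_cell[OF PL[of n]] by (simp add: P_eq g_def)
        have i2: "integrable M (\<lambda>x. c * (indicator (H 0) x *\<^sub>R F ((T ^^ n) x)))"
          using integrable_cell[OF L_infinity_Tn[OF FL, of n]] by (rule integrable_mult_right)
        have "(LINT x|M. F ((T ^^ n) x) * v x) = (LINT x|M. F ((T ^^ n) x) * g x - c * (indicator (H 0) x *\<^sub>R F ((T ^^ n) x)))"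
          by (intro Bochner_Integration.integral_cong refl) (auto simp: v_def algebra_simps indicator_def)
        also have "\<dots> = (LINT x|M. F ((T ^^ n) x) * g x) - c * (LINT x:H 0|M. F ((T ^^ n) x))"
          by (simp only: set_lebesgue_integral_def Bochner_Integration.integral_diff[OF i1 i2] integral_mult_right_zero)
        also have "(LINT x:H 0|M. F ((T ^^ n) x)) = (LINT x:H 0|M. F x)"
          by (rule set_integral_periodic_Tn[OF _ Fp]) simp
        finally show ?thesis by simp
      qed
      have "(\<lambda>n. ((LINT x|M. F ((T ^^ n) x) * v x) + c * (LINT x:H 0|M. F x)) / of_real vol)
          \<longlonglongrightarrow> (0 + c * (LINT x:H 0|M. F x)) / of_real vol"
        using lim vol_pos by (intro tendsto_intros) auto
      moreover have "average M F = (LINT x:H 0|M. F x) / of_real vol"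
        by (rule average_eq[OF average_periodic[OF FL Fp]])
      moreover have "average M G = c"
        using average_eq[OF average_periodic[OF GL Gp]] by (simp add: c_def g_def set_lebesgue_integral_def)
      ultimately show ?thesis unfolding eq by (simp add: mult.commute[of c])
    qed
    then show ?thesis using avg unfolding P_eq
      by (intro exI[of _ "\<lambda>n. (LINT x|M. F ((T ^^ n) x) * g x) / of_real vol"]) auto
  qed
qed

lemma translation_eigenfunction: "F \<in> translation_eigenfunctions a \<Longrightarrow> \<exists>\<omega>. eigenfunction F \<omega>"
  by (auto simp: translation_eigenfunctions_def eigenfunction_def)

lemma span_average:
  assumes "F \<in> complex_span (translation_eigenfunctions a)"
  shows "F \<in> L_infinity lborel" "average_exists M F"
proof -
  obtain n :: nat and z f where F: "F = (\<lambda>x. \<Sum>i<n. z i * f i x)"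
    and f: "\<And>i. i < n \<Longrightarrow> f i \<in> translation_eigenfunctions a"
    by (rule complex_spanE[OF assms]) (rule that)
  have fi: "f i \<in> L_infinity lborel" "has_infinite_volume_average M (f i) (average M (f i))" if "i < n" for i
    using translation_eigenfunction[OF f[OF that]] eigenfunction_average has_average
    by (auto simp: eigenfunction_def)
  show "F \<in> L_infinity lborel" unfolding F by (intro L_infinity_sum L_infinity_cmult fi) auto
  have "has_infinite_volume_average M F (\<Sum>i<n. z i * average M (f i))"
    unfolding F by (intro has_average_sum has_average_cmult L_infinity_cmult fi) auto
  then show "average_exists M F" by (auto simp: average_exists_def)
qed

lemma span_mixing:
  assumes "F \<in> complex_span (translation_eigenfunctions a)" "G \<in> complex_span (translation_eigenfunctions a)"
  shows "\<exists>h. (\<forall>n. has_infinite_volume_average M (\<lambda>x. F ((T ^^ n) x) * G x) (h n)) \<and>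
    h \<longlonglongrightarrow> average M F * average M G"
proof -
  obtain n :: nat and z f where F: "F = (\<lambda>x. \<Sum>i<n. z i * f i x)"
    and f: "\<And>i. i < n \<Longrightarrow> f i \<in> translation_eigenfunctions a"
    by (rule complex_spanE[OF assms(1)]) (rule that)
  obtain m :: nat and w g where G: "G = (\<lambda>x. \<Sum>j<m. w j * g j x)"
    and g: "\<And>j. j < m \<Longrightarrow> g j \<in> translation_eigenfunctions a"
    by (rule complex_spanE[OF assms(2)]) (rule that)
  have fi: "f i \<in> L_infinity lborel" "has_infinite_volume_average M (f i) (average M (f i))" if "i < n" for i
    using translation_eigenfunction[OF f[OF that]] eigenfunction_average has_average
    by (auto simp: eigenfunction_def)
  have gj: "g j \<in> L_infinity lborel" "has_infinite_volume_average M (g j) (average M (g j))" if "j < m" for j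
    using translation_eigenfunction[OF g[OF that]] eigenfunction_average has_average
    by (auto simp: eigenfunction_def)
  have "\<exists>h. (\<forall>r. has_infinite_volume_average M (\<lambda>x. f i ((T ^^ r) x) * g j x) (h r)) \<and>
      h \<longlonglongrightarrow> average M (f i) * average M (g j)" if ij: "i < n" "j < m" for i j
  proof -
    obtain \<omega> \<omega>' where "eigenfunction (f i) \<omega>" "eigenfunction (g j) \<omega>'"
      using translation_eigenfunction[OF f[OF ij(1)]] translation_eigenfunction[OF g[OF ij(2)]] by blast
    then show ?thesis by (rule eigenfunction_mixing)
  qed
  then obtain h where h: "\<And>i j r. i < n \<Longrightarrow> j < m \<Longrightarrow> has_infinite_volume_average M (\<lambda>x. f i ((T ^^ r) x) * g j x) (h i j r)"
    "\<And>i j. i < n \<Longrightarrow> j < m \<Longrightarrow> h i j \<longlonglongrightarrow> average M (f i) * average M (g j)" by metis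
  define k where "k r = (\<Sum>i<n. \<Sum>j<m. z i * w j * h i j r)" for r
  have FG: "F ((T ^^ r) x) * G x = (\<Sum>i<n. \<Sum>j<m. z i * w j * (f i ((T ^^ r) x) * g j x))" for r x
    unfolding F G sum_product by (intro sum.cong refl) (simp add: mult_ac)
  have 1: "has_infinite_volume_average M (\<lambda>x. F ((T ^^ r) x) * G x) (k r)" for r
    unfolding FG k_def
    by (intro has_average_sum has_average_cmult h L_infinity_sum L_infinity_cmult L_infinity_mult L_infinity_Tn fi gj) auto
  have "average M F = (\<Sum>i<n. z i * average M (f i))"
    unfolding F by (intro average_eq has_average_sum has_average_cmult L_infinity_cmult fi) auto
  moreover have "average M G = (\<Sum>j<m. w j * average M (g j))"
    unfolding G by (intro average_eq has_average_sum has_average_cmult L_infinity_cmult gj) auto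
  ultimately have "average M F * average M G = (\<Sum>i<n. z i * average M (f i)) * (\<Sum>j<m. w j * average M (g j))"
    by simp
  also have "\<dots> = (\<Sum>i<n. \<Sum>j<m. z i * w j * (average M (f i) * average M (g j)))"
    unfolding sum_product by (intro sum.cong refl) (simp add: mult_ac)
  finally have "average M F * average M G = (\<Sum>i<n. \<Sum>j<m. z i * w j * (average M (f i) * average M (g j)))" .
  moreover have "k \<longlonglongrightarrow> (\<Sum>i<n. \<Sum>j<m. z i * w j * (average M (f i) * average M (g j)))"
    unfolding k_def by (intro tendsto_sum tendsto_mult tendsto_const h) auto
  ultimately show ?thesis using 1 by metis
qed

lemma G2_average:
  assumes "F \<in> G2 a"
  shows "F \<in> L_infinity lborel" "average_exists M F"
proof -
  show F: "F \<in> L_infinity lborel" using assms by (simp add: G2_def L_infinity_closure_def)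
  show "average_exists M F"
  proof (rule average_exists_limit[OF F])
    fix e :: real assume "e > 0"
    then obtain K where "K \<in> complex_span (translation_eigenfunctions a)" "AE x in lborel. norm (F x - K x) \<le> e"
      using assms by (auto simp: G2_def L_infinity_closure_def)
    then show "\<exists>G\<in>L_infinity lborel. average_exists M G \<and> (AE x in lborel. norm (F x - G x) \<le> e)"
      using span_average by blast
  qed
qed

text \<open>Composition with \<open>T ^^ n\<close> does not increase the essential supremum. The
  averages \<open>h n\<close> and their approximations \<open>k n\<close> therefore stay within
  \<open>C * d\<close> of each other for all \<open>n\<close> simultaneously, and the limit in
  \<open>n\<close> passes from sums of eigenfunctions to their closure.\<close>

lemma G2_mixing:
  assumes F: "F \<in> G2 a" and G: "G \<in> G2 a"
  shows "\<exists>h. (\<forall>n. has_infinite_volume_average M (\<lambda>x. F ((T ^^ n) x) * G x) (h n)) \<and>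
    h \<longlonglongrightarrow> average M F * average M G"
proof -
  note FL = G2_average(1)[OF F] and GL = G2_average(1)[OF G]
  obtain B where "AE x in lborel. norm (F x) \<le> B" using FL by (auto simp: L_infinity_def)
  then have FB: "AE x in lborel. norm (F x) \<le> \<bar>B\<bar>" by eventually_elim simp
  obtain B' where "AE x in lborel. norm (G x) \<le> B'" using GL by (auto simp: L_infinity_def)
  then have GB: "AE x in lborel. norm (G x) \<le> \<bar>B'\<bar>" by eventually_elim simp
  \<comment> \<open>From \<open>f * g - f' * g' = f * (g - g') + (f - f') * g'\<close>, where
    \<open>g'\<close> is bounded by \<open>\<bar>B'\<bar> + 1\<close> as long as the approximation
    error is at most 1.\<close>
  define C where "C = \<bar>B\<bar> + \<bar>B'\<bar> + 1"
  have C: "C \<ge> 1" by (simp add: C_def)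
  have PL: "(\<lambda>x. F ((T ^^ n) x) * G x) \<in> L_infinity lborel" for n
    by (intro L_infinity_mult L_infinity_Tn FL GL)
  have approx: "\<exists>F'\<in>complex_span (translation_eigenfunctions a). \<exists>G'\<in>complex_span (translation_eigenfunctions a).
      (AE x in lborel. norm (F x - F' x) \<le> e) \<and> (AE x in lborel. norm (G x - G' x) \<le> e) \<and>
      (\<forall>n. AE x in lborel. norm (F ((T ^^ n) x) * G x - F' ((T ^^ n) x) * G' x) \<le> C * e)"
    if e: "0 < e" "e \<le> 1" for e
  proof -
    obtain F' where F': "F' \<in> complex_span (translation_eigenfunctions a)" "AE x in lborel. norm (F x - F' x) \<le> e"
      using F e by (auto simp: G2_def L_infinity_closure_def)
    obtain G' where G': "G' \<in> complex_span (translation_eigenfunctions a)" "AE x in lborel. norm (G x - G' x) \<le> e"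
      using G e by (auto simp: G2_def L_infinity_closure_def)
    have "AE x in lborel. norm (F ((T ^^ n) x) * G x - F' ((T ^^ n) x) * G' x) \<le> C * e" for n
      using AE_Tn[OF F'(2), of n] G'(2) AE_Tn[OF FB, of n] GB
    proof eventually_elim
      case (elim x)
      let ?f = "F ((T ^^ n) x)" and ?f' = "F' ((T ^^ n) x)"
      have "norm (G' x) \<le> norm (G x) + norm (G x - G' x)"
        using norm_triangle_ineq2[of "G' x" "G x"] by (simp add: norm_minus_commute)
      then have g': "norm (G' x) \<le> \<bar>B'\<bar> + 1" using elim e by linarith
      have "?f * G x - ?f' * G' x = ?f * (G x - G' x) + (?f - ?f') * G' x" by (simp add: algebra_simps)
      then have "norm (?f * G x - ?f' * G' x) \<le> norm ?f * norm (G x - G' x) + norm (?f - ?f') * norm (G' x)"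
        using norm_triangle_ineq[of "?f * (G x - G' x)" "(?f - ?f') * G' x"] by (simp add: norm_mult)
      also have "\<dots> \<le> \<bar>B\<bar> * e + e * (\<bar>B'\<bar> + 1)"
        using elim g' e by (intro add_mono mult_mono) auto
      also have "\<dots> = C * e" by (simp add: C_def algebra_simps)
      finally show ?case .
    qed
    then show ?thesis using F' G' by blast
  qed
  have ex: "average_exists M (\<lambda>x. F ((T ^^ n) x) * G x)" for n
  proof (rule average_exists_limit[OF PL])
    fix e :: real assume e: "e > 0"
    define d where "d = min 1 (e / C)"
    have d: "0 < d" "d \<le> 1" "C * d \<le> e" using e C by (auto simp: d_def min_def field_simps)
    obtain F' G' where FG: "F' \<in> complex_span (translation_eigenfunctions a)" "G' \<in> complex_span (translation_eigenfunctions a)"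
      "AE x in lborel. norm (F ((T ^^ n) x) * G x - F' ((T ^^ n) x) * G' x) \<le> C * d"
      using approx[OF d(1,2)] by blast
    have "average_exists M (\<lambda>x. F' ((T ^^ n) x) * G' x)"
      using span_mixing[OF FG(1,2)] by (auto simp: average_exists_def)
    moreover have "(\<lambda>x. F' ((T ^^ n) x) * G' x) \<in> L_infinity lborel"
      by (intro L_infinity_mult L_infinity_Tn span_average FG)
    moreover have "AE x in lborel. norm (F ((T ^^ n) x) * G x - F' ((T ^^ n) x) * G' x) \<le> e"
      using FG(3) by eventually_elim (use d in auto)
    ultimately show "\<exists>K\<in>L_infinity lborel. average_exists M K \<and> (AE x in lborel. norm (F ((T ^^ n) x) * G x - K x) \<le> e)"
      by blast
  qed
  define h where "h n = average M (\<lambda>x. F ((T ^^ n) x) * G x)" for n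
  have hn: "has_infinite_volume_average M (\<lambda>x. F ((T ^^ n) x) * G x) (h n)" for n
    unfolding h_def by (rule has_average[OF ex])
  define A where "A = average M F"
  define A' where "A' = average M G"
  have FA: "has_infinite_volume_average M F A" and GA: "has_infinite_volume_average M G A'"
    unfolding A_def A'_def by (intro has_average G2_average F G)+
  \<comment> \<open>\<open>C\<close> accounts for the error of the correlations, the other terms for
    the error of the product of averages.\<close>
  define D where "D = C + norm A + norm A' + 1"
  have D: "D > 0" using C by (simp add: D_def add_pos_nonneg)
  have "h \<longlonglongrightarrow> A * A'"
  proof (rule LIMSEQ_I)
    fix e :: real assume e: "0 < e"
    define d where "d = min 1 (e / (2 * D))"
    have d: "0 < d" "d \<le> 1" "D * d \<le> e / 2" using e D by (auto simp: d_def min_def field_simps)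
    obtain F' G' where FG: "F' \<in> complex_span (translation_eigenfunctions a)" "G' \<in> complex_span (translation_eigenfunctions a)"
      "AE x in lborel. norm (F x - F' x) \<le> d" "AE x in lborel. norm (G x - G' x) \<le> d"
      "\<And>n. AE x in lborel. norm (F ((T ^^ n) x) * G x - F' ((T ^^ n) x) * G' x) \<le> C * d"
      using approx[OF d(1,2)] by blast
    obtain k where k: "\<And>n. has_infinite_volume_average M (\<lambda>x. F' ((T ^^ n) x) * G' x) (k n)"
      "k \<longlonglongrightarrow> average M F' * average M G'"
      using span_mixing[OF FG(1,2)] by blast
    note FG' = span_average[OF FG(1)] span_average[OF FG(2)]
    have hk: "norm (h n - k n) \<le> C * d" for n
      using d C by (intro average_diff_le[OF PL _ FG(5) _ hn k(1)] L_infinity_mult L_infinity_Tn FG') auto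
    have a1: "norm (A - average M F') \<le> d"
      using d by (intro average_diff_le[OF FL FG'(1) FG(3) _ FA has_average[OF FG'(2)]]) auto
    have a2: "norm (A' - average M G') \<le> d"
      using d by (intro average_diff_le[OF GL FG'(3) FG(4) _ GA has_average[OF FG'(4)]]) auto
    have "average M F' * average M G' - A * A' = average M F' * (average M G' - A') + (average M F' - A) * A'"
      by (simp add: algebra_simps)
    then have "norm (average M F' * average M G' - A * A') \<le>
        norm (average M F') * norm (A' - average M G') + norm (A - average M F') * norm A'"
      using norm_triangle_ineq[of "average M F' * (average M G' - A')" "(average M F' - A) * A'"]
      by (simp add: norm_mult norm_minus_commute)
    also have "norm (average M F') \<le> norm A + 1"
      using norm_triangle_ineq2[of "average M F'" A] a1 d(2) by (simp add: norm_minus_commute)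
    then have "norm (average M F') * norm (A' - average M G') + norm (A - average M F') * norm A'
        \<le> (norm A + 1) * d + d * norm A'"
      using a1 a2 d(1) by (intro add_mono mult_mono) auto
    finally have prod: "norm (average M F' * average M G' - A * A') \<le> (norm A + 1) * d + d * norm A'" .
    obtain n0 where n0: "\<And>n. n \<ge> n0 \<Longrightarrow> norm (k n - average M F' * average M G') < e / 2"
      using LIMSEQ_D[OF k(2), of "e / 2"] e by auto
    have "norm (h n - A * A') < e" if "n \<ge> n0" for n
    proof -
      have "norm (h n - A * A') \<le> norm (h n - k n) + norm (k n - average M F' * average M G') + norm (average M F' * average M G' - A * A')"
        using norm_triangle_ineq[of "h n - k n" "k n - A * A'"]
          norm_triangle_ineq[of "k n - average M F' * average M G'" "average M F' * average M G' - A * A'"] by simp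
      moreover have "C * d + ((norm A + 1) * d + d * norm A') = D * d" by (simp add: D_def algebra_simps)
      ultimately show ?thesis using hk[of n] n0[OF that] prod d(3) by linarith
    qed
    then show "\<exists>n0. \<forall>n\<ge>n0. norm (h n - A * A') < e" by blast
  qed
  then show ?thesis using hn unfolding A_def A'_def by blast
qed

end

section \<open>Quasi-lifts and their finite modifications\<close>

lemma partition_interval_uniform:
  "partition_interval (uniform_partition a) j = {a * real_of_int j .. a * (real_of_int j + 1)}"
  by (simp add: partition_interval_def uniform_partition_def)

lemma Union_partition_interval_uniform:
  assumes a: "0 < a" and pq: "p \<le> q"
  shows "(\<Union>k\<in>{p..q}. partition_interval (uniform_partition a) k) = {a * real_of_int p .. a * (real_of_int q + 1)}"
proof (intro equalityI subsetI)
  fix x assume "x \<in> (\<Union>k\<in>{p..q}. partition_interval (uniform_partition a) k)"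
  then obtain k where k: "p \<le> k" "k \<le> q" "a * real_of_int k \<le> x" "x \<le> a * (real_of_int k + 1)"
    by (auto simp: partition_interval_uniform)
  have "a * real_of_int p \<le> a * real_of_int k" "a * (real_of_int k + 1) \<le> a * (real_of_int q + 1)"
    using k a by (auto intro!: mult_left_mono)
  then show "x \<in> {a * real_of_int p .. a * (real_of_int q + 1)}" using k by auto
next
  fix x assume x: "x \<in> {a * real_of_int p .. a * (real_of_int q + 1)}"
  define m where "m = \<lfloor>x / a\<rfloor>"
  have m: "real_of_int m \<le> x / a" "x / a < real_of_int m + 1" unfolding m_def by linarith+
  have xa: "real_of_int p \<le> x / a" "x / a \<le> real_of_int q + 1" using x a by (auto simp: field_simps)
  have pm: "p \<le> m" using xa(1) m(2) by linarith
  \<comment> \<open>The minimum with \<open>q\<close> assigns the right endpoint of the union to its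
    last interval.\<close>
  define k where "k = min m q"
  have "k \<in> {p..q}" using pm pq by (auto simp: k_def)
  moreover have "real_of_int k \<le> x / a" "x / a \<le> real_of_int k + 1"
    using m xa by (auto simp: k_def min_def)
  then have "x \<in> partition_interval (uniform_partition a) k"
    using a by (auto simp: partition_interval_uniform field_simps)
  ultimately show "x \<in> (\<Union>k\<in>{p..q}. partition_interval (uniform_partition a) k)" by blast
qed

text \<open>Uniform bounds on slopes and jumps are given outside the finite set \<open>K\<close> of
  branches. An exceptional branch has a continuous derivative on a compact cell, and a maximum over
  finitely many of them completes the bounds.\<close>

lemma markov_mapI:
  fixes a :: real and \<tau> \<tau>' \<tau>'' :: "int \<Rightarrow> real \<Rightarrow> real" and p q :: "int \<Rightarrow> int"
  defines "I \<equiv> \<lambda>j::int. {a * real_of_int j .. a * (real_of_int j + 1)}"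
  assumes a: "0 < a"
    and bij: "\<And>j. bij_betw (\<tau> j) (I j) {a * real_of_int (p j) .. a * (real_of_int (q j) + 1)}"
    and diff: "\<And>j. twice_differentiable_with (\<tau> j) (\<tau>' j) (\<tau>'' j) (I j)"
    and l: "1 < l" "\<And>j x. x \<in> I j \<Longrightarrow> l \<le> \<bar>\<tau>' j x\<bar>"
    and \<eta>: "\<And>j x. x \<in> I j \<Longrightarrow> \<bar>\<tau>'' j x / (\<tau>' j x)\<^sup>2\<bar> \<le> \<eta>"
    and K: "finite K"
    and far: "\<And>j x. j \<notin> K \<Longrightarrow> x \<in> I j \<Longrightarrow> \<bar>\<tau>' j x\<bar> \<le> B\<^sub>0" "\<And>j. j \<notin> K \<Longrightarrow> \<bar>p j - j\<bar> \<le> N\<^sub>0 \<and> \<bar>q j - j\<bar> \<le> N\<^sub>0"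
  obtains B N where "markov_map a (\<lambda>x. \<tau> \<lfloor>x / a\<rfloor> x) \<tau> \<tau>' \<tau>'' p q l \<eta> B N"
proof -
  have d1: "(\<tau> j has_real_derivative \<tau>' j x) (at x within I j)"
    and d2: "(\<tau>' j has_real_derivative \<tau>'' j x) (at x within I j)" if "x \<in> I j" for j x
    using diff[of j] that by (auto simp: twice_differentiable_with_def)
  have "\<exists>b. \<forall>x\<in>I j. \<bar>\<tau>' j x\<bar> \<le> b" for j
  proof -
    have "continuous_on (I j) (\<tau>' j)"
      unfolding continuous_on_eq_continuous_within using DERIV_continuous[OF d2] by blast
    then have "compact (\<tau>' j ` I j)" by (rule compact_continuous_image) (simp add: I_def)
    from compact_imp_bounded[OF this] show ?thesis by (auto simp: bounded_iff)
  qed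
  then obtain b where b: "\<And>j x. x \<in> I j \<Longrightarrow> \<bar>\<tau>' j x\<bar> \<le> b j" by metis
  define B where "B = Max (insert B\<^sub>0 (b ` K))"
  define N where "N = Max (insert N\<^sub>0 ((\<lambda>j. \<bar>p j - j\<bar>) ` K \<union> (\<lambda>j. \<bar>q j - j\<bar>) ` K))"
  have bB: "b j \<le> B" if "j \<in> K" for j unfolding B_def using K that by (intro Max_ge) auto
  have B0: "B\<^sub>0 \<le> B" unfolding B_def using K by (intro Max_ge) auto
  have pN: "\<bar>p j - j\<bar> \<le> N" "\<bar>q j - j\<bar> \<le> N" if "j \<in> K" for j
    unfolding N_def using K that by (auto intro!: Max_ge)
  have N0: "N\<^sub>0 \<le> N" unfolding N_def using K by (intro Max_ge) auto
  have "markov_map a (\<lambda>x. \<tau> \<lfloor>x / a\<rfloor> x) \<tau> \<tau>' \<tau>'' p q l \<eta> B N"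
  proof
    have "0 \<in> I 0" using a by (simp add: I_def)
    from \<eta>[OF this] show "0 \<le> \<eta>" by linarith
    show "\<bar>p j - j\<bar> \<le> N" "\<bar>q j - j\<bar> \<le> N" for j
      using pN[of j] far(2)[of j] N0 by (cases "j \<in> K"; linarith)+
    fix j x assume "x \<in> {a * real_of_int j .. a * (real_of_int j + 1)}"
    then have x: "x \<in> I j" by (simp add: I_def)
    show "\<bar>\<tau>' j x\<bar> \<le> B"
      using b[OF x] bB[of j] far(1)[OF _ x] B0 by (cases "j \<in> K"; fastforce)
  qed (use a bij d1 d2 l \<eta> in \<open>simp_all add: I_def\<close>)
  then show ?thesis by (rule that)
qed

lemma quasi_lift_markov:
  assumes "quasi_lift a T\<^sub>o"
  obtains \<sigma> \<sigma>' \<sigma>'' :: "int \<Rightarrow> real \<Rightarrow> real" and k\<^sub>1 k\<^sub>2 :: int and l \<eta> B N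
  where "markov_map a (\<lambda>x. \<sigma> \<lfloor>x / a\<rfloor> x) \<sigma> \<sigma>' \<sigma>'' (\<lambda>j. j + k\<^sub>1) (\<lambda>j. j + k\<^sub>2) l \<eta> B N"
    and "k\<^sub>1 \<le> 0" "0 \<le> k\<^sub>2" "k\<^sub>1 < k\<^sub>2"
    and "\<And>j x. x \<in> {a * real_of_int j <..< a * (real_of_int j + 1)} \<Longrightarrow> T\<^sub>o x = \<sigma> j x"
    and "\<And>j x. \<sigma> (j + 1) (x + a) = \<sigma> j x + a"
proof -
  obtain \<tau> where a: "0 < a" and br: "quasi_lift_branch a \<tau>"
    and eq: "\<And>j::int. \<forall>x\<in>{a * of_int j <..< a * (of_int j + 1)}. T\<^sub>o x = \<tau> (x - a * of_int j) + a * of_int j"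
    using assms unfolding quasi_lift_def by blast
  obtain k\<^sub>1 k\<^sub>2 :: int where k: "k\<^sub>1 \<le> 0" "0 \<le> k\<^sub>2" "bij_betw \<tau> {0..a} {a * of_int k\<^sub>1 .. a * (of_int k\<^sub>2 + 1)}"
    using br unfolding quasi_lift_branch_def by blast
  obtain \<tau>' \<tau>'' \<eta> l where d: "twice_differentiable_with \<tau> \<tau>' \<tau>'' {0..a}"
    and \<eta>: "\<forall>x\<in>{0..a}. \<bar>\<tau>'' x\<bar> \<le> \<eta>" and l: "l > 1" "\<forall>x\<in>{0..a}. l \<le> \<bar>\<tau>' x\<bar>"
    using br unfolding quasi_lift_branch_def by blast
  define \<sigma> where "\<sigma> j x = \<tau> (x - a * real_of_int j) + a * real_of_int j" for j x
  define \<sigma>' where "\<sigma>' j x = \<tau>' (x - a * real_of_int j)" for j x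
  define \<sigma>'' where "\<sigma>'' j x = \<tau>'' (x - a * real_of_int j)" for j x
  let ?I = "\<lambda>j::int. {a * real_of_int j .. a * (real_of_int j + 1)}"
  have mem: "x - a * real_of_int j \<in> {0..a}" if "x \<in> ?I j" for x j
    using that by (auto simp: distrib_left)
  have img: "(\<lambda>x. x - a * real_of_int j) ` ?I j = {0..a}" for j
    by (simp add: distrib_left)
  have bij: "bij_betw (\<sigma> j) (?I j) {a * real_of_int (j + k\<^sub>1) .. a * (real_of_int (j + k\<^sub>2) + 1)}" for j
  proof -
    have "bij_betw (\<lambda>x. x - a * real_of_int j) (?I j) {0..a}"
      using img[of j] by (auto simp: bij_betw_def inj_on_def)
    then have 1: "bij_betw (\<tau> \<circ> (\<lambda>x. x - a * real_of_int j)) (?I j) {a * of_int k\<^sub>1 .. a * (of_int k\<^sub>2 + 1)}"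
      using k(3) by (rule bij_betw_trans)
    have "(\<lambda>y. y + a * real_of_int j) ` {a * of_int k\<^sub>1 .. a * (of_int k\<^sub>2 + 1)} =
        {a * real_of_int (j + k\<^sub>1) .. a * (real_of_int (j + k\<^sub>2) + 1)}"
      by (simp add: algebra_simps)
    then have "bij_betw (\<lambda>y. y + a * real_of_int j) {a * of_int k\<^sub>1 .. a * (of_int k\<^sub>2 + 1)}
        {a * real_of_int (j + k\<^sub>1) .. a * (real_of_int (j + k\<^sub>2) + 1)}"
      by (auto simp: bij_betw_def inj_on_def)
    from bij_betw_trans[OF 1 this] show ?thesis by (simp add: o_def \<sigma>_def[abs_def])
  qed
  have chain: "((\<lambda>x. f (x - a * real_of_int j)) has_real_derivative f' (x - a * real_of_int j)) (at x within ?I j)"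
    if "\<forall>x\<in>{0..a}. (f has_real_derivative f' x) (at x within {0..a})" "x \<in> ?I j" for f f' j x
  proof -
    have "(f has_real_derivative f' (x - a * real_of_int j)) (at (x - a * real_of_int j) within (\<lambda>x. x - a * real_of_int j) ` ?I j)"
      unfolding img using that mem by blast
    moreover have "((\<lambda>x. x - a * real_of_int j) has_real_derivative 1) (at x within ?I j)"
      by (auto intro!: derivative_eq_intros)
    ultimately have "(f \<circ> (\<lambda>x. x - a * real_of_int j) has_real_derivative f' (x - a * real_of_int j) * 1) (at x within ?I j)"
      by (rule DERIV_image_chain)
    then show ?thesis by (simp add: o_def)
  qed
  have diff: "twice_differentiable_with (\<sigma> j) (\<sigma>' j) (\<sigma>'' j) (?I j)" for j
    unfolding twice_differentiable_with_def
  proof (intro ballI conjI)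
    fix x assume x: "x \<in> ?I j"
    have "((\<lambda>x. \<tau> (x - a * real_of_int j) + a * real_of_int j) has_real_derivative \<tau>' (x - a * real_of_int j) + 0) (at x within ?I j)"
      using d x by (intro DERIV_add chain DERIV_const) (auto simp: twice_differentiable_with_def)
    then show "(\<sigma> j has_real_derivative \<sigma>' j x) (at x within ?I j)" by (simp add: \<sigma>_def[abs_def] \<sigma>'_def)
    have "((\<lambda>x. \<tau>' (x - a * real_of_int j)) has_real_derivative \<tau>'' (x - a * real_of_int j)) (at x within ?I j)"
      using d x by (intro chain) (auto simp: twice_differentiable_with_def)
    then show "(\<sigma>' j has_real_derivative \<sigma>'' j x) (at x within ?I j)" by (simp add: \<sigma>'_def[abs_def] \<sigma>''_def)
  qed
  have "\<exists>b. \<forall>x\<in>{0..a}. \<bar>\<tau>' x\<bar> \<le> b"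
  proof -
    have "continuous_on {0..a} \<tau>'"
      unfolding continuous_on_eq_continuous_within using d DERIV_continuous
      by (fastforce simp: twice_differentiable_with_def)
    then have "compact (\<tau>' ` {0..a})" by (rule compact_continuous_image) simp
    from compact_imp_bounded[OF this] show ?thesis by (auto simp: bounded_iff)
  qed
  then obtain b where b: "\<And>x. x \<in> {0..a} \<Longrightarrow> \<bar>\<tau>' x\<bar> \<le> b" by blast
  \<comment> \<open>Slopes are above 1, so the bound on the second derivative serves as distortion
    constant.\<close>
  have dist: "\<bar>\<sigma>'' j x / (\<sigma>' j x)\<^sup>2\<bar> \<le> \<eta>" if "x \<in> ?I j" for j x
  proof -
    have m: "l \<le> \<bar>\<sigma>' j x\<bar>" "\<bar>\<sigma>'' j x\<bar> \<le> \<eta>" using mem[OF that] l \<eta> by (auto simp: \<sigma>'_def \<sigma>''_def)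
    then have "1 \<le> (\<sigma>' j x)\<^sup>2" using l(1) power_mono[of 1 "\<bar>\<sigma>' j x\<bar>" 2] by simp
    then have "\<bar>\<sigma>'' j x\<bar> / (\<sigma>' j x)\<^sup>2 \<le> \<bar>\<sigma>'' j x\<bar> / 1" by (intro divide_left_mono) auto
    then show ?thesis using m by (simp add: abs_divide)
  qed
  obtain B N where mm: "markov_map a (\<lambda>x. \<sigma> \<lfloor>x / a\<rfloor> x) \<sigma> \<sigma>' \<sigma>'' (\<lambda>j. j + k\<^sub>1) (\<lambda>j. j + k\<^sub>2) l \<eta> B N"
  proof (rule markov_mapI[of a \<sigma> "\<lambda>j. j + k\<^sub>1" "\<lambda>j. j + k\<^sub>2" \<sigma>' \<sigma>'' l \<eta> "{}" b "max \<bar>k\<^sub>1\<bar> \<bar>k\<^sub>2\<bar>"])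
    fix j x assume "x \<in> ?I j"
    then show "l \<le> \<bar>\<sigma>' j x\<bar>" "\<bar>\<sigma>' j x\<bar> \<le> b" using mem l(2) b by (auto simp: \<sigma>'_def)
  qed (use a bij diff dist l(1) in auto)
  interpret markov_map a "\<lambda>x. \<sigma> \<lfloor>x / a\<rfloor> x" \<sigma> \<sigma>' \<sigma>'' "\<lambda>j. j + k\<^sub>1" "\<lambda>j. j + k\<^sub>2" l \<eta> B N by (rule mm)
  have "k\<^sub>1 < k\<^sub>2"
  proof (rule ccontr)
    assume "\<not> k\<^sub>1 < k\<^sub>2"
    \<comment> \<open>A branch onto a single cell would take two points at distance \<open>a\<close>
      to points at distance at most \<open>a\<close>, against expansion.\<close>
    then have k0: "k\<^sub>1 = 0" "k\<^sub>2 = 0" using k by auto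
    have I0: "0 \<in> I 0" "a \<in> I 0" using a by auto
    then have "\<sigma> 0 0 \<in> J 0" "\<sigma> 0 a \<in> J 0" using \<tau>_image[of 0] by blast+
    then have "\<bar>\<sigma> 0 0 - \<sigma> 0 a\<bar> \<le> a" by (auto simp: k0 abs_le_iff)
    moreover have "l * \<bar>0 - a\<bar> \<le> \<bar>\<sigma> 0 0 - \<sigma> 0 a\<bar>" by (rule branch_expanding[OF I0])
    moreover have "1 * a < l * a" using a l(1) by (intro mult_strict_right_mono) auto
    ultimately show False using a by simp
  qed
  moreover have "T\<^sub>o x = \<sigma> j x" if "x \<in> {a * real_of_int j <..< a * (real_of_int j + 1)}" for j x
    using eq[of j] that by (simp add: \<sigma>_def)
  moreover have "\<sigma> (j + 1) (x + a) = \<sigma> j x + a" for j x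
    by (simp add: \<sigma>_def algebra_simps)
  ultimately show ?thesis using that[OF mm] k by blast
qed

text \<open>Branches with index at most \<open>k\<close> in modulus come from the assumptions on
  \<open>T\<close>, all others literally from the lift. Beyond \<open>k\<close> the two maps thus
  agree at the endpoints as well, and the uniform bounds of the lift apply.\<close>

lemma finite_modification_markov:
  assumes lift: "markov_map a (\<lambda>x. \<sigma> \<lfloor>x / a\<rfloor> x) \<sigma> \<sigma>' \<sigma>'' (\<lambda>j. j + k\<^sub>1) (\<lambda>j. j + k\<^sub>2) l\<^sub>0 \<eta>\<^sub>0 B\<^sub>0 N\<^sub>0"
    and To: "\<And>j x. x \<in> {a * real_of_int j <..< a * (real_of_int j + 1)} \<Longrightarrow> T\<^sub>o x = \<sigma> j x"
    and fm: "finite_modification a T\<^sub>o T" and em: "expanding_markov_map (uniform_partition a) T"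
  obtains \<kappa> \<kappa>' \<kappa>'' :: "int \<Rightarrow> real \<Rightarrow> real" and p q l \<eta> B N and k :: int
  where "markov_map a (\<lambda>x. \<kappa> \<lfloor>x / a\<rfloor> x) \<kappa> \<kappa>' \<kappa>'' p q l \<eta> B N"
    and "\<And>j. k < \<bar>j\<bar> \<Longrightarrow> \<kappa> j = \<sigma> j \<and> p j = j + k\<^sub>1 \<and> q j = j + k\<^sub>2"
    and "\<And>x. x \<notin> range (\<lambda>j::int. a * real_of_int j) \<Longrightarrow> T x = \<kappa> \<lfloor>x / a\<rfloor> x"
proof -
  interpret L: markov_map a "\<lambda>x. \<sigma> \<lfloor>x / a\<rfloor> x" \<sigma> \<sigma>' \<sigma>'' "\<lambda>j. j + k\<^sub>1" "\<lambda>j. j + k\<^sub>2" l\<^sub>0 \<eta>\<^sub>0 B\<^sub>0 N\<^sub>0 by (rule lift)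
  obtain k :: int where k: "\<And>x. x \<notin> (\<Union>j\<in>{-k..k}. partition_interval (uniform_partition a) j) \<Longrightarrow> T x = T\<^sub>o x"
    using fm unfolding finite_modification_def by blast
  from em obtain \<tau> \<tau>' \<tau>'' l \<eta> where
    br: "\<forall>j. (\<forall>x\<in>{uniform_partition a j <..< uniform_partition a (j + 1)}. \<tau> j x = T x) \<and>
             twice_differentiable_with (\<tau> j) (\<tau>' j) (\<tau>'' j) (partition_interval (uniform_partition a) j) \<and>
             (\<exists>p q. bij_betw (\<tau> j) (partition_interval (uniform_partition a) j)
                       (\<Union>k\<in>{p..q}. partition_interval (uniform_partition a) k))"
    and l: "1 < l" "\<forall>j. \<forall>x\<in>partition_interval (uniform_partition a) j. \<bar>\<tau>' j x\<bar> \<ge> l"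
    and \<eta>: "\<forall>j. \<forall>x\<in>partition_interval (uniform_partition a) j. \<bar>\<tau>'' j x / (\<tau>' j x)\<^sup>2\<bar> \<le> \<eta>"
    unfolding expanding_markov_map_def by (elim conjE exE) (rule that)
  note pi = partition_interval_uniform
  have "\<forall>j. \<exists>p q. bij_betw (\<tau> j) (L.I j) {a * real_of_int p .. a * (real_of_int q + 1)}"
  proof
    fix j
    obtain p q where b: "bij_betw (\<tau> j) (L.I j) (\<Union>k\<in>{p..q}. partition_interval (uniform_partition a) k)"
      using br unfolding pi by blast
    have "p \<le> q"
    proof (rule ccontr)
      assume "\<not> p \<le> q"
      then have "\<tau> j ` L.I j = {}" using b by (simp add: bij_betw_def)
      moreover have "a * real_of_int j \<in> L.I j" using L.a_pos by simp
      ultimately show False by blast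
    qed
    from b[unfolded Union_partition_interval_uniform[OF L.a_pos this]]
    show "\<exists>p q. bij_betw (\<tau> j) (L.I j) {a * real_of_int p .. a * (real_of_int q + 1)}" by blast
  qed
  then obtain p q where bij: "\<And>j. bij_betw (\<tau> j) (L.I j) {a * real_of_int (p j) .. a * (real_of_int (q j) + 1)}"
    by metis
  define \<kappa> where "\<kappa> j = (if \<bar>j\<bar> \<le> k then \<tau> j else \<sigma> j)" for j
  define \<kappa>' where "\<kappa>' j = (if \<bar>j\<bar> \<le> k then \<tau>' j else \<sigma>' j)" for j
  define \<kappa>'' where "\<kappa>'' j = (if \<bar>j\<bar> \<le> k then \<tau>'' j else \<sigma>'' j)" for j
  define P where "P j = (if \<bar>j\<bar> \<le> k then p j else j + k\<^sub>1)" for j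
  define Q where "Q j = (if \<bar>j\<bar> \<le> k then q j else j + k\<^sub>2)" for j
  obtain B N where mm: "markov_map a (\<lambda>x. \<kappa> \<lfloor>x / a\<rfloor> x) \<kappa> \<kappa>' \<kappa>'' P Q (min l l\<^sub>0) (max \<eta> \<eta>\<^sub>0) B N"
  proof (rule markov_mapI[of a \<kappa> P Q \<kappa>' \<kappa>'' "min l l\<^sub>0" "max \<eta> \<eta>\<^sub>0" "{-k..k}" B\<^sub>0 N\<^sub>0])
    show "0 < a" by (rule L.a_pos)
    show "bij_betw (\<kappa> j) (L.I j) {a * real_of_int (P j) .. a * (real_of_int (Q j) + 1)}" for j
      using bij[of j] L.bij[of j] by (simp add: \<kappa>_def P_def Q_def)
    show "twice_differentiable_with (\<kappa> j) (\<kappa>' j) (\<kappa>'' j) (L.I j)" for j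
    proof (cases "\<bar>j\<bar> \<le> k")
      case True
      then show ?thesis using br[rule_format, of j] by (simp add: pi \<kappa>_def \<kappa>'_def \<kappa>''_def)
    next
      case False
      then show ?thesis using L.deriv[of _ j] L.deriv2[of _ j]
        by (simp add: twice_differentiable_with_def \<kappa>_def \<kappa>'_def \<kappa>''_def)
    qed
    show "1 < min l l\<^sub>0" using l(1) L.l_gt_1 by simp
    show "min l l\<^sub>0 \<le> \<bar>\<kappa>' j x\<bar>" if x: "x \<in> L.I j" for j x
      using l(2)[rule_format, of x j] L.expanding[OF x] x by (auto simp: pi \<kappa>'_def)
    show "\<bar>\<kappa>'' j x / (\<kappa>' j x)\<^sup>2\<bar> \<le> max \<eta> \<eta>\<^sub>0" if x: "x \<in> L.I j" for j x
      using \<eta>[rule_format, of x j] L.distortion[OF x] x unfolding pi \<kappa>'_def \<kappa>''_def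
      by (simp split: if_split) linarith
    show "\<bar>\<kappa>' j x\<bar> \<le> B\<^sub>0" if "j \<notin> {-k..k}" "x \<in> L.I j" for j x
      using L.slope_le[OF that(2)] that(1) by (auto simp: \<kappa>'_def abs_le_iff)
    show "\<bar>P j - j\<bar> \<le> N\<^sub>0 \<and> \<bar>Q j - j\<bar> \<le> N\<^sub>0" if "j \<notin> {-k..k}" for j
      using L.jump[of j] that by (auto simp: P_def Q_def abs_le_iff)
  qed simp
  have agree: "T x = \<kappa> \<lfloor>x / a\<rfloor> x" if x: "x \<notin> range (\<lambda>j::int. a * real_of_int j)" for x
  proof -
    define j where "j = \<lfloor>x / a\<rfloor>"
    have "x \<in> L.H j" by (simp add: L.mem_H j_def)
    then have xo: "x \<in> {a * real_of_int j <..< a * (real_of_int j + 1)}"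
      using x by (auto simp: L.H_eq less_le)
    show ?thesis
    proof (cases "\<bar>j\<bar> \<le> k")
      case True
      then show ?thesis using br[rule_format, of j] xo unfolding j_def[symmetric]
        by (auto simp: \<kappa>_def uniform_partition_def)
    next
      case False
      have "x \<notin> partition_interval (uniform_partition a) i" if "i \<in> {-k..k}" for i
      proof
        assume "x \<in> partition_interval (uniform_partition a) i"
        then have xi: "a * real_of_int i \<le> x" "x \<le> a * (real_of_int i + 1)" by (auto simp: pi)
        have "a * real_of_int i < a * (real_of_int j + 1)" "a * real_of_int j < a * (real_of_int i + 1)"
          using xo xi by auto
        then have "i = j" using L.a_pos by (simp add: mult_less_cancel_left_pos)
        then show False using that False by (auto simp: abs_le_iff)
      qed
      then have "T x = T\<^sub>o x" by (intro k) blast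
      then show ?thesis using To[OF xo] False unfolding j_def[symmetric] by (simp add: \<kappa>_def)
    qed
  qed
  show ?thesis
    using that[OF mm _ agree, of k] by (simp add: \<kappa>_def P_def Q_def)
qed

section \<open>Independence of endpoint values, and bounded displacement\<close>

context markov_map
begin

text \<open>Arbitrary endpoint values add at most two points to the image of a closed cell, too
  little to cover another cell, so adjacency in the Markov graph of \<open>T'\<close> gives an edge
  in one of the two orientations. A path from \<open>E\<close> to its complement has to cross over
  somewhere.\<close>

lemma connected_edges:
  assumes T': "\<And>x. x \<notin> range (\<lambda>j::int. a * real_of_int j) \<Longrightarrow> T' x = T x"
    and conn: "markov_indecomposable (uniform_partition a) T'" and E: "E \<noteq> {}" "E \<noteq> UNIV"
  shows "\<exists>i\<in>E. \<exists>j. j \<notin> E \<and> (edge i j \<or> edge j i)"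
proof -
  have edge: "edge j k"
    if sub: "null_subset (partition_interval (uniform_partition a) k) (T' ` partition_interval (uniform_partition a) j)" for j k
  proof (rule ccontr)
    assume "\<not> edge j k"
    then have HJ: "H k \<inter> J j \<subseteq> {a * (real_of_int (q j) + 1)}" using not_edge_Int[of j k] by simp
    have img: "T' ` I j \<subseteq> J j \<union> {T' (a * j), T' (a * (j + 1))}"
    proof
      fix y assume "y \<in> T' ` I j"
      then obtain x where x: "x \<in> I j" "y = T' x" by blast
      show "y \<in> J j \<union> {T' (a * j), T' (a * (j + 1))}"
      proof (cases "x = a * j \<or> x = a * (j + 1)")
        case False
        then have xo: "a * real_of_int j < x" "x < a * (real_of_int j + 1)" using x by auto
        then have "x \<in> H j" by (simp add: H_eq)
        have "x \<notin> range (\<lambda>j::int. a * real_of_int j)"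
        proof
          assume "x \<in> range (\<lambda>j::int. a * real_of_int j)"
          then obtain i :: int where "x = a * real_of_int i" by blast
          then have "real_of_int j < real_of_int i" "real_of_int i < real_of_int j + 1"
            using xo a_pos by (auto simp: mult_less_cancel_left_pos)
          then have "j < i" "i < j + 1" by linarith+
          then show False by simp
        qed
        then have "y = \<tau> j x" using x(2) T' \<open>x \<in> H j\<close> by (simp add: T_eq mem_H)
        then show ?thesis using \<tau>_image[of j] x(1) by blast
      qed (use x in auto)
    qed
    have "I k - T' ` I j \<in> null_sets lborel"
      using sub by (simp add: null_subset_def partition_interval_uniform)
    moreover have "{a * (real_of_int (q j) + 1), T' (a * j), T' (a * (j + 1))} \<in> null_sets lborel"
      by (intro finite_imp_null_set_lborel) auto
    ultimately have "(I k - T' ` I j) \<union> {a * (real_of_int (q j) + 1), T' (a * j), T' (a * (j + 1))} \<in> null_sets lborel"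
      by (rule null_sets.Un)
    moreover have "H k \<subseteq> (I k - T' ` I j) \<union> {a * (real_of_int (q j) + 1), T' (a * j), T' (a * (j + 1))}"
      using HJ img H_sub_I[of k] by blast
    ultimately have "H k \<in> null_sets lborel" by (intro null_sets_subset[of _ lborel "H k"]) auto
    then show False using measure_eq_0_null_sets[of "H k" lborel] measure_H a_pos by simp
  qed
  obtain i j where ij: "i \<in> E" "j \<notin> E" using E by blast
  have "(i, j) \<in> (markov_edges (uniform_partition a) T')\<^sup>*" using conn by (simp add: markov_indecomposable_def)
  then have "\<exists>e f. e \<in> E \<and> f \<notin> E \<and> (e, f) \<in> markov_edges (uniform_partition a) T'"
    using ij
  proof (induction rule: rtrancl_induct)
    case (step y z)
    then show ?case by (cases "y \<in> E") auto
  qed simp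
  then show ?thesis using edge by (auto simp: markov_edges_def)
qed

text \<open>Almost no orbit of \<open>T\<close> ever meets the grid, the only place where the maps
  may differ.\<close>

lemma AE_funpow_eq:
  assumes T': "\<And>x. x \<notin> range (\<lambda>j::int. a * real_of_int j) \<Longrightarrow> T' x = T x"
  shows "AE x in lborel. \<forall>n. (T' ^^ n) x = (T ^^ n) x"
proof -
  have "range (\<lambda>j::int. a * j) \<in> null_sets lborel"
    by (intro countable_imp_null_set_lborel countable_image) auto
  then have "AE x in lborel. \<forall>n. (T ^^ n) x \<notin> range (\<lambda>j::int. a * j)" by (intro AE_Tn AE_not_in)
  then show ?thesis
  proof eventually_elim
    case (elim x)
    have "(T' ^^ n) x = (T ^^ n) x" for n
    proof (induction n)
      case (Suc n)
      then show ?case using T'[OF elim[rule_format, of n]] by simp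
    qed simp
    then show ?case by blast
  qed
qed

lemma T_bounded_displacement: "\<bar>T x - x\<bar> \<le> a * (real_of_int N + 1)"
proof -
  define j where "j = cell x"
  have x: "x \<in> I j" using H_sub_I[of j] mem_H[of x j] by (auto simp: j_def)
  then have "T x \<in> J j" using \<tau>_image[of j] by (auto simp: T_eq j_def)
  moreover have "real_of_int j - N \<le> p j" "real_of_int (q j) \<le> j + N" using jump[of j] by linarith+
  then have "a * (real_of_int j - N) \<le> a * p j" "a * (real_of_int (q j) + 1) \<le> a * (real_of_int j + N + 1)"
    using a_pos by (auto intro!: mult_left_mono)
  ultimately show ?thesis using x by (auto simp: abs_le_iff algebra_simps)
qed

end

text \<open>Equivalence with Lebesgue measure and finiteness are known on the fundamental domain.
  Translations preserve both measures and carry these properties to every cell, and a bounded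
  interval meets finitely many cells.\<close>

lemma quasi_lift_measure_averaging:
  assumes a: "0 < a" and qm: "quasi_lift_measure a T\<^sub>o M"
  shows "periodic_averaging M a"
proof -
  have sets_M: "sets M = sets borel" and shift: "preserves_measure (\<lambda>x. x + a) M"
    and fin: "emeasure M {0..<a} < \<infinity>"
    and null: "null_sets (restrict_space M {0..<a}) = null_sets (restrict_space lborel {0..<a})"
    using qm by (auto simp: quasi_lift_measure_def)
  have sp: "space M = UNIV" using sets_eq_imp_space_eq[OF sets_M] by simp
  define H where "H j = {a * real_of_int j ..< a * (real_of_int j + 1)}" for j :: int
  have H[measurable]: "H j \<in> sets borel" for j by (simp add: H_def)
  have memH: "x \<in> H j \<longleftrightarrow> \<lfloor>x / a\<rfloor> = j" for x j
    using a by (simp add: H_def floor_eq_iff pos_le_divide_eq pos_divide_less_eq mult.commute)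
  have tr: "(\<lambda>x. x + b) -` A \<in> sets borel" if "A \<in> sets borel" for A :: "real set" and b
    using measurable_sets[of "\<lambda>x. x + b" borel borel A] that by simp
  have sh: "emeasure M ((\<lambda>x. x + a) -` A) = emeasure M A" if "A \<in> sets borel" for A
    using emeasure_distr[of "\<lambda>x. x + a" M M A] shift that by (simp add: preserves_measure_def sets_M sp)
  have shj: "emeasure M ((\<lambda>x. x + a * real_of_int j) -` A) = emeasure M A" if A: "A \<in> sets borel" for A j
  proof (induction j rule: int_induct[where k = 0])
    case (step1 i)
    have "(\<lambda>x. x + a * real_of_int (i + 1)) -` A = (\<lambda>x. x + a) -` ((\<lambda>x. x + a * real_of_int i) -` A)"
      by (auto simp: algebra_simps)
    then show ?case using sh[OF tr[OF A]] step1 by simp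
  next
    case (step2 i)
    have "(\<lambda>x. x + a * real_of_int i) -` A = (\<lambda>x. x + a) -` ((\<lambda>x. x + a * real_of_int (i - 1)) -` A)"
      by (auto simp: algebra_simps)
    then show ?case using sh[OF tr[OF A]] step2 by simp
  qed simp
  have shl: "(\<lambda>x. x + b) -` A \<in> null_sets lborel \<longleftrightarrow> A \<in> null_sets lborel" if A: "A \<in> sets borel" for A :: "real set" and b
  proof -
    have "emeasure lborel A = emeasure (distr lborel borel ((+) b)) A" by (simp add: lborel_distr_plus)
    also have "\<dots> = emeasure lborel ((+) b -` A)" using A by (subst emeasure_distr) auto
    also have "(+) b -` A = (\<lambda>x. x + b) -` A" by (auto simp: add.commute)
    finally show ?thesis using A tr[OF A] by (simp add: null_sets_def)
  qed
  have null0: "A \<in> null_sets M \<longleftrightarrow> A \<in> null_sets lborel" if "A \<subseteq> H 0" for A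
  proof -
    have "A \<in> null_sets (restrict_space M {0..<a}) \<longleftrightarrow> A \<in> null_sets M"
      "A \<in> null_sets (restrict_space lborel {0..<a}) \<longleftrightarrow> A \<in> null_sets lborel"
      using that by (subst null_sets_restrict_space; force simp: sets_M H_def)+
    then show ?thesis by (simp only: null)
  qed
  have nullj: "A \<in> null_sets M \<longleftrightarrow> A \<in> null_sets lborel" if A: "A \<in> sets borel" "A \<subseteq> H j" for A j
  proof -
    have "(\<lambda>x. x + a * real_of_int j) -` A \<subseteq> H 0" using A(2) by (force simp: H_def algebra_simps)
    from null0[OF this] show ?thesis
      using shl[OF A(1)] shj[OF A(1), of j] A(1) tr[OF A(1)] by (simp add: null_sets_def sets_M)
  qed
  have decomp: "A = (\<Union>j. A \<inter> H j)" for A by (auto simp: memH)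
  have null_M: "A \<in> null_sets M \<longleftrightarrow> A \<in> null_sets lborel" for A
  proof
    assume A: "A \<in> null_sets M"
    then have Ab: "A \<in> sets borel" by (simp add: null_sets_def sets_M)
    have "A \<inter> H j \<in> null_sets lborel" for j
      using nullj[of "A \<inter> H j" j] Ab A by (auto simp: sets_M intro: null_set_Int2)
    then show "A \<in> null_sets lborel" by (subst decomp) (intro null_sets_UN)
  next
    assume A: "A \<in> null_sets lborel"
    then have Ab: "A \<in> sets borel" by (simp add: null_sets_def)
    have "A \<inter> H j \<in> null_sets M" for j
      using nullj[of "A \<inter> H j" j] Ab A by (auto intro: null_set_Int2)
    then show "A \<in> null_sets M" by (subst decomp) (intro null_sets_UN)
  qed
  have finH: "H j \<in> fmeasurable M" for j
  proof -
    have "(\<lambda>x. x + a * real_of_int j) -` H j = {0..<a}" by (auto simp: H_def algebra_simps)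
    then have "emeasure M (H j) = emeasure M {0..<a}" using shj[OF H, of j j] by simp
    then show ?thesis using fin by (intro fmeasurableI) (auto simp: sets_M)
  qed
  have "emeasure M {x..y} < \<infinity>" for x y
  proof -
    have "(\<Union>j\<in>{\<lfloor>x / a\<rfloor>..\<lfloor>y / a\<rfloor>}. H j) \<in> fmeasurable M" by (intro fmeasurable.finite_UN finH) auto
    moreover have "{x..y} \<subseteq> (\<Union>j\<in>{\<lfloor>x / a\<rfloor>..\<lfloor>y / a\<rfloor>}. H j)"
      using a by (auto simp: memH intro!: floor_mono divide_right_mono)
    ultimately have "{x..y} \<in> fmeasurable M" by (rule fmeasurableI2) (simp add: sets_M)
    then show ?thesis by (simp add: fmeasurable_def)
  qed
  then show ?thesis using a sets_M null_M shift by unfold_locales auto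
qed

theorem proposition4p5:
  fixes a :: real and T\<^sub>o T :: "real \<Rightarrow> real" and \<mu>\<^sub>o \<mu> :: "real measure"
  assumes "quasi_lift a T\<^sub>o"
    and "quasi_lift_measure a T\<^sub>o \<mu>\<^sub>o"
    and "finite_modification a T\<^sub>o T"
    and "expanding_markov_map (uniform_partition a) T"
    and "markov_indecomposable (uniform_partition a) T"
    and "sigma_finite_measure \<mu>"
    and "lebesgue_equivalent \<mu>"
    and "preserves_measure T \<mu>"
    and "same_averages \<mu> \<mu>\<^sub>o"
  shows "(\<forall>\<G>. \<G> \<subseteq> L_infinity \<mu> \<longrightarrow> GLM1 T \<mu> \<G> (L_one \<mu>)) \<and> GGM1 T \<mu> (G2 a)"
proof -

  \<comment> \<open>Markov representatives of the lift and its modification, with their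
    measures\<close>
  obtain \<sigma> \<sigma>' \<sigma>'' :: "int \<Rightarrow> real \<Rightarrow> real" and k\<^sub>1 k\<^sub>2 :: int and l\<^sub>1 \<eta>\<^sub>1 B\<^sub>1 N\<^sub>1
    where lift: "markov_map a (\<lambda>x. \<sigma> \<lfloor>x / a\<rfloor> x) \<sigma> \<sigma>' \<sigma>'' (\<lambda>j. j + k\<^sub>1) (\<lambda>j. j + k\<^sub>2) l\<^sub>1 \<eta>\<^sub>1 B\<^sub>1 N\<^sub>1"
    and k12: "k\<^sub>1 \<le> 0" "0 \<le> k\<^sub>2" "k\<^sub>1 < k\<^sub>2"
    and To: "\<And>j x. x \<in> {a * real_of_int j <..< a * (real_of_int j + 1)} \<Longrightarrow> T\<^sub>o x = \<sigma> j x"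
    and \<sigma>_shift: "\<And>j x. \<sigma> (j + 1) (x + a) = \<sigma> j x + a"
    by (rule quasi_lift_markov[OF assms(1)]) (rule that)
  obtain \<kappa> \<kappa>' \<kappa>'' :: "int \<Rightarrow> real \<Rightarrow> real" and p q l \<eta> B N and k :: int
    where modif: "markov_map a (\<lambda>x. \<kappa> \<lfloor>x / a\<rfloor> x) \<kappa> \<kappa>' \<kappa>'' p q l \<eta> B N"
    and k: "\<And>j. k < \<bar>j\<bar> \<Longrightarrow> \<kappa> j = \<sigma> j \<and> p j = j + k\<^sub>1 \<and> q j = j + k\<^sub>2"
    and T_eq: "\<And>x. x \<notin> range (\<lambda>j::int. a * real_of_int j) \<Longrightarrow> T x = \<kappa> \<lfloor>x / a\<rfloor> x"
  proof (rule finite_modification_markov[OF lift _ assms(3,4)])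
    show "T\<^sub>o x = \<sigma> j x" if "x \<in> {a * real_of_int j <..< a * (real_of_int j + 1)}" for j x
      by (rule To[OF that])
  qed (rule that)
  \<comment> \<open>The given maps have arbitrary values on the grid; these versions follow their
    branches at every point and agree with them off a null set.\<close>
  define T\<^sub>1 where "T\<^sub>1 x = \<sigma> \<lfloor>x / a\<rfloor> x" for x
  define T' where "T' x = \<kappa> \<lfloor>x / a\<rfloor> x" for x
  interpret L: markov_map a T\<^sub>1 \<sigma> \<sigma>' \<sigma>'' "\<lambda>j. j + k\<^sub>1" "\<lambda>j. j + k\<^sub>2" l\<^sub>1 \<eta>\<^sub>1 B\<^sub>1 N\<^sub>1
    using lift unfolding T\<^sub>1_def[abs_def] .
  interpret T': markov_map a T' \<kappa> \<kappa>' \<kappa>'' p q l \<eta> B N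
    using modif unfolding T'_def[abs_def] .
  have T_T': "T x = T' x" if "x \<notin> range (\<lambda>j::int. a * real_of_int j)" for x
    using T_eq[OF that] by (simp add: T'_def)
  have To_T1: "T\<^sub>o x = T\<^sub>1 x" if x: "x \<notin> range (\<lambda>j::int. a * real_of_int j)" for x
  proof -
    have "x \<in> L.H \<lfloor>x / a\<rfloor>" by (simp add: L.mem_H)
    moreover have "x \<noteq> a * real_of_int \<lfloor>x / a\<rfloor>" using x by (metis rangeI)
    ultimately have "x \<in> {a * real_of_int \<lfloor>x / a\<rfloor> <..< a * (real_of_int \<lfloor>x / a\<rfloor> + 1)}"
      by (auto simp: L.H_eq)
    from To[OF this] show ?thesis by (simp add: T\<^sub>1_def)
  qed
  have a: "0 < a" by (rule L.a_pos)
  have shift: "T\<^sub>1 (x + a) = T\<^sub>1 x + a" for x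
  proof -
    have "\<lfloor>(x + a) / a\<rfloor> = \<lfloor>x / a\<rfloor> + 1" using a by (simp add: add_divide_distrib)
    then show ?thesis by (simp add: T\<^sub>1_def \<sigma>_shift)
  qed
  interpret O: periodic_averaging \<mu>\<^sub>o a
    by (rule quasi_lift_measure_averaging[OF a assms(2)])
  have sets_\<mu>: "sets \<mu> = sets borel" and null_\<mu>: "null_sets \<mu> = null_sets lborel"
    using assms(7) by (auto simp: lebesgue_equivalent_def absolutely_continuous_def)
  have space_\<mu>: "space \<mu> = UNIV" using sets_eq_imp_space_eq[OF sets_\<mu>] by simp
  have null_grid: "range (\<lambda>j::int. a * real_of_int j) \<in> null_sets lborel"
    by (intro countable_imp_null_set_lborel countable_image) auto
  have AE_grid: "AE x in lborel. x \<notin> range (\<lambda>j::int. a * real_of_int j)" by (rule AE_not_in[OF null_grid])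
  have same: "average_exists \<mu> F \<longleftrightarrow> average_exists \<mu>\<^sub>o F" "average_exists \<mu> F \<longrightarrow> average \<mu> F = average \<mu>\<^sub>o F"
    if "F \<in> borel_measurable borel" "bounded (range F)" for F :: "real \<Rightarrow> complex"
    using assms(9) that by (auto simp: same_averages_def)
  \<comment> \<open>Finiteness on bounded sets is part of having an average: the constant 1 has one
    for \<open>\<mu>\<^sub>o\<close>, hence also for \<open>\<mu>\<close>.\<close>
  have fin_\<mu>: "emeasure \<mu> {x..y} < \<infinity>" for x y
  proof -
    have "average_exists \<mu>\<^sub>o (\<lambda>_. 1)"
      using O.average_periodic[OF L_infinity_const[of 1]] by (auto simp: average_exists_def)
    then have "average_exists \<mu> (\<lambda>_. 1)" using same(1)[of "\<lambda>_. 1"] by simp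
    then have "emeasure \<mu> {(x + y) / 2 - (y - x) / 2 .. (x + y) / 2 + (y - x) / 2} < \<infinity>"
      unfolding average_exists_def has_infinite_volume_average_def by blast
    moreover have "(x + y) / 2 - (y - x) / 2 = x" "(x + y) / 2 + (y - x) / 2 = y" by (simp_all add: field_simps)
    ultimately show ?thesis by simp
  qed
  interpret M: averaging \<mu> by unfold_locales (fact sets_\<mu> null_\<mu> fin_\<mu>)+
  have inv: "emeasure \<mu> (T' -` A) = emeasure \<mu> A" if A: "A \<in> sets borel" for A
  proof -
    have pm: "T \<in> \<mu> \<rightarrow>\<^sub>M \<mu>" "distr \<mu> \<mu> T = \<mu>" using assms(8) by (auto simp: preserves_measure_def)
    have "emeasure \<mu> (T' -` A) = emeasure \<mu> (T -` A)"
    proof (rule emeasure_eq_AE)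
      show "AE x in \<mu>. x \<in> T' -` A \<longleftrightarrow> x \<in> T -` A"
        using AE_grid unfolding M.AE_M_iff by eventually_elim (simp add: T_T')
      show "T' -` A \<in> sets \<mu>" using measurable_sets[OF T'.T_measurable A] by (simp add: sets_\<mu>)
      show "T -` A \<in> sets \<mu>" using measurable_sets[OF pm(1), of A] A by (simp add: sets_\<mu> space_\<mu>)
    qed
    also have "\<dots> = emeasure (distr \<mu> \<mu> T) A"
      using emeasure_distr[OF pm(1), of A] A by (simp add: sets_\<mu> space_\<mu>)
    finally show ?thesis by (simp only: pm(2))
  qed
  interpret Tm: modified_lift a T' \<kappa> \<kappa>' \<kappa>'' p q l \<eta> B N T\<^sub>1 \<sigma> \<sigma>' \<sigma>'' "\<lambda>j. j + k\<^sub>1" "\<lambda>j. j + k\<^sub>2" l\<^sub>1 \<eta>\<^sub>1 B\<^sub>1 N\<^sub>1 k k\<^sub>1 k\<^sub>2 \<mu>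
  proof unfold_locales
    show "T' x = T\<^sub>1 x" if "k < \<bar>\<lfloor>x / a\<rfloor>\<bar>" for x using k[OF that] by (simp add: T'_def T\<^sub>1_def)
    show "\<exists>i\<in>E. \<exists>j. j \<notin> E \<and> (T'.edge i j \<or> T'.edge j i)" if "E \<noteq> {}" "E \<noteq> UNIV" for E
      by (rule T'.connected_edges[OF T_T' assms(5) that])
  qed (use k k12 shift sets_\<mu> null_\<mu> inv fin_\<mu> in auto)
  interpret LA: lift_averaging \<mu>\<^sub>o a T\<^sub>1
  proof
    show "T\<^sub>1 \<in> borel \<rightarrow>\<^sub>M borel" by (rule L.T_measurable)
    show "T\<^sub>1 (x + a) = T\<^sub>1 x + a" for x by (rule shift)
    define R where "R = restrict_space \<mu>\<^sub>o {0..<a}"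
    have circ: "(\<lambda>x. T\<^sub>o x rmod a) \<in> R \<rightarrow>\<^sub>M R" "distr R R (\<lambda>x. T\<^sub>o x rmod a) = R"
      using assms(2) by (auto simp: quasi_lift_measure_def preserves_measure_def R_def)
    have rm: "(\<lambda>x. x rmod a) \<in> borel \<rightarrow>\<^sub>M borel"
      using a by (simp add: rmod_def)
    have "(\<lambda>x. T\<^sub>1 x rmod a) \<in> \<mu>\<^sub>o \<rightarrow>\<^sub>M borel"
      using measurable_compose[OF L.T_measurable rm] measurable_cong_sets[OF O.sets_M refl] by blast
    then have "(\<lambda>x. T\<^sub>1 x rmod a) \<in> R \<rightarrow>\<^sub>M borel" unfolding R_def by (rule measurable_restrict_space1)
    then have m1: "(\<lambda>x. T\<^sub>1 x rmod a) \<in> R \<rightarrow>\<^sub>M R"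
      unfolding R_def using a measurable_cong_sets[OF refl O.sets_M]
      by (intro measurable_restrict_space2) (auto simp: rmod_nonneg rmod_less)
    have "AE x in \<mu>\<^sub>o. T\<^sub>1 x rmod a = T\<^sub>o x rmod a"
      using AE_grid unfolding O.AE_M_iff by eventually_elim (simp add: To_T1)
    then have "AE x in R. T\<^sub>1 x rmod a = T\<^sub>o x rmod a"
      unfolding R_def by (subst AE_restrict_space_iff) (auto simp: O.sets_M)
    then have "distr R R (\<lambda>x. T\<^sub>1 x rmod a) = distr R R (\<lambda>x. T\<^sub>o x rmod a)"
      by (intro distr_cong_AE refl m1 circ(1))
    then show "preserves_measure (\<lambda>x. T\<^sub>1 x rmod a) (restrict_space \<mu>\<^sub>o {0..<a})"
      using m1 circ(2) by (simp add: preserves_measure_def R_def)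
  qed
  \<comment> \<open>For the lift, neighbouring cells are always joined, because
    \<open>k\<^sub>1 < k\<^sub>2\<close>; a set of cells without an edge across its cut would be
    closed under steps of 1 in both directions.\<close>
  have conn1: "\<exists>i\<in>E. \<exists>j. j \<notin> E \<and> (L.edge i j \<or> L.edge j i)" if E: "E \<noteq> {}" "E \<noteq> UNIV" for E
  proof -
    have "\<exists>i. (i \<in> E) \<noteq> (i + 1 \<in> E)"
    proof (rule ccontr)
      assume no: "\<not> ?thesis"
      obtain e where e: "e \<in> E" using E by blast
      have "i \<in> E" for i
      proof (induction i rule: int_induct[where k = e])
        case (step1 i)
        then show ?case using no by blast
      next
        case (step2 i)
        then show ?case using no by (metis diff_add_cancel)
      qed (rule e)
      then show False using E by blast
    qed
    then obtain i where i: "(i \<in> E) \<noteq> (i + 1 \<in> E)" by blast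
    have "L.edge i (i + 1) \<or> L.edge (i + 1) i" using k12 by (auto simp: L.edge_def)
    then show ?thesis using i by blast
  qed
  \<comment> \<open>The lift is regarded as a modification of itself, with its own measure, and is
    thereby exact.\<close>
  interpret Lm: modified_lift a T\<^sub>1 \<sigma> \<sigma>' \<sigma>'' "\<lambda>j. j + k\<^sub>1" "\<lambda>j. j + k\<^sub>2" l\<^sub>1 \<eta>\<^sub>1 B\<^sub>1 N\<^sub>1 T\<^sub>1 \<sigma> \<sigma>' \<sigma>'' "\<lambda>j. j + k\<^sub>1" "\<lambda>j. j + k\<^sub>2" l\<^sub>1 \<eta>\<^sub>1 B\<^sub>1 N\<^sub>1 k k\<^sub>1 k\<^sub>2 \<mu>\<^sub>o
    by unfold_locales (use k k12 shift O.sets_M O.null_M O.fin_M LA.emeasure_vimage_T conn1 in auto)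
  interpret LM: mixing_lift \<mu>\<^sub>o a T\<^sub>1
  proof
    fix F g :: "real \<Rightarrow> complex"
    assume F: "F \<in> L_infinity lborel" and g: "integrable \<mu>\<^sub>o g" "(LINT x|\<mu>\<^sub>o. g x) = 0"
    then show "(\<lambda>n. LINT x|\<mu>\<^sub>o. F ((T\<^sub>1 ^^ n) x) * g x) \<longlonglongrightarrow> 0"
      using Lm.global_local_mixing[OF _ _ g] by (auto simp: L_infinity_def)
  qed
  have Tn_eq: "AE x in lborel. \<forall>n. (T ^^ n) x = (T' ^^ n) x"
    by (rule T'.AE_funpow_eq[OF T_T'])
  have T_meas: "T \<in> borel \<rightarrow>\<^sub>M borel"
    using assms(8) measurable_cong_sets[OF sets_\<mu> sets_\<mu>] by (auto simp: preserves_measure_def)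
  have Tn_meas: "T ^^ n \<in> borel \<rightarrow>\<^sub>M borel" for n using T_meas by simp

  \<comment> \<open>Global-local mixing of the modified map\<close>
  have "GLM1 T \<mu> \<G> (L_one \<mu>)" if \<G>: "\<G> \<subseteq> L_infinity \<mu>" for \<G>
    unfolding GLM1_def
  proof (intro ballI impI)
    fix F g assume "F \<in> \<G>" and g: "g \<in> L_one \<mu>" "(LINT x|\<mu>. g x) = 0"
    then have "F \<in> L_infinity \<mu>" using \<G> by blast
    then obtain K where Fm: "F \<in> borel_measurable \<mu>" and K: "AE x in lborel. norm (F x) \<le> K"
      by (auto simp: L_infinity_def M.AE_M_iff)
    have Fb: "F \<in> borel_measurable borel" using Fm measurable_cong_sets[OF sets_\<mu> refl] by blast
    have gi: "integrable \<mu> g" using g by (simp add: L_one_def)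
    have "(LINT x|\<mu>. F ((T ^^ n) x) * g x) = (LINT x|\<mu>. F ((T' ^^ n) x) * g x)" for n
    proof (rule integral_cong_AE)
      have "(\<lambda>x. F ((T ^^ n) x)) \<in> borel_measurable \<mu>" "(\<lambda>x. F ((T' ^^ n) x)) \<in> borel_measurable \<mu>"
        by (intro M.measurable_M measurable_compose[OF Tn_meas Fb] measurable_compose[OF T'.Tn_measurable Fb])+
      then show "(\<lambda>x. F ((T ^^ n) x) * g x) \<in> borel_measurable \<mu>" "(\<lambda>x. F ((T' ^^ n) x) * g x) \<in> borel_measurable \<mu>"
        using gi by auto
      show "AE x in \<mu>. F ((T ^^ n) x) * g x = F ((T' ^^ n) x) * g x"
        using Tn_eq unfolding M.AE_M_iff by eventually_elim simp
    qed
    then show "(\<lambda>n. LINT x|\<mu>. F ((T ^^ n) x) * g x) \<longlonglongrightarrow> 0"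
      using Tm.global_local_mixing[OF Fb K gi g(2)] by simp
  qed

  \<comment> \<open>Global-global mixing by comparison with the lift\<close>
  moreover have "GGM1 T \<mu> (G2 a)"
  proof -
    \<comment> \<open>Equality of averages concerns functions bounded at every point, so an
      essentially bounded function is first changed on a null set.\<close>
    have transfer: "has_infinite_volume_average \<mu> F L"
      if F: "F \<in> L_infinity lborel" and avg: "has_infinite_volume_average \<mu>\<^sub>o F L" for F L
    proof -
      obtain K where Fm[measurable]: "F \<in> borel_measurable borel" and K: "AE x in lborel. norm (F x) \<le> K"
        using F by (auto simp: L_infinity_def)
      define F' where "F' x = (if norm (F x) \<le> K then F x else 0)" for x
      have F'm: "F' \<in> borel_measurable borel" unfolding F'_def by measurable
      have eq: "AE x in lborel. F' x = F x" using K by eventually_elim (simp add: F'_def)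
      have "norm (F' x) \<le> \<bar>K\<bar>" for x by (auto simp: F'_def intro: order_trans[OF _ abs_ge_self])
      then have bdd: "bounded (range F')" by (auto simp: bounded_iff)
      have o: "has_infinite_volume_average \<mu>\<^sub>o F' L" by (rule O.has_average_cong[OF F'm Fm eq avg])
      then have "average_exists \<mu>\<^sub>o F'" by (auto simp: average_exists_def)
      then have ex: "average_exists \<mu> F'" and "average \<mu> F' = average \<mu>\<^sub>o F'" using same[OF F'm bdd] by auto
      then have "has_infinite_volume_average \<mu> F' L"
        using M.has_average[OF ex] O.average_eq[OF o] by simp
      moreover have "AE x in lborel. F x = F' x" using eq by eventually_elim simp
      ultimately show ?thesis by (intro M.has_average_cong[OF Fm F'm])
    qed
    have avg: "has_infinite_volume_average \<mu> F (average \<mu>\<^sub>o F)" if "F \<in> G2 a" for F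
      by (rule transfer[OF LM.G2_average(1)[OF that] O.has_average[OF LM.G2_average(2)[OF that]]])
    have local: "\<exists>R. \<forall>x. R < \<bar>x\<bar> \<longrightarrow> (T' ^^ n) x = (T\<^sub>1 ^^ n) x" for n
    proof -
      define D where "D = a * (real_of_int N\<^sub>1 + 1)"
      have D: "D \<ge> 0" unfolding D_def using a L.N_nonneg by simp
      have disp: "\<bar>(T\<^sub>1 ^^ m) x - x\<bar> \<le> D * real m" for m x
      proof (induction m)
        case (Suc m)
        have "\<bar>T\<^sub>1 ((T\<^sub>1 ^^ m) x) - (T\<^sub>1 ^^ m) x\<bar> \<le> D" unfolding D_def by (rule L.T_bounded_displacement)
        then show ?case using Suc by (simp add: algebra_simps)
      qed simp
      \<comment> \<open>In \<open>n\<close> steps the lift moves a point by at most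
        \<open>D * n\<close>, so a point beyond \<open>R\<close> stays outside the modified cells
        throughout; \<open>k + 1\<close> instead of \<open>k\<close> allows for the width of the
        outermost cell.\<close>
      define R where "R = a * (real_of_int k + 1) + D * real n"
      have "(T' ^^ m) x = (T\<^sub>1 ^^ m) x" if x: "R < \<bar>x\<bar>" and "m \<le> n" for x m
        using \<open>m \<le> n\<close>
      proof (induction m)
        case (Suc m)
        let ?y = "(T\<^sub>1 ^^ m) x"
        have "D * real m \<le> D * real n" using Suc.prems D by (intro mult_left_mono) auto
        then have "a * (real_of_int k + 1) < \<bar>?y\<bar>" using disp[of m x] x unfolding R_def by linarith
        then have "real_of_int k + 1 < \<bar>?y\<bar> / a" using a by (simp add: field_simps)
        then have "real_of_int k + 1 < \<bar>?y / a\<bar>" using a by (simp add: abs_divide)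
        then have "k < \<bar>\<lfloor>?y / a\<rfloor>\<bar>" by linarith
        then have "T' ?y = T\<^sub>1 ?y" by (rule Tm.agree)
        then show ?case using Suc by simp
      qed simp
      then show ?thesis by blast
    qed
    show ?thesis
      unfolding GGM1_def
    proof (intro conjI ballI)
      show "average_exists \<mu> F" if "F \<in> G2 a" for F using avg[OF that] by (auto simp: average_exists_def)
      fix F G assume F: "F \<in> G2 a" and G: "G \<in> G2 a"
      note FL = LM.G2_average(1)[OF F] and GL = LM.G2_average(1)[OF G]
      obtain h where h: "\<And>n. has_infinite_volume_average \<mu>\<^sub>o (\<lambda>x. F ((T\<^sub>1 ^^ n) x) * G x) (h n)"
        "h \<longlonglongrightarrow> average \<mu>\<^sub>o F * average \<mu>\<^sub>o G"
        using LM.G2_mixing[OF F G] by blast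
      \<comment> \<open>The iterates are compared under \<open>\<mu>\<^sub>o\<close>, where bounded
        sets are negligible by translation invariance; only then is the average transferred to
        \<open>\<mu>\<close>.\<close>
      have hn: "has_infinite_volume_average \<mu> (\<lambda>x. F ((T ^^ n) x) * G x) (h n)" for n
      proof (rule transfer)
        have Fb: "F \<in> borel_measurable borel" using FL by (simp add: L_infinity_def)
        obtain K where "AE x in lborel. norm (F x) \<le> K" using FL by (auto simp: L_infinity_def)
        from T'.AE_Tn[OF this] have "AE x in lborel. norm (F ((T ^^ n) x)) \<le> K"
          using Tn_eq by eventually_elim simp
        then have "(\<lambda>x. F ((T ^^ n) x)) \<in> L_infinity lborel"
          unfolding L_infinity_def using measurable_compose[OF Tn_meas Fb, of n] by auto
        then show PL: "(\<lambda>x. F ((T ^^ n) x) * G x) \<in> L_infinity lborel" by (rule L_infinity_mult[OF _ GL])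
        obtain R where R: "\<And>x. R < \<bar>x\<bar> \<Longrightarrow> (T' ^^ n) x = (T\<^sub>1 ^^ n) x" using local by blast
        have eq: "AE x in lborel. R < \<bar>x\<bar> \<longrightarrow> F ((T ^^ n) x) * G x = F ((T\<^sub>1 ^^ n) x) * G x"
          using Tn_eq by eventually_elim (simp add: R)
        show "has_infinite_volume_average \<mu>\<^sub>o (\<lambda>x. F ((T ^^ n) x) * G x) (h n)"
          by (rule O.has_average_eq_outside[OF PL _ eq h(1)]) (intro L_infinity_mult LA.L_infinity_Tn FL GL)
      qed
      show "\<forall>\<^sub>F n in sequentially. average_exists \<mu> (\<lambda>x. F ((T ^^ n) x) * G x)"
        using hn by (intro always_eventually allI) (auto simp: average_exists_def)
      show "(\<lambda>n. average \<mu> (\<lambda>x. F ((T ^^ n) x) * G x)) \<longlonglongrightarrow> average \<mu> F * average \<mu> G"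
        using h(2) by (simp add: M.average_eq[OF hn] M.average_eq[OF avg[OF F]] M.average_eq[OF avg[OF G]])
    qed
  qed
  ultimately show ?thesis by blast
qed

end
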